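(* Let $\Omega\subset\mathbb{R}^n$ be open, let $F\in\mathcal{DM}^p(\Omega)$ for $1\le p\le\infty$, and let $U\subset\Omega$ be a bounded open set such that $\mathscr{M}_*^{n-1}(\partial U)<\infty$. Assume that $\mathrm{div}F$ has compact support in $U$ and that $$F(x)=\frac{1}{n\omega_n}\int_\Omega\frac{x-y}{|x-y|^n}\,d\,\mathrm{div}F(y)\qquad\text{for }\mathcal{L}^n\text{-a.e. }x\in\Omega.$$ Then $\langle F\cdot\nu,\cdot\rangle_{\partial U}\in\mathcal{M}(\partial U)$. Similarly, if $K\subset\Omega$ is a compact set such that $\mathscr{M}_*^{n-1}(\partial K)<\infty$, then $\langle F\cdot\nu,\cdot\rangle_{\partial K}\in\mathcal{M}(\partial K)$, which is in particular true for $K=\overline U$ if $U\Subset\Omega$.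
   Context: $\mathcal{DM}^p(\Omega)$ is the space of vector fields $F\in L^p(\Omega;\mathbb{R}^n)$ whose distributional divergence $\mathrm{div}F$ is a real finite Radon measure on $\Omega$. $\mathcal{L}^n$ is the Lebesgue measure and $\omega_n$ is the Lebesgue measure of the unit ball of $\mathbb{R}^n$. For a closed set $C\subset\mathbb{R}^n$, the (lower) $(n-1)$-dimensional Minkowski content is $\mathscr{M}_*^{n-1}(C):=\liminf_{\varepsilon\to0}\frac{|C+B(0,\varepsilon)|}{2\varepsilon}$. The normal trace of $F$ on the boundary of a bounded Borel set $E\subset\Omega$ is $\langle F\cdot\nu,\phi\rangle_{\partial E}:=\int_E\phi\,d\,\mathrm{div}F+\int_EF\cdot\nabla\phi\,dx$ for $\phi\in\mathrm{Lip}_c(\mathbb{R}^n)$ (Lipschitz functions with compact support), and $\langle F\cdot\nu,\cdot\rangle_{\partial E}\in\mathcal{M}(\partial E)$ means that it is represented by a Radon measure on $\partial E$. $A\Subset\Omega$ means that the closure of $A$ is a compact subset of $\Omega$.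
   Formalization: In the part on compact K, the support of div F is assumed not to meet ∂K; without this the claim fails, e.g. div F = δ_0 and K = {0} together with closed annuli 2^(-2i-1) ≤ |x| ≤ 2^(-2i) accumulating at 0 (n ≥ 2). *)

theory Defs
  imports "HOL-Analysis.Analysis"
begin

section \<open>Finite signed Radon measures\<close>

text \<open>
  A real finite Radon measure on a Borel set S is a countably additive real function on the
  Borel subsets of S; it is represented by a function on all sets whose values outside the
  Borel subsets of S are irrelevant.  Below, S is always open or closed, so regularity and
  finiteness of the total variation are automatic.
\<close>

definition signed_radon_measure :: "'a::euclidean_space set \<Rightarrow> ('a set \<Rightarrow> real) \<Rightarrow> bool" where
  "signed_radon_measure S \<mu> \<longleftrightarrow>
     (\<forall>A :: nat \<Rightarrow> 'a set. (\<forall>i. A i \<in> sets borel \<and> A i \<subseteq> S) \<longrightarrow> disjoint_family A \<longrightarrow>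
        (\<lambda>i. \<mu> (A i)) sums \<mu> (\<Union>i. A i))"

text \<open>
  The positive part of the Jordan decomposition, as a Borel measure on the whole space that is
  concentrated on S.  Since \<open>ennreal\<close> truncates negative values to 0, the supremum is the usual
  upper variation.  The negative part is the positive part of \<open>- \<mu>\<close>.
\<close>

definition pos_part_measure :: "'a::euclidean_space set \<Rightarrow> ('a set \<Rightarrow> real) \<Rightarrow> 'a measure" where
  "pos_part_measure S \<mu> =
     measure_of UNIV (sets borel) (\<lambda>A. SUP B\<in>{B \<in> sets borel. B \<subseteq> A \<inter> S}. ennreal (\<mu> B))"

definition signed_integral ::
  "'a::euclidean_space set \<Rightarrow> ('a set \<Rightarrow> real) \<Rightarrow> ('a \<Rightarrow> 'b::{banach, second_countable_topology}) \<Rightarrow> 'b"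
  where
  "signed_integral S \<mu> f =
     integral\<^sup>L (pos_part_measure S \<mu>) f - integral\<^sup>L (pos_part_measure S (\<lambda>A. - \<mu> A)) f"

text \<open>The support, relative to S: the complement in S of the largest relatively open null set.\<close>

definition signed_support :: "'a::euclidean_space set \<Rightarrow> ('a set \<Rightarrow> real) \<Rightarrow> 'a set" where
  "signed_support S \<mu> =
     {x \<in> S. \<forall>V. open V \<longrightarrow> x \<in> V \<longrightarrow> (\<exists>B \<in> sets borel. B \<subseteq> V \<inter> S \<and> \<mu> B \<noteq> 0)}"

section \<open>Test functions and gradients\<close>

definition partial_deriv :: "'a::euclidean_space \<Rightarrow> ('a \<Rightarrow> real) \<Rightarrow> 'a \<Rightarrow> real" where
  "partial_deriv b \<phi> x = deriv (\<lambda>t. \<phi> (x + t *\<^sub>R b)) 0"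

text \<open>
  For Lipschitz functions this is the gradient almost everywhere (Rademacher); on the
  exceptional null set the value is arbitrary.
\<close>

definition grad :: "('a::euclidean_space \<Rightarrow> real) \<Rightarrow> 'a \<Rightarrow> 'a" where
  "grad \<phi> x = (\<Sum>b\<in>Basis. partial_deriv b \<phi> x *\<^sub>R b)"

primrec Ck :: "nat \<Rightarrow> ('a::euclidean_space \<Rightarrow> real) \<Rightarrow> bool" where
  "Ck 0 \<phi> \<longleftrightarrow> continuous_on UNIV \<phi>"
| "Ck (Suc k) \<phi> \<longleftrightarrow> continuous_on UNIV \<phi> \<and>
     (\<forall>b\<in>Basis. (\<forall>x. (\<lambda>t. \<phi> (x + t *\<^sub>R b)) differentiable at 0) \<and> Ck k (partial_deriv b \<phi>))"

definition Cc_infinity :: "'a::euclidean_space set \<Rightarrow> ('a \<Rightarrow> real) set" where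
  "Cc_infinity \<Omega> =
     {\<phi>. (\<forall>k. Ck k \<phi>) \<and> compact (closure {x. \<phi> x \<noteq> 0}) \<and> closure {x. \<phi> x \<noteq> 0} \<subseteq> \<Omega>}"

definition Lip_c :: "('a::euclidean_space \<Rightarrow> real) set" where
  "Lip_c = {\<phi>. (\<exists>L. L-lipschitz_on UNIV \<phi>) \<and> compact (closure {x. \<phi> x \<noteq> 0})}"

section \<open>Divergence-measure fields\<close>

definition Lp_field :: "ennreal \<Rightarrow> 'a::euclidean_space set \<Rightarrow> ('a \<Rightarrow> 'a) \<Rightarrow> bool" where
  "Lp_field p \<Omega> F \<longleftrightarrow> F \<in> borel_measurable (lebesgue_on \<Omega>) \<and>
     (if p = \<infinity> then \<exists>C. AE x in lebesgue_on \<Omega>. norm (F x) \<le> C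
      else integrable (lebesgue_on \<Omega>) (\<lambda>x. norm (F x) powr enn2real p))"

definition is_divergence :: "'a::euclidean_space set \<Rightarrow> ('a \<Rightarrow> 'a) \<Rightarrow> ('a set \<Rightarrow> real) \<Rightarrow> bool" where
  "is_divergence \<Omega> F \<mu> \<longleftrightarrow> signed_radon_measure \<Omega> \<mu> \<and>
     (\<forall>\<phi> \<in> Cc_infinity \<Omega>. (LINT x:\<Omega>|lebesgue. F x \<bullet> grad \<phi> x) = - signed_integral \<Omega> \<mu> \<phi>)"

definition DM :: "ennreal \<Rightarrow> 'a::euclidean_space set \<Rightarrow> ('a \<Rightarrow> 'a) set" where
  "DM p \<Omega> = {F. Lp_field p \<Omega> F \<and> (\<exists>\<mu>. is_divergence \<Omega> F \<mu>)}"

text \<open>The choice is unique on the Borel subsets of \<open>\<Omega>\<close>.\<close>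

definition div_measure :: "'a::euclidean_space set \<Rightarrow> ('a \<Rightarrow> 'a) \<Rightarrow> 'a set \<Rightarrow> real" where
  "div_measure \<Omega> F = (SOME \<mu>. is_divergence \<Omega> F \<mu>)"

section \<open>Minkowski content and normal traces\<close>

definition lower_minkowski_content :: "'a::euclidean_space set \<Rightarrow> ennreal" where
  "lower_minkowski_content C =
     Liminf (at_right 0) (\<lambda>\<epsilon>::real. emeasure lebesgue (C + ball 0 \<epsilon>) / ennreal (2 * \<epsilon>))"

definition normal_trace ::
  "'a::euclidean_space set \<Rightarrow> ('a \<Rightarrow> 'a) \<Rightarrow> 'a set \<Rightarrow> ('a \<Rightarrow> real) \<Rightarrow> real" where
  "normal_trace \<Omega> F E \<phi> =
     signed_integral \<Omega> (div_measure \<Omega> F) (\<lambda>x. indicator E x * \<phi> x)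
     + (LINT x:E|lebesgue. F x \<bullet> grad \<phi> x)"

definition normal_trace_is_measure :: "'a::euclidean_space set \<Rightarrow> ('a \<Rightarrow> 'a) \<Rightarrow> 'a set \<Rightarrow> bool" where
  "normal_trace_is_measure \<Omega> F E \<longleftrightarrow>
     (\<exists>\<sigma>. signed_radon_measure (frontier E) \<sigma> \<and>
          (\<forall>\<phi> \<in> Lip_c. normal_trace \<Omega> F E \<phi> = signed_integral (frontier E) \<sigma> \<phi>))"

end

theory Submission
  imports Defs "HOL-Probability.Helly_Selection"
begin

text \<open>
  The field \<open>F\<close> is extended from \<open>\<Omega>\<close> to the whole space as the convolution of \<open>div F\<close> with
  \<open>k(z) = z / |z| ^ n\<close>, divided by \<open>n\<close> times the volume of the unit ball. Replacing \<open>|z|\<close> by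
  \<open>max |z| \<delta>\<close> in the denominator makes \<open>k\<close> Lipschitz, with divergence \<open>n / \<delta> ^ n\<close> times the
  indicator of the ball of radius \<open>\<delta>\<close>; letting \<open>\<delta>\<close> tend to 0 yields the divergence theorem for the
  extended field against all compactly supported Lipschitz functions.

  Let \<open>\<psi>\<^sub>\<epsilon>\<close> be Lipschitz cutoffs with constant \<open>2 / \<epsilon>\<close> tending to the indicator of \<open>E\<close> and locally
  constant off the \<open>\<epsilon>\<close>-neighbourhood of the boundary. Testing with \<open>\<psi>\<^sub>\<epsilon> \<phi>\<close> shows that the normal trace
  at \<open>\<phi>\<close> is the limit of the integrals of \<open>- \<phi> F \<bullet> grad \<psi>\<^sub>\<epsilon>\<close>. Since \<open>div F\<close> is supported away
  from the boundary, \<open>F\<close> is bounded near it, so along a sequence realising the lower Minkowski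
  content the \<open>L\<^sup>1\<close> norms of \<open>F \<bullet> grad \<psi>\<^sub>\<epsilon>\<close> stay bounded, and a weak limit of these densities
  represents the trace.
\<close>

section \<open>Almost everywhere differentiability of Lipschitz functions along lines\<close>

text \<open>\<open>grad\<close> is assembled from derivatives along the basis vectors, and the
  cutoffs are distance functions, hence merely Lipschitz. Integration by parts therefore rests on
  difference quotients and on almost everywhere differentiability along each direction, which
  reduces to monotone functions of one variable.

  The cutoffs approach an open set from inside and a compact set from outside, so that they converge
  to the indicator at every point, frontier included.

  Helly's selection theorem concerns the line, so a ball of the space is coded into [0, 1]. A
  continuous injection is out of reach in higher dimension, but only the decoding map has to be
  continuous, because test functions are composed with it; the coding map need only be Borel. The
  Cantor set offers this: its ternary digits can be read off by continuous functions.

  The weak limit is a difference of two measures that need not be mutually singular, whereas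
  \<open>signed_integral\<close> is defined by upper variations. A Hahn set reconciles the
  two.\<close>

lemma continuous_on_if_increments_le:
  fixes f :: "real \<Rightarrow> real"
  assumes mono: "\<And>x y. x \<le> y \<Longrightarrow> f x \<le> f y"
    and le: "\<And>x y. x \<le> y \<Longrightarrow> f y - f x \<le> y - x"
  shows "continuous_on UNIV f"
proof -
  have "1-lipschitz_on UNIV f"
  proof (rule lipschitz_onI)
    fix x y show "dist (f x) (f y) \<le> 1 * dist x y"
      using mono[of x y] mono[of y x] le[of x y] le[of y x] by (cases "x \<le> y") (auto simp: dist_real_def)
  qed simp
  then show ?thesis by (rule lipschitz_on_continuous_on)
qed

text \<open>The complementary function \<open>x - f x\<close> is nondecreasing and continuous as
  well. The two Stieltjes measures add up to a measure that gives every box its length, which is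
  Lebesgue measure by uniqueness; each summand is therefore dominated by it.\<close>

lemma interval_measure_le_lborel:
  fixes f :: "real \<Rightarrow> real"
  assumes mono: "\<And>x y. x \<le> y \<Longrightarrow> f x \<le> f y"
    and le: "\<And>x y. x \<le> y \<Longrightarrow> f y - f x \<le> y - x"
    and A: "A \<in> sets borel"
  shows "emeasure (interval_measure f) A \<le> emeasure lborel A"
proof -
  define g where "g x = x - f x" for x
  have cf: "continuous_on UNIV f" by (rule continuous_on_if_increments_le[OF mono le])
  have cg: "continuous_on UNIV g" unfolding g_def by (intro continuous_intros cf)
  have mg: "\<And>x y. x \<le> y \<Longrightarrow> g x \<le> g y" using le by (force simp: g_def)
  define m where "m A = emeasure (interval_measure f) A + emeasure (interval_measure g) A" for A
  define M where "M = measure_of UNIV (sets borel) m"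
  have ms: "measure_space UNIV (sets borel) m"
  proof -
    have "countably_additive (sets borel) m"
    proof (rule countably_additiveI)
      fix A :: "nat \<Rightarrow> real set"
      assume A: "range A \<subseteq> sets borel" "disjoint_family A" "(\<Union>i. A i) \<in> sets borel"
      show "(\<Sum>i. m (A i)) = m (\<Union>i. A i)"
        using A unfolding m_def by (subst suminf_add[symmetric]) (auto simp: suminf_emeasure)
    qed
    then show ?thesis
      using sets.sigma_algebra_axioms[of "borel :: real measure"]
      by (auto simp: measure_space_def m_def positive_def)
  qed
  have eM: "emeasure M A = m A" if "A \<in> sets borel" for A
    unfolding M_def using that ms
    by (subst emeasure_measure_of_sigma) (auto simp: measure_space_def)
  \<comment> \<open>Boxes on the line are open intervals; the endpoints carry no mass because
    \<open>h\<close> is continuous.\<close>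
  have Icc: "emeasure (interval_measure h) {l<..<u} = h u - h l"
    if "l \<le> u" and mono: "\<And>x y. x \<le> y \<Longrightarrow> h x \<le> h y" and cont: "continuous_on UNIV h"
    for h :: "real \<Rightarrow> real" and l u
  proof -
    have *: "emeasure (interval_measure h) {x} = 0" for x
      using emeasure_interval_measure_Icc[of x x h, OF _ mono cont] by simp
    have "emeasure (interval_measure h) {l<..<u} = emeasure (interval_measure h) {l..u}"
    proof (rule emeasure_eq_AE)
      have "AE x in interval_measure h. x \<notin> {l}" "AE x in interval_measure h. x \<notin> {u}"
        by (rule AE_not_in, simp add: null_sets_def *)+
      then show "AE x in interval_measure h. (x \<in> {l<..<u}) = (x \<in> {l..u})"
        by eventually_elim auto
    qed auto
    then show ?thesis using emeasure_interval_measure_Icc[OF \<open>l \<le> u\<close> mono cont] by simp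
  qed
  have "lborel = M"
  proof (rule lborel_eqI)
    fix l u :: real assume "\<And>b. b \<in> Basis \<Longrightarrow> l \<bullet> b \<le> u \<bullet> b"
    then have lu: "l \<le> u" by simp
    show "emeasure M (box l u) = ennreal (\<Prod>b\<in>Basis. (u - l) \<bullet> b)"
      using lu mono[OF lu] mg[OF lu]
      by (auto simp: eM m_def Icc[OF lu mono cf] Icc[OF lu mg cg] ennreal_plus[symmetric] g_def
          simp del: ennreal_plus)
  qed (use sets.sigma_sets_eq[of "borel :: real measure"] in \<open>simp add: M_def\<close>)
  then show ?thesis using eM[OF A] by (simp add: m_def)
qed

text \<open>Vitali's theorem selects countably many disjoint intervals from the fine cover, all
  inside an open set that exceeds \<open>E\<close> by little. What they miss of \<open>E\<close> is
  Lebesgue null, hence null for \<open>M\<close>; what they cover outside \<open>E\<close> has small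
  Lebesgue measure, hence small measure for \<open>N\<close>. These are the roles of the two
  dominations by Lebesgue measure.\<close>

lemma measure_le_of_fine_cover:
  fixes M N :: "real measure"
  assumes sM: "sets M = sets borel" and sN: "sets N = sets borel"
    and leM: "\<And>A. A \<in> sets borel \<Longrightarrow> emeasure M A \<le> emeasure lborel A"
    and leN: "\<And>A. A \<in> sets borel \<Longrightarrow> emeasure N A \<le> emeasure lborel A"
    and E: "E \<in> sets borel"
    and cov: "\<And>x d. x \<in> E \<Longrightarrow> 0 < d \<Longrightarrow>
       \<exists>a b. a < b \<and> a \<le> x \<and> x \<le> b \<and> b - a < d \<and> emeasure M {a..b} \<le> emeasure N {a..b}"
  shows "emeasure M E \<le> emeasure N E"
proof (rule ennreal_le_epsilon)
  fix e :: real assume e: "0 < e"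
  obtain U where U: "open U" "E \<subseteq> U" "emeasure lborel (U - E) < e"
    by (rule outer_regular_lborel[OF E e])
  have Ub: "U \<in> sets borel" using U by auto
  define K where "K = {(a::real, b::real). a < b \<and> {a..b} \<subseteq> U \<and> emeasure M {a..b} \<le> emeasure N {a..b}}"
  \<comment> \<open>The covering theorem speaks of balls, so an interval is encoded by its midpoint
    and half its length.\<close>
  define c where "c = (\<lambda>(a::real, b). (a + b) / 2)"
  define r where "r = (\<lambda>(a::real, b). (b - a) / 2)"
  have cb: "cball (c i) (r i) = {fst i .. snd i}" for i
    by (cases i) (auto simp: c_def r_def cball_def dist_real_def abs_le_iff field_simps)
  obtain C where C: "countable C" "C \<subseteq> K"
     "pairwise (\<lambda>i j. disjnt (cball (c i) (r i)) (cball (c j) (r j))) C"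
     and neg: "negligible (E - (\<Union>i \<in> C. cball (c i) (r i)))"
  proof (rule Vitali_covering_theorem_cballs[of K r E c])
    fix i assume "i \<in> K" then show "0 < r i" by (auto simp: K_def r_def)
  next
    fix x d :: real assume x: "x \<in> E" and d: "0 < d"
    obtain d' where d': "0 < d'" "ball x d' \<subseteq> U" using U x by (meson openE subsetD)
    obtain a b where ab: "a < b" "a \<le> x" "x \<le> b" "b - a < min d d'" "emeasure M {a..b} \<le> emeasure N {a..b}"
      using cov[OF x, of "min d d'"] d d' by auto
    have "{a..b} \<subseteq> ball x d'" using ab by (auto simp: dist_real_def)
    then have "(a, b) \<in> K" using ab d' by (auto simp: K_def)
    moreover have "r (a, b) < d" using ab by (auto simp: r_def)
    ultimately show "\<exists>i. i \<in> K \<and> x \<in> cball (c i) (r i) \<and> r i < d"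
      using ab cb[of "(a, b)"] by (intro exI[of _ "(a, b)"]) auto
  qed blast
  define I where "I i = {fst i .. snd i}" for i :: "real \<times> real"
  define W where "W = (\<Union>i\<in>C. I i)"
  have Ib: "I i \<in> sets borel" for i by (auto simp: I_def)
  have Wb: "W \<in> sets borel" unfolding W_def using C(1) Ib by (intro sets.countable_UN') auto
  have dj: "disjoint_family_on I C"
    using C(3) unfolding cb disjoint_family_on_def pairwise_def disjnt_def I_def by blast
  have WU: "W \<subseteq> U" using C(2) unfolding W_def I_def K_def by fastforce
  have sum: "emeasure L W = (\<integral>\<^sup>+i. emeasure L (I i) \<partial>count_space C)"
    if "sets L = sets borel" for L :: "real measure"
    unfolding W_def using C(1) dj Ib that by (intro emeasure_UN_countable) auto
  have null: "emeasure M (E - W) = 0"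
  proof -
    have "emeasure lborel (E - W) = 0"
      using neg E Wb unfolding cb negligible_iff_null_sets W_def I_def
      by (auto simp: null_sets_def emeasure_completion)
    then show ?thesis using leM[of "E - W"] E Wb by auto
  qed
  have "emeasure M E \<le> emeasure M (W \<union> (E - W))"
    using E Wb by (intro emeasure_mono) (auto simp: sM)
  also have "\<dots> \<le> emeasure M W + emeasure M (E - W)"
    using E Wb by (intro emeasure_subadditive) (auto simp: sM)
  also have "\<dots> = emeasure M W" using null by simp
  also have "\<dots> \<le> emeasure N W" unfolding sum[OF sM] sum[OF sN]
    using C(2) by (intro nn_integral_mono) (auto simp: K_def I_def)
  also have "\<dots> \<le> emeasure N (E \<union> (U - E))"
    using WU U(1) E by (intro emeasure_mono) (auto simp: sN)
  also have "\<dots> \<le> emeasure N E + emeasure N (U - E)"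
    using E Ub by (intro emeasure_subadditive) (auto simp: sN)
  also have "\<dots> \<le> emeasure N E + e"
    using leN[of "U - E"] U(3) E Ub by (intro add_left_mono) auto
  finally show "emeasure M E \<le> emeasure N E + ennreal e" .
qed

text \<open>The bound keeps the lower and upper limits of the quotients finite, so the derivative
  fails to exist exactly when two numbers separate them. Rational thresholds make the exceptional
  set a countable union.\<close>

lemma not_differentiable_quotients:
  fixes u :: "real \<Rightarrow> real"
  assumes bd: "\<And>h. \<bar>u h - u 0\<bar> \<le> L * \<bar>h\<bar>"
  shows "\<not> u differentiable at 0 \<longleftrightarrow>
    (\<exists>p\<in>\<rat>. \<exists>q\<in>\<rat>. p < q \<and> (\<exists>\<^sub>F h in at 0. (u h - u 0) / h < p) \<and> (\<exists>\<^sub>F h in at 0. q < (u h - u 0) / h))"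
proof -
  define Q where "Q h = (u h - u 0) / h" for h
  have Qb: "\<bar>Q h\<bar> \<le> \<bar>L\<bar>" for h
  proof (cases "h = 0")
    case False
    have "\<bar>u h - u 0\<bar> \<le> \<bar>L\<bar> * \<bar>h\<bar>" using bd[of h] by (smt (verit) mult_right_mono abs_ge_zero)
    then show ?thesis using False by (simp add: Q_def abs_divide divide_le_eq)
  qed (simp add: Q_def)
  have diff: "u differentiable at 0 \<longleftrightarrow> (\<exists>D. (Q \<longlongrightarrow> D) (at 0))"
    unfolding real_differentiable_def DERIV_def Q_def by simp
  show ?thesis
  proof
    assume nd: "\<not> u differentiable at 0"
    \<comment> \<open>The extended reals are a complete lattice, so lower and upper limits exist
      there unconditionally.\<close>
    define q where "q h = ereal (Q h)" for h
    have bl: "- \<bar>L\<bar> \<le> Liminf (at 0) q"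
      by (rule Liminf_bounded) (use Qb in \<open>auto simp: q_def abs_le_iff intro!: always_eventually; fail | auto simp: q_def minus_le_iff abs_le_iff\<close>)
    have bu: "Limsup (at 0) q \<le> \<bar>L\<bar>"
      by (rule Limsup_bounded) (use Qb in \<open>auto simp: q_def abs_le_iff\<close>)
    have "Liminf (at 0) q \<noteq> Limsup (at 0) q"
    proof
      assume eq: "Liminf (at 0) q = Limsup (at 0) q"
      then have "\<bar>Liminf (at 0) q\<bar> \<noteq> \<infinity>" using bl bu
        by (cases "Liminf (at 0) q") auto
      then obtain D where D: "Liminf (at 0) q = ereal D" by (metis ereal_real)
      have "(q \<longlongrightarrow> ereal D) (at 0)"
        by (rule Liminf_eq_Limsup) (use eq D in auto)
      then have "(Q \<longlongrightarrow> D) (at 0)" by (simp add: q_def[abs_def])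
      then show False using nd diff by blast
    qed
    then have "Liminf (at 0) q < Limsup (at 0) q"
      using Liminf_le_Limsup[of "at (0::real)" q] by auto
    then obtain a where a: "Liminf (at 0) q < ereal a" "ereal a < Limsup (at 0) q"
      by (metis ereal_dense2)
    obtain b where b: "ereal a < ereal b" "ereal b < Limsup (at 0) q"
      by (metis ereal_dense2 a(2))
    obtain p where p: "p \<in> \<rat>" "a < p" "p < (a + b) / 2"
      using Rats_dense_in_real[of a "(a+b)/2"] b by auto
    obtain r where r: "r \<in> \<rat>" "(a+b)/2 < r" "r < b"
      using Rats_dense_in_real[of "(a+b)/2" b] b by auto
    have 1: "\<exists>\<^sub>F h in at 0. Q h < p"
    proof (rule ccontr)
      assume "\<not> ?thesis"
      then have "eventually (\<lambda>h. ereal p \<le> q h) (at 0)"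
        by (simp add: not_frequently q_def not_less)
      from Liminf_bounded[OF this] a p show False
        by (meson ereal_less_eq(3) leD less_imp_le order_trans)
    qed
    have 2: "\<exists>\<^sub>F h in at 0. r < Q h"
    proof (rule ccontr)
      assume "\<not> ?thesis"
      then have "eventually (\<lambda>h. q h \<le> ereal r) (at 0)"
        by (simp add: not_frequently q_def not_less)
      from Limsup_bounded[OF this] b r show False
        by (meson ereal_less_eq(3) leD less_imp_le order_trans)
    qed
    show "\<exists>p\<in>\<rat>. \<exists>q\<in>\<rat>. p < q \<and> (\<exists>\<^sub>F h in at 0. (u h - u 0) / h < p) \<and> (\<exists>\<^sub>F h in at 0. q < (u h - u 0) / h)"
      using 1 2 p r unfolding Q_def by (intro bexI[of _ p] bexI[of _ r]) auto
  next
    assume "\<exists>p\<in>\<rat>. \<exists>q\<in>\<rat>. p < q \<and> (\<exists>\<^sub>F h in at 0. (u h - u 0) / h < p) \<and> (\<exists>\<^sub>F h in at 0. q < (u h - u 0) / h)"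
    then obtain p q where pq: "p < q" "\<exists>\<^sub>F h in at 0. Q h < p" "\<exists>\<^sub>F h in at 0. q < Q h"
      by (auto simp: Q_def)
    show "\<not> u differentiable at 0"
    proof
      assume "u differentiable at 0"
      then obtain D where D: "(Q \<longlongrightarrow> D) (at 0)" using diff by auto
      have "D \<le> p"
      proof (rule ccontr)
        assume "\<not> D \<le> p" then have "eventually (\<lambda>h. p < Q h) (at 0)" using D by (auto intro: order_tendstoD)
        then have "eventually (\<lambda>h. \<not> Q h < p) (at 0)" by eventually_elim auto
        then show False using pq(2) by (simp add: frequently_def)
      qed
      moreover have "q \<le> D"
      proof (rule ccontr)
        assume "\<not> q \<le> D" then have "eventually (\<lambda>h. Q h < q) (at 0)" using D by (auto intro: order_tendstoD)
        then have "eventually (\<lambda>h. \<not> q < Q h) (at 0)" by eventually_elim auto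
        then show False using pq(3) by (simp add: frequently_def)
      qed
      ultimately show False using pq(1) by simp
    qed
  qed
qed

text \<open>Uncountably many increments enter the condition, but each contributes an open set of
  points. Their union is open, and only the smallness of the increments calls for a countable
  intersection.\<close>

lemma borel_frequently_less:
  fixes Q :: "real \<Rightarrow> 'a::euclidean_space \<Rightarrow> real"
  assumes "\<And>h. h \<noteq> 0 \<Longrightarrow> continuous_on UNIV (Q h)"
  shows "{x. \<exists>\<^sub>F h in at 0. Q h x < p} \<in> sets borel"
proof -
  have eq: "{x. \<exists>\<^sub>F h in at 0. Q h x < p} =
     (\<Inter>m::nat. \<Union>h\<in>{h. h \<noteq> 0 \<and> \<bar>h\<bar> < inverse (Suc m)}. {x. Q h x < p})" (is "?A = ?B")
  proof (intro set_eqI iffI)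
    fix x assume x: "x \<in> ?A"
    show "x \<in> ?B"
    proof
      fix m
      have "\<exists>h. h \<noteq> 0 \<and> \<bar>h\<bar> < inverse (Suc m) \<and> Q h x < p"
        using x unfolding frequently_def eventually_at
        by (auto simp: dist_real_def dest!: spec[of _ "inverse (Suc m)"])
      then show "x \<in> (\<Union>h\<in>{h. h \<noteq> 0 \<and> \<bar>h\<bar> < inverse (Suc m)}. {x. Q h x < p})" by auto
    qed
  next
    fix x assume x: "x \<in> ?B"
    show "x \<in> ?A"
      unfolding frequently_def eventually_at mem_Collect_eq
    proof clarify
      fix d :: real assume d: "0 < d" and *: "\<forall>xa\<in>UNIV. xa \<noteq> 0 \<and> dist xa 0 < d \<longrightarrow> \<not> Q xa x < p"
      obtain m where m: "inverse (real (Suc m)) < d" using d reals_Archimedean by blast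
      obtain h where "h \<noteq> 0" "\<bar>h\<bar> < inverse (Suc m)" "Q h x < p" using x by auto
      then show False using * m by (auto simp: dist_real_def)
    qed
  qed
  have "open (\<Union>h\<in>{h. h \<noteq> 0 \<and> \<bar>h\<bar> < inverse (Suc m)}. {x. Q h x < p})" for m :: nat
    by (intro open_UN ballI open_Collect_less assms continuous_on_const) auto
  then show ?thesis unfolding eq by (intro sets.countable_INT') auto
qed

lemma borel_not_differentiable_along:
  fixes \<phi> :: "'a::euclidean_space \<Rightarrow> real"
  assumes lip: "L-lipschitz_on UNIV \<phi>"
  shows "{x. \<not> (\<lambda>t. \<phi> (x + t *\<^sub>R b)) differentiable at 0} \<in> sets borel"
proof -
  define Q where "Q h x = (\<phi> (x + h *\<^sub>R b) - \<phi> x) / h" for h x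
  have c: "continuous_on UNIV \<phi>" using lip by (rule lipschitz_on_continuous_on)
  have cQ: "continuous_on UNIV (Q h)" if "h \<noteq> 0" for h
    unfolding Q_def using that
    by (intro continuous_intros continuous_on_compose2[OF c]) auto
  have bd: "\<bar>\<phi> (x + h *\<^sub>R b) - \<phi> (x + 0 *\<^sub>R b)\<bar> \<le> (L * norm b) * \<bar>h\<bar>" for x h
    using lipschitz_onD[OF lip, of "x + h *\<^sub>R b" x]
    by (simp add: dist_real_def dist_norm algebra_simps)
  \<comment> \<open>The lower bound \<open>q\<close> on the quotients is written with both signs
    reversed, so that the same measurability lemma serves for both conditions.\<close>
  have "{x. \<not> (\<lambda>t. \<phi> (x + t *\<^sub>R b)) differentiable at 0} =
    (\<Union>p\<in>\<rat>. \<Union>q\<in>\<rat>\<inter>{p<..}. {x. \<exists>\<^sub>F h in at 0. Q h x < p} \<inter> {x. \<exists>\<^sub>F h in at 0. - Q h x < - q})"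
    (is "_ = ?R")
  proof (intro set_eqI)
    fix x
    show "x \<in> {x. \<not> (\<lambda>t. \<phi> (x + t *\<^sub>R b)) differentiable at 0} \<longleftrightarrow> x \<in> ?R"
      using not_differentiable_quotients[of "\<lambda>t. \<phi> (x + t *\<^sub>R b)", OF bd] by (simp add: Q_def) blast
  qed
  also have "?R \<in> sets borel"
  proof -
    have m: "{x. \<exists>\<^sub>F h in at 0. Q h x < p} \<inter> {x. \<exists>\<^sub>F h in at 0. - Q h x < - q} \<in> sets borel" for p q
      by (intro sets.Int borel_frequently_less cQ continuous_on_minus)
    have c: "countable (\<rat> \<inter> {p<..})" for p :: real
      by (rule countable_subset[OF _ countable_rat]) auto
    show ?thesis by (intro sets.countable_UN'' countable_rat c m)
  qed
  finally show ?thesis .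
qed

text \<open>Lebesgue's argument: on \<open>E p q\<close> arbitrarily short intervals have mean slope
  below \<open>p\<close>, so the Stieltjes measure is at most \<open>p\<close> times Lebesgue
  measure there; others have slope above \<open>q\<close>, so it is also at least \<open>q\<close>
  times Lebesgue measure. With \<open>p < q\<close> the set must be null. The normalisation of the
  increments makes the Stieltjes measure dominated by Lebesgue measure, as the covering argument
  requires.\<close>

lemma monotone_lipschitz_differentiable_AE:
  fixes f :: "real \<Rightarrow> real"
  assumes mono: "\<And>x y. x \<le> y \<Longrightarrow> f x \<le> f y"
    and le: "\<And>x y. x \<le> y \<Longrightarrow> f y - f x \<le> y - x"
  shows "AE x in lborel. (\<lambda>t. f (x + t)) differentiable at 0"
proof -
  define \<nu> where "\<nu> = interval_measure f"
  define Q where "Q h x = (f (x + h) - f x) / h" for h x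
  have cf: "continuous_on UNIV f" by (rule continuous_on_if_increments_le[OF mono le])
  have cQ: "continuous_on UNIV (Q h)" if "h \<noteq> 0" for h
    unfolding Q_def using that
    by (intro continuous_intros continuous_on_compose2[OF cf]) auto
  have bd: "\<bar>f (x + h) - f (x + 0)\<bar> \<le> 1 * \<bar>h\<bar>" for x h
    using mono[of x "x+h"] mono[of "x+h" x] le[of x "x+h"] le[of "x+h" x] by (cases "h \<ge> 0") auto
  have Q01: "0 \<le> Q h x" "Q h x \<le> 1" if "h \<noteq> 0" for h x
    using that mono[of x "x+h"] mono[of "x+h" x] le[of x "x+h"] le[of "x+h" x]
    by (cases "h > 0"; auto simp: Q_def field_simps; fail)+
  define E where "E p q = {x. \<exists>\<^sub>F h in at 0. Q h x < p} \<inter> {x. \<exists>\<^sub>F h in at 0. - Q h x < - q}" for p q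
  have Eb: "E p q \<in> sets borel" for p q unfolding E_def
    by (intro sets.Int borel_frequently_less cQ continuous_on_minus)
  have \<nu>le: "emeasure \<nu> A \<le> emeasure lborel A" if "A \<in> sets borel" for A
    unfolding \<nu>_def using that by (intro interval_measure_le_lborel mono le)
  have \<nu>I: "emeasure \<nu> {a..b} = f b - f a" if "a \<le> b" for a b
    unfolding \<nu>_def using that mono cf by (rule emeasure_interval_measure_Icc)
  \<comment> \<open>A quotient with increment \<open>h\<close> is the mean slope of the interval
    between \<open>x\<close> and \<open>x + h\<close>, which lies right or left of \<open>x\<close>
    according to the sign. The predicate \<open>P\<close> stands for either comparison.\<close>
  have cover: "\<exists>a b. a < b \<and> a \<le> x \<and> x \<le> b \<and> b - a < d \<and> P ((f b - f a) / (b - a))"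
    if fr: "\<exists>\<^sub>F h in at 0. P (Q h x)" and d: "0 < d" for P x d
  proof -
    obtain h where h: "h \<noteq> 0" "\<bar>h\<bar> < d" "P (Q h x)"
      using fr d unfolding frequently_def eventually_at by (auto simp: dist_real_def)
    show ?thesis
    proof (cases "h > 0")
      case True then show ?thesis using h by (intro exI[of _ x] exI[of _ "x+h"]) (auto simp: Q_def)
    next
      case False
      have "(f x - f (x + h)) / (x - (x + h)) = Q h x" using h by (simp add: Q_def field_simps)
      then show ?thesis using False h by (intro exI[of _ "x+h"] exI[of _ x]) (auto)
    qed
  qed
  have null: "emeasure lborel (E p q) = 0" if pq: "p < q" for p q
  proof (cases "E p q = {}")
    case False
    then obtain x where x: "x \<in> E p q" by auto
    obtain h where h: "h \<noteq> 0" "Q h x < p"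
      using x unfolding E_def frequently_def eventually_at by (auto dest: spec[of _ 1])
    obtain h' where h': "h' \<noteq> 0" "q < Q h' x"
      using x unfolding E_def frequently_def eventually_at by (auto dest: spec[of _ 1])
    \<comment> \<open>All quotients lie in [0, 1], so a single point of \<open>E p q\<close>
      confines the thresholds; both scaled Lebesgue measures are then below Lebesgue
      measure.\<close>
    have p0: "0 < p" and q1: "q < 1" using h h' Q01[of h x] Q01[of h' x] by auto
    \<comment> \<open>Bounded pieces have finite measure, which allows it to be cancelled from the
      final inequality.\<close>
    have fin: "emeasure lborel (E p q \<inter> {-real k..real k}) = 0" for k
    proof -
      define B where "B = E p q \<inter> {-real k..real k}"
      have Bb: "B \<in> sets borel" using Eb by (auto simp: B_def)
      have scale_le: "emeasure (scale_measure (ennreal r) lborel) A \<le> emeasure lborel A" if "r \<le> 1" for r A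
        using mult_right_mono[of "ennreal r" 1 "emeasure lborel A"] that by auto
      have 1: "emeasure \<nu> B \<le> emeasure (scale_measure (ennreal p) lborel) B"
      proof (rule measure_le_of_fine_cover[OF _ _ \<nu>le scale_le Bb])
        fix x d :: real assume "x \<in> B" "0 < d"
        then have "\<exists>\<^sub>F h in at 0. Q h x < p" by (auto simp: B_def E_def)
        from cover[OF this \<open>0 < d\<close>] obtain a b where ab: "a < b" "a \<le> x" "x \<le> b" "b - a < d" "(f b - f a) / (b - a) < p" by auto
        then have "f b - f a \<le> p * (b - a)" by (simp add: field_simps)
        then show "\<exists>a b. a < b \<and> a \<le> x \<and> x \<le> b \<and> b - a < d \<and> emeasure \<nu> {a..b} \<le> emeasure (scale_measure (ennreal p) lborel) {a..b}"
          using ab p0 by (intro exI[of _ a] exI[of _ b]) (auto simp: \<nu>I ennreal_mult[symmetric] intro!: ennreal_leI)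
      qed (use p0 q1 pq in \<open>auto simp: \<nu>_def\<close>)
      have 2: "emeasure (scale_measure (ennreal q) lborel) B \<le> emeasure \<nu> B"
      proof (rule measure_le_of_fine_cover[OF _ _ scale_le \<nu>le Bb])
        fix x d :: real assume "x \<in> B" "0 < d"
        then have "\<exists>\<^sub>F h in at 0. q < Q h x" by (auto simp: B_def E_def)
        from cover[OF this \<open>0 < d\<close>] obtain a b where ab: "a < b" "a \<le> x" "x \<le> b" "b - a < d" "q < (f b - f a) / (b - a)" by auto
        then have "q * (b - a) \<le> f b - f a" by (simp add: field_simps)
        then show "\<exists>a b. a < b \<and> a \<le> x \<and> x \<le> b \<and> b - a < d \<and> emeasure (scale_measure (ennreal q) lborel) {a..b} \<le> emeasure \<nu> {a..b}"
          using ab p0 pq by (intro exI[of _ a] exI[of _ b]) (auto simp: \<nu>I ennreal_mult[symmetric] intro!: ennreal_leI)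
      qed (use p0 q1 pq in \<open>auto simp: \<nu>_def\<close>)
      have "emeasure lborel B \<le> emeasure lborel {-real k..real k}"
        by (intro emeasure_mono) (auto simp: B_def)
      then have "emeasure lborel B < \<infinity>" by (auto simp: le_less_trans)
      then obtain r where r: "emeasure lborel B = ennreal r" "0 \<le> r" by (cases "emeasure lborel B") auto
      have "ennreal q * ennreal r \<le> ennreal p * ennreal r" using 1 2 r(1) by auto
      then have "q * r \<le> p * r" using r(2) p0 pq by (simp add: ennreal_mult[symmetric])
      then have "r = 0" using r(2) pq by (auto simp: mult_le_cancel_right)
      then show ?thesis using r by (simp add: B_def)
    qed
    have "emeasure lborel (\<Union>k. E p q \<inter> {-real k..real k}) = 0"
      using fin Eb by (intro emeasure_UN_eq_0) auto
    moreover have "(\<Union>k. E p q \<inter> {-real k..real k}) = E p q"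
    proof -
      have "\<exists>k. -real k \<le> x \<and> x \<le> real k" for x
        using real_arch_simple[of "\<bar>x\<bar>"] by (auto simp: abs_le_iff minus_le_iff)
      then show ?thesis by auto
    qed
    ultimately show ?thesis by simp
  qed auto
  have "AE x in lborel. \<forall>p\<in>\<rat>. \<forall>q\<in>\<rat>. p < q \<longrightarrow> x \<notin> E p q"
    using countable_rat null Eb
    by (intro AE_ball_countable[THEN iffD2] ballI AE_impI AE_not_in null_setsI) auto
  then show ?thesis
  proof eventually_elim
    case (elim x)
    have b: "\<bar>f (x + h) - f (x + 0)\<bar> \<le> 1 * \<bar>h\<bar>" for h by (rule bd)
    show ?case
    proof (rule ccontr)
      assume "\<not> ?thesis"
      from not_differentiable_quotients[of "\<lambda>t. f (x + t)", OF b, THEN iffD1, OF this] elim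
      show False by (auto simp: E_def Q_def)
    qed
  qed
qed

lemma lipschitz_real_differentiable_AE:
  fixes f :: "real \<Rightarrow> real"
  assumes lip: "L-lipschitz_on UNIV f"
  shows "AE x in lborel. (\<lambda>t. f (x + t)) differentiable at 0"
proof -
  \<comment> \<open>The summand 1 keeps \<open>K\<close> positive when \<open>L\<close> is 0. The
    increments of \<open>f x / K\<close> have modulus at most \<open>y - x\<close>, and averaging
    with the identity moves them into the interval from 0 to \<open>y - x\<close>.\<close>
  define K where "K = L + 1"
  have K: "K > 0" using lipschitz_on_nonneg[OF lip] by (simp add: K_def)
  define g where "g x = (f x / K + x) / 2" for x
  have lf: "\<bar>f y - f x\<bar> \<le> K * (y - x)" if "x \<le> y" for x y
    using lipschitz_onD[OF lip, of x y] that by (auto simp: dist_real_def K_def algebra_simps abs_minus_commute)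
  have lf': "- (y - x) \<le> f y / K - f x / K" "f y / K - f x / K \<le> y - x" if "x \<le> y" for x y
    using lf[OF that] K by (auto simp: abs_le_iff field_simps)
  have "AE x in lborel. (\<lambda>t. g (x + t)) differentiable at 0"
  proof (rule monotone_lipschitz_differentiable_AE)
    fix x y :: real assume "x \<le> y"
    from lf'[OF this] show "g x \<le> g y" "g y - g x \<le> y - x" unfolding g_def by (simp_all only: divide_right_mono, argo+)
  qed
  then show ?thesis
  proof eventually_elim
    case (elim x)
    have "(\<lambda>t. f (x + t)) = (\<lambda>t. K * (2 * g (x + t) - (x + t)))" using K by (auto simp: g_def field_simps)
    then show ?case using elim by (auto intro!: derivative_intros)
  qed
qed

text \<open>By translation invariance, the measure of a set equals the average over \<open>t \<in> [0, 1]\<close> of the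
  measures of its translates by \<open>t b\<close>, hence by Tonelli the integral of the measures of its slices.\<close>

lemma null_set_if_lines_null:
  fixes N :: "'a::euclidean_space set"
  assumes N: "N \<in> sets borel" and sl: "\<And>x. AE t in lborel. x + t *\<^sub>R b \<notin> N"
  shows "emeasure lborel N = 0"
proof -
  have [measurable]: "N \<in> sets borel" by fact
  have tr: "(\<integral>\<^sup>+x. indicator N (x + t *\<^sub>R b) \<partial>lborel) = emeasure lborel N" for t
  proof -
    have "emeasure lborel N = (\<integral>\<^sup>+x. indicator N x \<partial>distr lborel borel ((+) (t *\<^sub>R b)))"
      by (simp add: lborel_distr_plus)
    also have "\<dots> = (\<integral>\<^sup>+x. indicator N (t *\<^sub>R b + x) \<partial>lborel)"
      by (intro nn_integral_distr) auto
    finally show ?thesis by (simp add: add.commute)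
  qed
  have "emeasure lborel N = (\<integral>\<^sup>+t. emeasure lborel N * indicator {0..1::real} t \<partial>lborel)"
    by (subst nn_integral_cmult_indicator) auto
  also have "\<dots> = (\<integral>\<^sup>+t. \<integral>\<^sup>+x. indicator N (x + t *\<^sub>R b) * indicator {0..1::real} t \<partial>lborel \<partial>lborel)"
  proof (intro nn_integral_cong)
    fix t :: real
    have "(\<integral>\<^sup>+x. indicator N (x + t *\<^sub>R b) * indicator {0..1} t \<partial>lborel)
      = (\<integral>\<^sup>+x. indicator N (x + t *\<^sub>R b) \<partial>lborel) * indicator {0..1} t"
      by (rule nn_integral_multc) measurable
    then show "emeasure lborel N * indicator {0..1} t
      = (\<integral>\<^sup>+x. indicator N (x + t *\<^sub>R b) * indicator {0..1} t \<partial>lborel)"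
      by (simp only: tr)
  qed
  also have "\<dots> = (\<integral>\<^sup>+x. \<integral>\<^sup>+t. indicator N (x + t *\<^sub>R b) * indicator {0..1::real} t \<partial>lborel \<partial>lborel)"
    by (rule lborel_pair.Fubini'[symmetric]) measurable
  also have "\<dots> = (\<integral>\<^sup>+x. 0 \<partial>(lborel :: 'a measure))"
  proof (intro nn_integral_cong)
    fix x
    have "(\<integral>\<^sup>+t. indicator N (x + t *\<^sub>R b) * indicator {0..1::real} t \<partial>lborel) = (\<integral>\<^sup>+t. 0 \<partial>(lborel :: real measure))"
      using sl[of x] by (intro nn_integral_cong_AE) (auto elim!: eventually_mono)
    then show "(\<integral>\<^sup>+t. indicator N (x + t *\<^sub>R b) * indicator {0..1::real} t \<partial>lborel) = 0" by simp
  qed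
  finally show ?thesis by simp
qed

lemma lipschitz_differentiable_along_AE:
  fixes \<phi> :: "'a::euclidean_space \<Rightarrow> real"
  assumes lip: "L-lipschitz_on UNIV \<phi>"
  shows "AE x in lborel. (\<lambda>t. \<phi> (x + t *\<^sub>R b)) differentiable at 0"
proof -
  define N where "N = {x. \<not> (\<lambda>t. \<phi> (x + t *\<^sub>R b)) differentiable at 0}"
  have Nb: "N \<in> sets borel" unfolding N_def using lip by (rule borel_not_differentiable_along)
  have "emeasure lborel N = 0"
  proof (rule null_set_if_lines_null[OF Nb])
    fix x
    have "(L * norm b)-lipschitz_on UNIV (\<lambda>t. \<phi> (x + t *\<^sub>R b))"
    proof (rule lipschitz_onI)
      fix s t
      show "dist (\<phi> (x + s *\<^sub>R b)) (\<phi> (x + t *\<^sub>R b)) \<le> L * norm b * dist s t"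
        using lipschitz_onD[OF lip, of "x + s *\<^sub>R b" "x + t *\<^sub>R b"]
        by (simp add: dist_norm scaleR_diff_left[symmetric] ac_simps)
    qed (use lipschitz_on_nonneg[OF lip] in auto)
    from lipschitz_real_differentiable_AE[OF this]
    show "AE t in lborel. x + t *\<^sub>R b \<notin> N"
      by (simp add: N_def algebra_simps)
  qed
  then have "AE x in lborel. x \<notin> N" using Nb by (intro AE_not_in) auto
  then show ?thesis by (simp add: N_def)
qed

section \<open>Partial derivatives of Lipschitz functions\<close>

lemma integrable_indicator_cball: "integrable lborel (indicator (cball (c::'a::euclidean_space) R) :: 'a \<Rightarrow> real)"
  by (rule integrable_real_indicator) (simp, rule emeasure_lborel_cball_finite)

lemma integrable_bounded_support:
  fixes f :: "'a::euclidean_space \<Rightarrow> 'b::{banach, second_countable_topology}"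
  assumes [measurable]: "f \<in> borel_measurable borel" and bd: "AE x in lborel. norm (f x) \<le> B"
    and supp: "\<And>x. R \<le> norm x \<Longrightarrow> f x = 0"
  shows "integrable lborel f"
proof (rule Bochner_Integration.integrable_bound)
  show "integrable lborel (\<lambda>x::'a. B * indicator (cball 0 R) x)"
    by (intro integrable_mult_right integrable_indicator_cball)
  show "AE x in lborel. norm (f x) \<le> norm (B * indicator (cball 0 R) x)"
    using bd
  proof eventually_elim
    case (elim x)
    then show ?case using supp[of x] by (cases "norm x \<le> R") (auto simp: indicator_def)
  qed
qed auto

section \<open>Difference quotients and partial derivatives\<close>

lemma has_real_derivative_partial_deriv:
  fixes \<phi> :: "'a::euclidean_space \<Rightarrow> real"
  assumes "(\<lambda>t. \<phi> (x + t *\<^sub>R b)) differentiable at 0"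
  shows "((\<lambda>t. \<phi> (x + t *\<^sub>R b)) has_real_derivative partial_deriv b \<phi> x) (at 0)"
  using assms unfolding partial_deriv_def by (simp add: DERIV_deriv_iff_real_differentiable)

lemma partial_deriv_eqI:
  fixes \<phi> :: "'a::euclidean_space \<Rightarrow> real"
  assumes "((\<lambda>t. \<phi> (x + t *\<^sub>R b)) has_real_derivative D) (at 0)"
  shows "partial_deriv b \<phi> x = D"
  using assms unfolding partial_deriv_def by (rule DERIV_imp_deriv)

lemma partial_deriv_locally_const:
  fixes \<phi> :: "'a::euclidean_space \<Rightarrow> real"
  assumes "0 < e" and c: "\<And>z. z \<in> ball x e \<Longrightarrow> \<phi> z = c"
  shows "partial_deriv b \<phi> x = 0"
proof (rule partial_deriv_eqI)
  have "((\<lambda>t. x + t *\<^sub>R b) \<longlongrightarrow> x + 0 *\<^sub>R b) (nhds 0)"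
    by (intro tendsto_intros filterlim_ident)
  then have "eventually (\<lambda>t. x + t *\<^sub>R b \<in> ball x e) (nhds 0)"
    using \<open>0 < e\<close> by (intro topological_tendstoD) auto
  then have ev: "eventually (\<lambda>t. \<phi> (x + t *\<^sub>R b) = c) (nhds 0)"
    by eventually_elim (rule c)
  show "((\<lambda>t. \<phi> (x + t *\<^sub>R b)) has_real_derivative 0) (at 0)"
    by (subst DERIV_cong_ev[OF refl ev refl]) simp
qed

lemma has_real_derivative_imp_quotients:
  fixes \<phi> :: "'a::euclidean_space \<Rightarrow> real"
  assumes "((\<lambda>t. \<phi> (x + t *\<^sub>R b)) has_real_derivative D) (at 0)"
    and "h \<longlonglongrightarrow> 0" and "\<And>n. h n \<noteq> (0::real)"
  shows "(\<lambda>n::nat. (\<phi> (x + h n *\<^sub>R b) - \<phi> x) / h n) \<longlonglongrightarrow> D"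
proof -
  have lim: "((\<lambda>h. (\<phi> (x + h *\<^sub>R b) - \<phi> x) / h) \<longlongrightarrow> D) (at 0)"
    using assms(1)[unfolded DERIV_def] by simp
  have "filterlim h (at 0) sequentially" using assms by (auto simp: filterlim_at)
  from filterlim_compose[OF lim this] show ?thesis by simp
qed

text \<open>\<open>deriv\<close> is a choice operator: where no derivative exists its defining
  predicate is constantly false, so all such points share one value. Measurability and boundedness
  thereby extend to the exceptional set.\<close>

lemma partial_deriv_not_differentiable:
  fixes \<phi> :: "'a::euclidean_space \<Rightarrow> real"
  assumes "\<not> (\<lambda>t. \<phi> (x + t *\<^sub>R b)) differentiable at 0"
  shows "partial_deriv b \<phi> x = (SOME D. False)"
proof -
  have "(\<lambda>D. ((\<lambda>t. \<phi> (x + t *\<^sub>R b)) has_real_derivative D) (at 0)) = (\<lambda>D. False)"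
    using assms by (auto simp: real_differentiable_def)
  then show ?thesis by (simp add: partial_deriv_def deriv_def)
qed

lemma borel_measurable_partial_deriv:
  fixes \<phi> :: "'a::euclidean_space \<Rightarrow> real"
  assumes lip: "L-lipschitz_on UNIV \<phi>"
  shows "partial_deriv b \<phi> \<in> borel_measurable borel"
proof -
  define N where "N = {x. \<not> (\<lambda>t. \<phi> (x + t *\<^sub>R b)) differentiable at 0}"
  have [measurable]: "N \<in> sets borel" unfolding N_def by (rule borel_not_differentiable_along[OF lip])
  have [measurable]: "\<phi> \<in> borel_measurable borel"
    using lipschitz_on_continuous_on[OF lip] by (rule borel_measurable_continuous_onI)
  define q where "q m x = (\<phi> (x + inverse (real (Suc m)) *\<^sub>R b) - \<phi> x) / inverse (real (Suc m))" for m x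
  have [measurable]: "q m \<in> borel_measurable borel" for m unfolding q_def by measurable
  have *: "partial_deriv b \<phi> x = (if x \<in> N then SOME D. False else lim (\<lambda>m. q m x))" for x
  proof (cases "x \<in> N")
    case True
    then show ?thesis by (simp add: N_def partial_deriv_not_differentiable)
  next
    case False
    then have "((\<lambda>t. \<phi> (x + t *\<^sub>R b)) has_real_derivative partial_deriv b \<phi> x) (at 0)"
      by (auto simp: N_def intro: has_real_derivative_partial_deriv)
    from has_real_derivative_imp_quotients[OF this LIMSEQ_inverse_real_of_nat]
    have "(\<lambda>m. q m x) \<longlonglongrightarrow> partial_deriv b \<phi> x" by (simp add: q_def)
    then show ?thesis using False by (simp add: limI)
  qed
  have "(\<lambda>x. if x \<in> N then SOME D. False else lim (\<lambda>m. q m x)) \<in> borel_measurable borel"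
    by measurable
  then show ?thesis unfolding *[abs_def] .
qed

lemma lipschitz_quotient_le:
  fixes \<phi> :: "'a::euclidean_space \<Rightarrow> real"
  assumes lip: "L-lipschitz_on UNIV \<phi>"
  shows "\<bar>(\<phi> (x + h *\<^sub>R b) - \<phi> x) / h\<bar> \<le> L * norm b"
proof (cases "h = 0")
  case False
  then show ?thesis
    using lipschitz_onD[OF lip, of "x + h *\<^sub>R b" x]
    by (simp add: dist_real_def dist_norm abs_divide divide_le_eq ac_simps)
qed (use lipschitz_on_nonneg[OF lip] in auto)

lemma AE_partial_deriv:
  fixes \<phi> :: "'a::euclidean_space \<Rightarrow> real"
  assumes lip: "L-lipschitz_on UNIV \<phi>"
  shows "AE x in lborel. ((\<lambda>t. \<phi> (x + t *\<^sub>R b)) has_real_derivative partial_deriv b \<phi> x) (at 0)"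
  using lipschitz_differentiable_along_AE[OF lip, of b]
  by eventually_elim (rule has_real_derivative_partial_deriv)

lemma partial_deriv_le:
  fixes \<phi> :: "'a::euclidean_space \<Rightarrow> real"
  assumes lip: "L-lipschitz_on UNIV \<phi>" and d: "(\<lambda>t. \<phi> (x + t *\<^sub>R b)) differentiable at 0"
  shows "\<bar>partial_deriv b \<phi> x\<bar> \<le> L * norm b"
proof -
  have "(\<lambda>n. \<bar>(\<phi> (x + inverse (real (Suc n)) *\<^sub>R b) - \<phi> x) / inverse (real (Suc n))\<bar>) \<longlonglongrightarrow> \<bar>partial_deriv b \<phi> x\<bar>"
    by (intro tendsto_rabs has_real_derivative_imp_quotients
      has_real_derivative_partial_deriv d LIMSEQ_inverse_real_of_nat) auto
  then show ?thesis
    by (rule LIMSEQ_le_const2) (use lipschitz_quotient_le[OF lip] in blast)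
qed

lemma AE_partial_deriv_le:
  fixes \<phi> :: "'a::euclidean_space \<Rightarrow> real"
  assumes lip: "L-lipschitz_on UNIV \<phi>"
  shows "AE x in lborel. \<bar>partial_deriv b \<phi> x\<bar> \<le> L * norm b"
  using lipschitz_differentiable_along_AE[OF lip, of b]
  by eventually_elim (rule partial_deriv_le[OF lip])

text \<open>For finite increments the identity is translation invariance of Lebesgue measure: a
  forward quotient of \<phi> turns into a backward quotient of \<psi>. Both sides pass to the limit
  by dominated convergence, because quotients of Lipschitz functions are bounded. Since \<phi>
  vanishes far out, \<psi> may grow linearly.\<close>

lemma lipschitz_integration_by_parts:
  fixes \<phi> \<psi> :: "'a::euclidean_space \<Rightarrow> real"
  assumes \<phi>: "L-lipschitz_on UNIV \<phi>" and \<psi>: "M-lipschitz_on UNIV \<psi>"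
    and supp: "\<And>x. R \<le> norm x \<Longrightarrow> \<phi> x = 0"
  shows "(\<integral>x. \<psi> x * partial_deriv b \<phi> x \<partial>lborel) = - (\<integral>x. \<phi> x * partial_deriv b \<psi> x \<partial>lborel)"
proof -
  have [measurable]: "\<phi> \<in> borel_measurable borel" "\<psi> \<in> borel_measurable borel"
    using lipschitz_on_continuous_on[OF \<phi>] lipschitz_on_continuous_on[OF \<psi>]
    by (auto intro: borel_measurable_continuous_onI)
  note [measurable] = borel_measurable_partial_deriv[OF \<phi>] borel_measurable_partial_deriv[OF \<psi>]
  define h where "h n = inverse (real (Suc n))" for n
  have h: "h n \<noteq> 0" "0 < h n" "h n \<le> 1" for n by (auto simp: h_def inverse_le_1_iff)
  have h0: "h \<longlonglongrightarrow> 0" unfolding h_def by (rule LIMSEQ_inverse_real_of_nat)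
  have h0': "(\<lambda>n. - h n) \<longlonglongrightarrow> 0" using tendsto_minus[OF h0] by simp
  \<comment> \<open>The increments are at most 1, so all translates of \<phi> that occur vanish
    outside this common radius.\<close>
  define R' where "R' = \<bar>R\<bar> + norm b + 1"
  have \<psi>b: "\<bar>\<psi> x\<bar> \<le> \<bar>\<psi> 0\<bar> + M * norm x" for x
    using lipschitz_onD[OF \<psi>, of x 0] by (auto simp: dist_real_def)
  have \<phi>b: "\<bar>\<phi> x\<bar> \<le> \<bar>\<phi> 0\<bar> + L * \<bar>R\<bar>" for x
  proof (cases "norm x \<le> R")
    case True
    have "\<bar>\<phi> x\<bar> \<le> \<bar>\<phi> 0\<bar> + L * norm x" using lipschitz_onD[OF \<phi>, of x 0] by (auto simp: dist_real_def)
    also have "L * norm x \<le> L * \<bar>R\<bar>" using True lipschitz_on_nonneg[OF \<phi>] by (intro mult_left_mono) auto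
    finally show ?thesis by simp
  qed (use supp[of x] lipschitz_on_nonneg[OF \<phi>] in auto)
  have int\<phi>: "integrable lborel \<phi>"
    using \<phi>b supp by (intro integrable_bounded_support[of \<phi> _ R]) auto
  have supp': "\<phi> (x + t *\<^sub>R b) = 0" if "R' \<le> norm x" "\<bar>t\<bar> \<le> 1" for x t
  proof (rule supp)
    have "norm x \<le> norm (x + t *\<^sub>R b) + norm (t *\<^sub>R b)" by (metis add_diff_cancel_right' norm_triangle_ineq4)
    moreover have "norm (t *\<^sub>R b) \<le> norm b" using that(2) by (simp add: mult_left_le_one_le)
    ultimately show "R \<le> norm (x + t *\<^sub>R b)" using that(1) by (simp add: R'_def)
  qed
  have M0: "0 \<le> M" and L0: "0 \<le> L" using lipschitz_on_nonneg \<phi> \<psi> by blast+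
  have trans: "(\<integral>x. \<psi> x * ((\<phi> (x + h n *\<^sub>R b) - \<phi> x) / h n) \<partial>lborel)
     = - (\<integral>x. \<phi> x * ((\<psi> (x + (- h n) *\<^sub>R b) - \<psi> x) / (- h n)) \<partial>lborel)" for n
  proof -
    have int\<psi>\<phi>: "integrable lborel (\<lambda>x. \<psi> x * \<phi> (x + t *\<^sub>R b))" if t: "\<bar>t\<bar> \<le> 1" for t
    proof (rule integrable_bounded_support[where R=R'])
      show "AE x in lborel. norm (\<psi> x * \<phi> (x + t *\<^sub>R b)) \<le> (\<bar>\<psi> 0\<bar> + M * R') * (\<bar>\<phi> 0\<bar> + L * \<bar>R\<bar>)"
      proof (rule AE_I2)
        fix x
        show "norm (\<psi> x * \<phi> (x + t *\<^sub>R b)) \<le> (\<bar>\<psi> 0\<bar> + M * R') * (\<bar>\<phi> 0\<bar> + L * \<bar>R\<bar>)"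
        proof (cases "R' \<le> norm x")
          case True
          then show ?thesis using supp'[OF True t] M0 L0 by (auto simp: R'_def intro!: mult_nonneg_nonneg add_nonneg_nonneg)
        next
          case False
          have "\<bar>\<psi> x\<bar> \<le> \<bar>\<psi> 0\<bar> + M * R'"
            using \<psi>b[of x] mult_left_mono[of "norm x" R' M] False M0 by auto
          then show ?thesis unfolding real_norm_def abs_mult using \<phi>b M0 False
            by (intro mult_mono) auto
        qed
      qed
    qed (use supp' t in auto)
    have int2: "integrable lborel (\<lambda>x. \<phi> x * \<psi> (x + (- h n) *\<^sub>R b))"
    proof -
      have "integrable (distr lborel borel ((+) (h n *\<^sub>R b))) (\<lambda>x. \<phi> x * \<psi> (x + (- h n) *\<^sub>R b))"
        using int\<psi>\<phi>[of "h n"] h[of n] by (subst integrable_distr_eq) (auto simp: algebra_simps)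
      then show ?thesis by (simp add: lborel_distr_plus)
    qed
    have "(\<integral>x. \<psi> x * \<phi> (x + h n *\<^sub>R b) \<partial>lborel) = (\<integral>x. \<phi> x * \<psi> (x + (- h n) *\<^sub>R b) \<partial>distr lborel borel ((+) (h n *\<^sub>R b)))"
      by (subst integral_distr) (auto simp: algebra_simps)
    also have "\<dots> = (\<integral>x. \<phi> x * \<psi> (x + (- h n) *\<^sub>R b) \<partial>lborel)" by (simp add: lborel_distr_plus)
    finally have eq: "(\<integral>x. \<psi> x * \<phi> (x + h n *\<^sub>R b) \<partial>lborel) = (\<integral>x. \<phi> x * \<psi> (x + (- h n) *\<^sub>R b) \<partial>lborel)" .
    have "(\<integral>x. \<psi> x * ((\<phi> (x + h n *\<^sub>R b) - \<phi> x) / h n) \<partial>lborel)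
      = (\<integral>x. (\<psi> x * \<phi> (x + h n *\<^sub>R b) - \<psi> x * \<phi> (x + 0 *\<^sub>R b)) / h n \<partial>lborel)"
      by (simp add: field_simps)
    also have "\<dots> = ((\<integral>x. \<psi> x * \<phi> (x + h n *\<^sub>R b) \<partial>lborel) - (\<integral>x. \<psi> x * \<phi> (x + 0 *\<^sub>R b) \<partial>lborel)) / h n"
      unfolding integral_divide_zero
      using int\<psi>\<phi>[of "h n"] int\<psi>\<phi>[of 0] h[of n] by (subst Bochner_Integration.integral_diff) auto
    also have "\<dots> = - (((\<integral>x. \<phi> x * \<psi> (x + (- h n) *\<^sub>R b) \<partial>lborel) - (\<integral>x. \<phi> x * \<psi> x \<partial>lborel)) / (- h n))"
      unfolding eq by (simp add: mult.commute)
    also have "((\<integral>x. \<phi> x * \<psi> (x + (- h n) *\<^sub>R b) \<partial>lborel) - (\<integral>x. \<phi> x * \<psi> x \<partial>lborel)) / (- h n)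
       = (\<integral>x. (\<phi> x * \<psi> (x + (- h n) *\<^sub>R b) - \<phi> x * \<psi> x) / (- h n) \<partial>lborel)"
      unfolding integral_divide_zero
      using int2 int\<psi>\<phi>[of 0] by (subst Bochner_Integration.integral_diff) (auto simp: mult.commute)
    finally show ?thesis by (simp add: field_simps)
  qed
  have 1: "(\<lambda>n. \<integral>x. \<psi> x * ((\<phi> (x + h n *\<^sub>R b) - \<phi> x) / h n) \<partial>lborel) \<longlonglongrightarrow> (\<integral>x. \<psi> x * partial_deriv b \<phi> x \<partial>lborel)"
  proof (rule integral_dominated_convergence[where w="\<lambda>x. (\<bar>\<psi> 0\<bar> + M * R') * (L * norm b) * indicator (cball 0 R') x"])
    show "integrable lborel (\<lambda>x::'a. (\<bar>\<psi> 0\<bar> + M * R') * (L * norm b) * indicator (cball 0 R') x)"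
      by (intro integrable_mult_right integrable_indicator_cball)
    show "AE x in lborel. (\<lambda>n. \<psi> x * ((\<phi> (x + h n *\<^sub>R b) - \<phi> x) / h n)) \<longlonglongrightarrow> \<psi> x * partial_deriv b \<phi> x"
      using AE_partial_deriv[OF \<phi>, of b]
      by eventually_elim (intro tendsto_mult tendsto_const has_real_derivative_imp_quotients h0 h)
    show "AE x in lborel. norm (\<psi> x * ((\<phi> (x + h n *\<^sub>R b) - \<phi> x) / h n))
        \<le> (\<bar>\<psi> 0\<bar> + M * R') * (L * norm b) * indicator (cball 0 R') x" for n
    proof (rule AE_I2)
      fix x
      show "norm (\<psi> x * ((\<phi> (x + h n *\<^sub>R b) - \<phi> x) / h n))
        \<le> (\<bar>\<psi> 0\<bar> + M * R') * (L * norm b) * indicator (cball 0 R') x"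
      proof (cases "norm x \<le> R'")
        case True
        have "\<bar>\<psi> x\<bar> \<le> \<bar>\<psi> 0\<bar> + M * R'"
          using \<psi>b[of x] mult_left_mono[of "norm x" R' M] True M0 by auto
        then have "\<bar>\<psi> x\<bar> * \<bar>(\<phi> (x + h n *\<^sub>R b) - \<phi> x) / h n\<bar> \<le> (\<bar>\<psi> 0\<bar> + M * R') * (L * norm b)"
          using lipschitz_quotient_le[OF \<phi>] by (intro mult_mono) auto
        then show ?thesis using True by (simp add: abs_mult)
      next
        case False
        then show ?thesis using supp'[of x "h n"] supp'[of x 0] h[of n] by auto
      qed
    qed
  qed auto
  have 2: "(\<lambda>n. \<integral>x. \<phi> x * ((\<psi> (x + (- h n) *\<^sub>R b) - \<psi> x) / (- h n)) \<partial>lborel) \<longlonglongrightarrow> (\<integral>x. \<phi> x * partial_deriv b \<psi> x \<partial>lborel)"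
  proof (rule integral_dominated_convergence[where w="\<lambda>x. \<bar>\<phi> x\<bar> * (M * norm b)"])
    show "integrable lborel (\<lambda>x. \<bar>\<phi> x\<bar> * (M * norm b))"
      using int\<phi> by auto
    show "AE x in lborel. (\<lambda>n. \<phi> x * ((\<psi> (x + (- h n) *\<^sub>R b) - \<psi> x) / (- h n))) \<longlonglongrightarrow> \<phi> x * partial_deriv b \<psi> x"
      using AE_partial_deriv[OF \<psi>, of b]
    proof eventually_elim
      case (elim x)
      show ?case using h by (intro tendsto_mult tendsto_const has_real_derivative_imp_quotients[OF elim h0']) auto
    qed
    show "AE x in lborel. norm (\<phi> x * ((\<psi> (x + (- h n) *\<^sub>R b) - \<psi> x) / (- h n))) \<le> \<bar>\<phi> x\<bar> * (M * norm b)" for n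
      unfolding real_norm_def abs_mult
      by (intro AE_I2 mult_left_mono lipschitz_quotient_le[OF \<psi>]) auto
  qed auto
  show ?thesis
    by (rule LIMSEQ_unique[OF 1]) (unfold trans, rule tendsto_minus[OF 2])
qed

lemma lipschitz_on_UNIV_mult:
  fixes \<phi> \<psi> :: "'a::metric_space \<Rightarrow> real"
  assumes \<phi>: "L-lipschitz_on UNIV \<phi>" and \<psi>: "M-lipschitz_on UNIV \<psi>"
    and b\<phi>: "\<And>x. \<bar>\<phi> x\<bar> \<le> A" and b\<psi>: "\<And>x. \<bar>\<psi> x\<bar> \<le> B"
  shows "(A * M + B * L)-lipschitz_on UNIV (\<lambda>x. \<phi> x * \<psi> x)"
proof (rule lipschitz_onI)
  fix x y
  have "\<bar>\<phi> x * \<psi> x - \<phi> y * \<psi> y\<bar> = \<bar>\<phi> x * (\<psi> x - \<psi> y) + \<psi> y * (\<phi> x - \<phi> y)\<bar>" by (simp add: algebra_simps)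
  also have "\<dots> \<le> \<bar>\<phi> x\<bar> * \<bar>\<psi> x - \<psi> y\<bar> + \<bar>\<psi> y\<bar> * \<bar>\<phi> x - \<phi> y\<bar>"
    by (metis abs_mult abs_triangle_ineq)
  also have "\<dots> \<le> A * (M * dist x y) + B * (L * dist x y)"
    using lipschitz_onD[OF \<phi>, of x y] lipschitz_onD[OF \<psi>, of x y] b\<phi>[of x] b\<psi>[of y]
    by (intro add_mono mult_mono) (auto simp: dist_real_def)
  finally show "dist (\<phi> x * \<psi> x) (\<phi> y * \<psi> y) \<le> (A * M + B * L) * dist x y"
    by (simp add: dist_real_def algebra_simps)
next
  have "0 \<le> A" "0 \<le> B" using b\<phi> b\<psi> by (meson abs_ge_zero order_trans)+
  then show "0 \<le> A * M + B * L" using lipschitz_on_nonneg[OF \<phi>] lipschitz_on_nonneg[OF \<psi>] by auto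
qed

section \<open>Gradients of Lipschitz functions\<close>

lemma inner_grad: "v \<bullet> grad \<phi> x = (\<Sum>b\<in>Basis. (v \<bullet> b) * partial_deriv b \<phi> x)"
  by (simp add: grad_def inner_sum_right mult.commute)

lemma borel_measurable_grad:
  fixes \<phi> :: "'a::euclidean_space \<Rightarrow> real"
  assumes lip: "L-lipschitz_on UNIV \<phi>"
  shows "grad \<phi> \<in> borel_measurable borel"
  unfolding grad_def[abs_def] using borel_measurable_partial_deriv[OF lip] by auto

lemma AE_norm_grad_le:
  fixes \<phi> :: "'a::euclidean_space \<Rightarrow> real"
  assumes lip: "L-lipschitz_on UNIV \<phi>"
  shows "AE x in lborel. norm (grad \<phi> x) \<le> real DIM('a) * L"
proof -
  have "AE x in lborel. \<forall>b\<in>Basis. \<bar>partial_deriv b \<phi> x\<bar> \<le> L * norm b"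
    by (intro AE_ball_countable[THEN iffD2] ballI AE_partial_deriv_le[OF lip] countable_finite finite_Basis)
  then show ?thesis
  proof eventually_elim
    case (elim x)
    have "norm (grad \<phi> x) \<le> (\<Sum>b\<in>(Basis::'a set). L)"
      unfolding grad_def using elim by (intro sum_norm_le) auto
    then show ?case by simp
  qed
qed

lemma grad_locally_const:
  fixes \<phi> :: "'a::euclidean_space \<Rightarrow> real"
  assumes "0 < e" and "\<And>z. z \<in> ball x e \<Longrightarrow> \<phi> z = c"
  shows "grad \<phi> x = 0"
proof -
  have "partial_deriv b \<phi> x = 0" for b
    by (rule partial_deriv_locally_const[OF assms(1)]) (rule assms(2))
  then show ?thesis by (simp add: grad_def)
qed

text \<open>The bound holds at every point, also on the null set where a partial derivative takes
  its default value \<open>c\<close>, which is why \<open>c\<close> enters the constant. Dominating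
  functions can then be stated pointwise.\<close>

lemma bounded_grad:
  fixes \<phi> :: "'a::euclidean_space \<Rightarrow> real"
  assumes lip: "L-lipschitz_on UNIV \<phi>"
  obtains C where "0 \<le> C" "\<And>x. norm (grad \<phi> x) \<le> C"
proof -
  define c where "c = (SOME D::real. False)"
  have *: "\<bar>partial_deriv b \<phi> x\<bar> \<le> L * norm b + \<bar>c\<bar>" for b x
  proof (cases "(\<lambda>t. \<phi> (x + t *\<^sub>R b)) differentiable at 0")
    case True
    then show ?thesis using partial_deriv_le[OF lip] by (metis abs_ge_zero add_increasing2)
  next
    case False
    then show ?thesis using lipschitz_on_nonneg[OF lip] by (simp add: partial_deriv_not_differentiable c_def)
  qed
  show ?thesis
  proof (rule that)
    fix x
    show "norm (grad \<phi> x) \<le> (\<Sum>b\<in>(Basis::'a set). L * norm b + \<bar>c\<bar>)"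
      unfolding grad_def by (intro sum_norm_le) (metis * norm_scaleR norm_Basis mult.right_neutral real_norm_def)
  qed (use lipschitz_on_nonneg[OF lip] in \<open>auto intro!: sum_nonneg\<close>)
qed

lemma AE_grad_mult:
  fixes \<phi> \<psi> :: "'a::euclidean_space \<Rightarrow> real"
  assumes \<phi>: "L-lipschitz_on UNIV \<phi>" and \<psi>: "M-lipschitz_on UNIV \<psi>"
  shows "AE x in lborel. grad (\<lambda>x. \<phi> x * \<psi> x) x = \<psi> x *\<^sub>R grad \<phi> x + \<phi> x *\<^sub>R grad \<psi> x"
proof -
  have "AE x in lborel. \<forall>b\<in>Basis. ((\<lambda>t. \<phi> (x + t *\<^sub>R b)) has_real_derivative partial_deriv b \<phi> x) (at 0)
     \<and> ((\<lambda>t. \<psi> (x + t *\<^sub>R b)) has_real_derivative partial_deriv b \<psi> x) (at 0)"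
    using AE_partial_deriv[OF \<phi>] AE_partial_deriv[OF \<psi>]
    by (intro AE_ball_countable[THEN iffD2] ballI AE_conjI countable_finite finite_Basis)
  then show ?thesis
  proof eventually_elim
    case (elim x)
    have "partial_deriv b (\<lambda>x. \<phi> x * \<psi> x) x = \<psi> x * partial_deriv b \<phi> x + \<phi> x * partial_deriv b \<psi> x"
      if b: "b \<in> Basis" for b
      by (rule partial_deriv_eqI) (use elim b in \<open>auto intro!: derivative_eq_intros\<close>)
    then show ?case
      by (simp add: grad_def scaleR_sum_right sum.distrib[symmetric] scaleR_add_left)
  qed
qed

lemma Lip_cE:
  fixes \<phi> :: "'a::euclidean_space \<Rightarrow> real"
  assumes "\<phi> \<in> Lip_c"
  obtains L R B where "L-lipschitz_on UNIV \<phi>" "0 < R" "\<And>x. R \<le> norm x \<Longrightarrow> \<phi> x = 0"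
    "\<And>x. R \<le> norm x \<Longrightarrow> grad \<phi> x = 0" "\<And>x. \<bar>\<phi> x\<bar> \<le> B"
proof -
  obtain L where L: "L-lipschitz_on UNIV \<phi>" and c: "compact (closure {x. \<phi> x \<noteq> 0})"
    using assms by (auto simp: Lip_c_def)
  obtain R where R: "0 < R" "\<And>x. x \<in> closure {x. \<phi> x \<noteq> 0} \<Longrightarrow> norm x \<le> R"
    using compact_imp_bounded[OF c] by (auto simp: bounded_pos)
  have z: "\<phi> x = 0" if "R < norm x" for x
    using R(2)[of x] that closure_subset[of "{x. \<phi> x \<noteq> 0}"] by force
  show ?thesis
  proof (rule that[of L "R + 1" "\<bar>\<phi> 0\<bar> + L * R"])
    \<comment> \<open>The extra unit of radius leaves a ball around \<open>x\<close> that misses the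
      support.\<close>
    show "grad \<phi> x = 0" if "R + 1 \<le> norm x" for x
    proof (rule grad_locally_const[of 1])
      fix z assume "z \<in> ball x 1"
      then have "norm x - norm z < 1" by (smt (verit) dist_norm mem_ball norm_triangle_ineq2)
      then show "\<phi> z = 0" using that by (intro z) auto
    qed simp
    fix x
    show "\<bar>\<phi> x\<bar> \<le> \<bar>\<phi> 0\<bar> + L * R"
    proof (cases "norm x \<le> R")
      case True
      have "\<bar>\<phi> x\<bar> \<le> \<bar>\<phi> 0\<bar> + L * norm x" using lipschitz_onD[OF L, of x 0] by (auto simp: dist_real_def)
      also have "L * norm x \<le> L * R" using True lipschitz_on_nonneg[OF L] by (intro mult_left_mono) auto
      finally show ?thesis by simp
    qed (use z[of x] R lipschitz_on_nonneg[OF L] in auto)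
  qed (use R L z in auto)
qed

section \<open>The Newtonian field of a measure\<close>

text \<open>Up to its normalising factor, the gradient of the fundamental solution of the Laplacian;
  at the origin the value is 0.\<close>

definition newton_kernel :: "'a::euclidean_space \<Rightarrow> 'a" where
  "newton_kernel z = z /\<^sub>R norm z ^ DIM('a)"

text \<open>For positive \<delta> it is linear inside the ball of radius \<delta> and equal to the
  Newtonian kernel outside; its norm never exceeds that of the Newtonian kernel, except that both
  vanish at the origin.\<close>

definition reg_kernel :: "real \<Rightarrow> 'a::euclidean_space \<Rightarrow> 'a" where
  "reg_kernel \<delta> z = z /\<^sub>R max (norm z) \<delta> ^ DIM('a)"

lemma borel_measurable_newton_kernel [measurable]: "newton_kernel \<in> borel_measurable borel"
  unfolding newton_kernel_def[abs_def] by measurable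

lemma borel_measurable_reg_kernel [measurable]: "reg_kernel \<delta> \<in> borel_measurable borel"
  unfolding reg_kernel_def[abs_def] by measurable

lemma sets_borel_balls [measurable]:
  "ball (c::'a::euclidean_space) r \<in> sets borel" "cball c r \<in> sets borel"
  by auto

section \<open>Size and local integrability of the Newtonian kernel\<close>

lemma norm_newton_kernel:
  assumes "z \<noteq> 0"
  shows "norm (newton_kernel (z::'a::euclidean_space)) = inverse (norm z ^ (DIM('a) - 1))"
proof -
  obtain m where m: "DIM('a) = Suc m" using DIM_positive[where 'a='a] by (cases "DIM('a)") auto
  then show ?thesis using assms by (simp add: newton_kernel_def divide_simps)
qed

lemma norm_newton_kernel_le:
  assumes "r \<le> norm z" "0 < r"
  shows "norm (newton_kernel (z::'a::euclidean_space)) \<le> inverse (r ^ (DIM('a) - 1))"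
proof -
  have "norm (newton_kernel z) = inverse (norm z ^ (DIM('a) - 1))" using assms by (intro norm_newton_kernel) auto
  also have "\<dots> \<le> inverse (r ^ (DIM('a) - 1))" using assms by (intro le_imp_inverse_le power_mono) auto
  finally show ?thesis .
qed

text \<open>Dyadic shells: where the norm lies between \<open>(1/2) ^ Suc i\<close> and
  \<open>(1/2) ^ i\<close>, the kernel is at most \<open>2 ^ (Suc i * m)\<close> with
  \<open>m\<close> one less than the dimension, while the ball of radius \<open>(1/2) ^ i\<close>
  has volume proportional to \<open>(1/2) ^ (i * Suc m)\<close>. The products decay like
  \<open>(1/2) ^ i\<close>, so bounding shells by full balls still leaves a convergent
  series.\<close>

lemma nn_integral_kernel_unit_ball:
  "(\<integral>\<^sup>+z. ennreal (norm (newton_kernel (z::'a::euclidean_space))) * indicator (ball 0 1) z \<partial>lborel) < \<infinity>"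
proof -
  obtain m where m: "DIM('a) = Suc m" using DIM_positive[where 'a='a] by (cases "DIM('a)") auto
  define t where "t i z = ennreal (2 ^ (Suc i * m)) * indicator (ball (0::'a) ((1/2) ^ i)) z" for i :: nat and z
  have le: "ennreal (norm (newton_kernel z)) * indicator (ball 0 1) z \<le> (\<Sum>i. t i z)" for z :: 'a
  proof (cases "z = 0 \<or> norm z \<ge> 1")
    case True then show ?thesis by (auto simp: newton_kernel_def)
  next
    case False
    have "\<exists>k. (1/2::real) ^ k \<le> norm z"
      using real_arch_pow_inv[of "norm z" "1/2"] False by (auto intro: less_imp_le)
    then obtain k where k: "(1/2) ^ k \<le> norm z" "\<And>i. i < k \<Longrightarrow> \<not> (1/2) ^ i \<le> norm z"
      using exists_least_iff[of "\<lambda>k. (1/2) ^ k \<le> norm z"] by auto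
    then obtain i where i: "k = Suc i" using False by (cases k) auto
    have "norm (newton_kernel z) \<le> inverse (((1/2) ^ Suc i) ^ (DIM('a) - 1))"
      using k i by (intro norm_newton_kernel_le) auto
    also have "\<dots> = 2 ^ (Suc i * m)" unfolding m by (simp only: power_mult[symmetric] power_divide) (simp add: field_simps)
    finally have "ennreal (norm (newton_kernel z)) * indicator (ball 0 1) z \<le> t i z"
      using k(2)[of i] i False by (auto simp: t_def intro!: ennreal_leI)
    also have "\<dots> \<le> (\<Sum>i. t i z)" using sum_le_suminf[of "\<lambda>i. t i z" "{i}"] by auto
    finally show ?thesis .
  qed
  have "(\<integral>\<^sup>+z. ennreal (norm (newton_kernel (z::'a))) * indicator (ball 0 1) z \<partial>lborel) \<le> (\<integral>\<^sup>+z. (\<Sum>i. t i z) \<partial>lborel)"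
    by (intro nn_integral_mono le)
  also have "\<dots> = (\<Sum>i. \<integral>\<^sup>+z. t i z \<partial>lborel)"
    by (intro nn_integral_suminf) (simp add: t_def del: mem_ball, measurable)
  also have "\<dots> = (\<Sum>i. ennreal (2 ^ m * unit_ball_vol DIM('a) * (1/2) ^ i))"
  proof (intro suminf_cong)
    fix i
    have "(\<integral>\<^sup>+z. t i z \<partial>lborel) = ennreal (2 ^ (Suc i * m)) * ennreal (unit_ball_vol DIM('a) * ((1/2) ^ i) ^ DIM('a))"
      unfolding t_def by (subst nn_integral_cmult_indicator) (auto simp: emeasure_ball)
    also have "\<dots> = ennreal (2 ^ (Suc i * m) * (unit_ball_vol DIM('a) * ((1/2) ^ i) ^ DIM('a)))"
      by (intro ennreal_mult[symmetric]) auto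
    also have "2 ^ (Suc i * m) * (unit_ball_vol DIM('a) * ((1/2) ^ i) ^ DIM('a)) = 2 ^ m * unit_ball_vol DIM('a) * (1/2::real) ^ i"
      unfolding m by (simp add: power_mult[symmetric] power_add power_divide field_simps)
    finally show "(\<integral>\<^sup>+z. t i z \<partial>lborel) = ennreal (2 ^ m * unit_ball_vol DIM('a) * (1/2) ^ i)" .
  qed
  also have "\<dots> = ennreal (\<Sum>i. 2 ^ m * unit_ball_vol DIM('a) * (1/2) ^ i)"
    by (intro suminf_ennreal2 summable_mult summable_geometric) auto
  finally show ?thesis by (rule le_less_trans) auto
qed

text \<open>The \<open>itself\<close> argument carries the dimension, which the type of the value
  does not show.\<close>

definition kernel_bound :: "'a::euclidean_space itself \<Rightarrow> real \<Rightarrow> ennreal" where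
  "kernel_bound _ R = (\<integral>\<^sup>+z. ennreal (norm (newton_kernel (z::'a))) * indicator (ball 0 1) z \<partial>lborel) + emeasure lborel (cball (0::'a) R)"

lemma kernel_bound_finite: "kernel_bound TYPE('a::euclidean_space) R < \<infinity>"
  using nn_integral_kernel_unit_ball[where 'a='a] emeasure_lborel_cball_finite[of "0::'a" R]
  by (auto simp: kernel_bound_def)

text \<open>Within distance 1 of \<open>y\<close> the singularity costs a translate of the unit ball
  integral; farther away the kernel is at most 1 and costs the volume of the large ball. The bound
  does not depend on \<open>y\<close>, so it can be integrated against a finite measure.\<close>

lemma nn_integral_kernel_le:
  "(\<integral>\<^sup>+x. ennreal (norm (newton_kernel (x - y))) * indicator (cball (0::'a::euclidean_space) R) x \<partial>lborel) \<le> kernel_bound TYPE('a) R"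
proof -
  have "(\<integral>\<^sup>+x. ennreal (norm (newton_kernel (x - y))) * indicator (cball (0::'a) R) x \<partial>lborel)
     \<le> (\<integral>\<^sup>+x. ennreal (norm (newton_kernel (x - y))) * indicator (ball 0 1) (x - y) + indicator (cball (0::'a) R) x \<partial>lborel)"
  proof (intro nn_integral_mono)
    fix x
    show "ennreal (norm (newton_kernel (x - y))) * indicator (cball 0 R) x
      \<le> ennreal (norm (newton_kernel (x - y))) * indicator (ball 0 1) (x - y) + indicator (cball 0 R) x"
      using norm_newton_kernel_le[of 1 "x - y"] by (cases "norm (x - y) < 1") (auto simp: indicator_def)
  qed
  also have "\<dots> = (\<integral>\<^sup>+x. ennreal (norm (newton_kernel (x - y))) * indicator (ball 0 1) (x - y) \<partial>lborel)
      + (\<integral>\<^sup>+x. indicator (cball (0::'a) R) x \<partial>lborel)"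
    by (rule nn_integral_add) measurable
  also have "(\<integral>\<^sup>+x. indicator (cball (0::'a) R) x \<partial>lborel) = emeasure lborel (cball (0::'a) R)"
    by (rule nn_integral_indicator) measurable
  also have "(\<integral>\<^sup>+x. ennreal (norm (newton_kernel (x - y))) * indicator (ball 0 1) (x - y) \<partial>lborel)
     = (\<integral>\<^sup>+x. ennreal (norm (newton_kernel (- y + x))) * indicator (ball 0 1) (- y + x) \<partial>lborel)"
    by simp
  also have "\<dots> = (\<integral>\<^sup>+z. ennreal (norm (newton_kernel (z::'a))) * indicator (ball 0 1) z \<partial>distr lborel borel ((+) (- y)))"
  proof (rule nn_integral_distr[symmetric])
    show "(+) (- y) \<in> lborel \<rightarrow>\<^sub>M borel" by simp
    show "(\<lambda>z::'a. ennreal (norm (newton_kernel z)) * indicator (ball 0 1) z) \<in> borel_measurable (distr lborel borel ((+) (- y)))"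
      unfolding measurable_distr_eq1 by measurable
  qed
  also have "\<dots> = (\<integral>\<^sup>+z. ennreal (norm (newton_kernel (z::'a))) * indicator (ball 0 1) z \<partial>lborel)"
    by (simp only: lborel_distr_plus)
  finally show ?thesis by (simp add: kernel_bound_def)
qed

section \<open>The regularised kernel and its divergence\<close>

lemma lipschitz_reg_kernel:
  assumes \<delta>: "0 < \<delta>"
  shows "((1 + real DIM('a)) * inverse (\<delta> ^ DIM('a)))-lipschitz_on UNIV (reg_kernel \<delta> :: 'a::euclidean_space \<Rightarrow> 'a)"
proof -
  define n where "n = DIM('a)"
  define a where "a z = max (norm z) \<delta>" for z :: 'a
  define m where "m z = inverse (a z ^ n)" for z :: 'a
  have a: "0 < a z" "\<delta> \<le> a z" "norm z \<le> a z" for z using \<delta> by (auto simp: a_def)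
  have a1: "\<bar>a z - a w\<bar> \<le> norm (z - w)" for z w
    unfolding a_def using norm_triangle_ineq3[of z w] by linarith
  have mb: "m w \<le> inverse (\<delta> ^ n)" for w
    unfolding m_def using a[of w] \<delta> by (intro le_imp_inverse_le power_mono) auto
  have mm: "norm z * \<bar>m z - m w\<bar> \<le> n * inverse (\<delta> ^ n) * norm (z - w)" for z w
  proof -
    \<comment> \<open>Scaling by \<delta> brings both ratios into [0, 1], where the n-th power is
      Lipschitz with constant \<open>n\<close>. The difference of the ratios yields a factor
      \<open>1 / a z\<close>, which absorbs the norm of \<open>z\<close>.\<close>
    have "\<bar>(\<delta> / a z) ^ n - (\<delta> / a w) ^ n\<bar> \<le> n * \<bar>\<delta> / a z - \<delta> / a w\<bar>"
      using norm_power_diff[of "\<delta> / a z" "\<delta> / a w" n] a[of z] a[of w] \<delta> by simp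
    also have "\<bar>\<delta> / a z - \<delta> / a w\<bar> = \<delta> * \<bar>a w - a z\<bar> / (a z * a w)"
    proof -
      have "\<delta> / a z - \<delta> / a w = \<delta> * (a w - a z) / (a z * a w)"
        using a(1)[of z] a(1)[of w] by (simp add: field_simps)
      then show ?thesis using a(1)[of z] a(1)[of w] \<delta> by (simp add: abs_mult)
    qed
    also have "\<dots> \<le> norm (z - w) / a z"
    proof -
      have "\<delta> * \<bar>a w - a z\<bar> \<le> a w * norm (z - w)" using a[of w] a1[of w z] \<delta> by (intro mult_mono) (auto simp: norm_minus_commute)
      then show ?thesis using a(1)[of z] a(1)[of w] by (simp add: field_simps)
    qed
    finally have *: "\<bar>(\<delta> / a z) ^ n - (\<delta> / a w) ^ n\<bar> \<le> n * (norm (z - w) / a z)" by (simp add: mult_left_mono)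
    have "m z - m w = inverse (\<delta> ^ n) * ((\<delta> / a z) ^ n - (\<delta> / a w) ^ n)"
      using \<delta> a(1) by (simp add: m_def power_divide field_simps)
    then have "\<bar>m z - m w\<bar> = inverse (\<delta> ^ n) * \<bar>(\<delta> / a z) ^ n - (\<delta> / a w) ^ n\<bar>"
      using \<delta> by (simp add: abs_mult)
    also have "\<dots> \<le> inverse (\<delta> ^ n) * (n * (norm (z - w) / a z))"
      using * \<delta> by (intro mult_left_mono) auto
    finally have "norm z * \<bar>m z - m w\<bar> \<le> a z * (inverse (\<delta> ^ n) * (n * (norm (z - w) / a z)))"
      using a[of z] by (intro mult_mono) auto
    also have "\<dots> = n * inverse (\<delta> ^ n) * norm (z - w)" using a(1)[of z] by (simp add: field_simps)
    finally show ?thesis .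
  qed
  have "((1 + real n) * inverse (\<delta> ^ n))-lipschitz_on UNIV (reg_kernel \<delta> :: 'a \<Rightarrow> 'a)"
  proof (rule lipschitz_onI)
    fix z w :: 'a
    have "reg_kernel \<delta> z - reg_kernel \<delta> w = m w *\<^sub>R (z - w) + (m z - m w) *\<^sub>R z"
      by (simp add: reg_kernel_def m_def a_def n_def algebra_simps)
    then have "norm (reg_kernel \<delta> z - reg_kernel \<delta> w) \<le> norm (m w *\<^sub>R (z - w)) + norm ((m z - m w) *\<^sub>R z)"
      by (metis norm_triangle_ineq)
    also have "\<dots> = m w * norm (z - w) + norm z * \<bar>m z - m w\<bar>"
      using a(1)[of w] by (simp add: m_def)
    also have "\<dots> \<le> inverse (\<delta> ^ n) * norm (z - w) + n * inverse (\<delta> ^ n) * norm (z - w)"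
      by (intro add_mono mm mult_right_mono mb) auto
    finally show "dist (reg_kernel \<delta> z) (reg_kernel \<delta> w) \<le> (1 + real n) * inverse (\<delta> ^ n) * dist z w"
      by (simp add: dist_norm algebra_simps)
  qed (use \<delta> in auto)
  then show ?thesis by (simp add: n_def)
qed

lemma partial_deriv_reg_kernel_inside:
  fixes x y b :: "'a::euclidean_space"
  assumes b: "b \<in> Basis" and z: "norm (x - y) < \<delta>"
  shows "partial_deriv b (\<lambda>x. reg_kernel \<delta> (x - y) \<bullet> b) x = inverse (\<delta> ^ DIM('a))"
proof (rule partial_deriv_eqI)
  have "((\<lambda>t. norm (x + t *\<^sub>R b - y)) \<longlongrightarrow> norm (x + 0 *\<^sub>R b - y)) (nhds 0)"
    by (intro tendsto_intros filterlim_ident)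
  then have "eventually (\<lambda>t. norm (x + t *\<^sub>R b - y) < \<delta>) (nhds 0)"
    using z by (intro order_tendstoD) auto
  then have ev: "eventually (\<lambda>t. reg_kernel \<delta> (x + t *\<^sub>R b - y) \<bullet> b = inverse (\<delta> ^ DIM('a)) * ((x - y) \<bullet> b + t)) (nhds 0)"
    by eventually_elim (use b in \<open>simp add: reg_kernel_def algebra_simps inner_diff_left inner_add_left\<close>)
  show "((\<lambda>t. reg_kernel \<delta> (x + t *\<^sub>R b - y) \<bullet> b) has_real_derivative inverse (\<delta> ^ DIM('a))) (at 0)"
    by (subst DERIV_cong_ev[OF refl ev refl]) (auto intro!: derivative_eq_intros)
qed

lemma partial_deriv_reg_kernel_outside:
  fixes x y b :: "'a::euclidean_space"
  assumes b: "b \<in> Basis" and z: "\<delta> < norm (x - y)" and \<delta>: "0 < \<delta>"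
  shows "partial_deriv b (\<lambda>x. reg_kernel \<delta> (x - y) \<bullet> b) x =
    inverse (norm (x - y) ^ DIM('a)) - real DIM('a) * ((x - y) \<bullet> b)\<^sup>2 / norm (x - y) ^ (DIM('a) + 2)"
proof (rule partial_deriv_eqI)
  define s where "s = (x - y) \<bullet> b"
  define \<rho> where "\<rho> = norm (x - y)"
  obtain m where m: "DIM('a) = Suc m" using DIM_positive[where 'a='a] by (cases "DIM('a)") auto
  have \<rho>: "0 < \<rho>" using z \<delta> unfolding \<rho>_def by linarith
  \<comment> \<open>On the line through \<open>x\<close> in direction \<open>b\<close> the squared
    norm is a quadratic polynomial in \<open>t\<close>, which reduces the derivative to a
    one-variable quotient rule.\<close>
  have nrm: "norm (x + t *\<^sub>R b - y) = sqrt (\<rho>\<^sup>2 + 2 * t * s + t\<^sup>2)" for t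
  proof -
    define w where "w = x - y"
    have eq1: "(w + t *\<^sub>R b) \<bullet> (w + t *\<^sub>R b) = w \<bullet> w + 2 * t * (w \<bullet> b) + t\<^sup>2"
      using b by (simp add: inner_add_left inner_add_right inner_commute[of b w] power2_eq_square inner_same_Basis algebra_simps)
    have eq2: "x + t *\<^sub>R b - y = w + t *\<^sub>R b" by (simp add: w_def)
    have "(x + t *\<^sub>R b - y) \<bullet> (x + t *\<^sub>R b - y) = \<rho>\<^sup>2 + 2 * t * s + t\<^sup>2"
      unfolding eq2 eq1 by (simp add: \<rho>_def s_def w_def power2_norm_eq_inner)
    then show ?thesis by (simp add: norm_eq_sqrt_inner)
  qed
  have "((\<lambda>t. norm (x + t *\<^sub>R b - y)) \<longlongrightarrow> norm (x + 0 *\<^sub>R b - y)) (nhds 0)"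
    by (intro tendsto_intros filterlim_ident)
  then have "eventually (\<lambda>t. \<delta> < norm (x + t *\<^sub>R b - y)) (nhds 0)"
    using z by (intro order_tendstoD) auto
  then have ev: "eventually (\<lambda>t. reg_kernel \<delta> (x + t *\<^sub>R b - y) \<bullet> b = (s + t) / sqrt (\<rho>\<^sup>2 + 2 * t * s + t\<^sup>2) ^ Suc m) (nhds 0)"
  proof eventually_elim
    case (elim t)
    have "(x + t *\<^sub>R b - y) \<bullet> b = s + t" using b by (simp add: s_def inner_diff_left inner_add_left)
    then show ?case using elim by (simp add: reg_kernel_def m nrm max_def divide_inverse mult.commute)
  qed
  have "((\<lambda>t. (s + t) / sqrt (\<rho>\<^sup>2 + 2 * t * s + t\<^sup>2) ^ Suc m) has_real_derivative
     (1 * \<rho> ^ Suc m - s * (real (Suc m) * (s / \<rho> * \<rho> ^ m))) / (\<rho> ^ Suc m * \<rho> ^ Suc m)) (at 0)"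
  proof -
    have at0: "sqrt (\<rho>\<^sup>2 + 2 * 0 * s + 0\<^sup>2) = \<rho>" using \<rho> by simp
    have "((\<lambda>t. \<rho>\<^sup>2 + 2 * t * s + t\<^sup>2) has_real_derivative 2 * s) (at 0)"
      by (auto intro!: derivative_eq_intros)
    moreover have "(sqrt has_real_derivative inverse \<rho> / 2) (at (\<rho>\<^sup>2 + 2 * 0 * s + 0\<^sup>2))"
      using DERIV_real_sqrt[of "\<rho>\<^sup>2"] \<rho> by simp
    ultimately have "((\<lambda>t. sqrt (\<rho>\<^sup>2 + 2 * t * s + t\<^sup>2)) has_real_derivative inverse \<rho> / 2 * (2 * s)) (at 0)"
      by (intro DERIV_chain2[where f=sqrt and g="\<lambda>t. \<rho>\<^sup>2 + 2 * t * s + t\<^sup>2"])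
    moreover have "inverse \<rho> / 2 * (2 * s) = s / \<rho>" by (simp add: inverse_eq_divide)
    ultimately have "((\<lambda>t. sqrt (\<rho>\<^sup>2 + 2 * t * s + t\<^sup>2)) has_real_derivative s / \<rho>) (at 0)"
      by simp
    from DERIV_power[OF this, of "Suc m", unfolded at0]
    have p: "((\<lambda>t. sqrt (\<rho>\<^sup>2 + 2 * t * s + t\<^sup>2) ^ Suc m) has_real_derivative real (Suc m) * (s / \<rho> * \<rho> ^ m)) (at 0)"
      by (simp only: diff_Suc_Suc diff_zero)
    have l: "((\<lambda>t. s + t) has_real_derivative 1) (at 0)" by (auto intro!: derivative_eq_intros)
    have nz: "sqrt (\<rho>\<^sup>2 + 2 * 0 * s + 0\<^sup>2) ^ Suc m \<noteq> 0" unfolding at0 using \<rho> by simp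
    from DERIV_divide[OF l p nz, unfolded at0] show ?thesis by (simp only: add_0_right)
  qed
  also have "(1 * \<rho> ^ Suc m - s * (real (Suc m) * (s / \<rho> * \<rho> ^ m))) / (\<rho> ^ Suc m * \<rho> ^ Suc m)
     = inverse (\<rho> ^ Suc m) - real (Suc m) * s\<^sup>2 / \<rho> ^ (Suc m + 2)"
  proof -
    have 1: "s * (real (Suc m) * (s / \<rho> * \<rho> ^ m)) = real (Suc m) * s\<^sup>2 * (\<rho> ^ m / \<rho>)" by (simp add: power2_eq_square)
    have 2: "(\<rho> ^ m / \<rho>) / (\<rho> ^ Suc m * \<rho> ^ Suc m) = 1 / \<rho> ^ (Suc m + 2)"
      using \<rho> by (simp add: divide_simps)
    have 3: "1 * \<rho> ^ Suc m / (\<rho> ^ Suc m * \<rho> ^ Suc m) = inverse (\<rho> ^ Suc m)" using \<rho> by (simp add: divide_simps)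
    show ?thesis unfolding diff_divide_distrib 1 3 unfolding times_divide_eq_right[symmetric] 2 by simp
  qed
  finally show "((\<lambda>t. reg_kernel \<delta> (x + t *\<^sub>R b - y) \<bullet> b) has_real_derivative
     inverse (norm (x - y) ^ DIM('a)) - real DIM('a) * ((x - y) \<bullet> b)\<^sup>2 / norm (x - y) ^ (DIM('a) + 2)) (at 0)"
    unfolding m s_def[symmetric] \<rho>_def[symmetric] by (subst DERIV_cong_ev[OF refl ev refl])
qed

text \<open>Inside the ball every partial derivative equals
  \<open>inverse (\<delta> ^ DIM('a))\<close>. Outside, the squared coordinates add up to the
  squared norm and the two terms cancel. The sphere, where the kernel has a kink, is a null
  set.\<close>

lemma AE_divergence_reg_kernel:
  fixes y :: "'a::euclidean_space"
  assumes \<delta>: "0 < \<delta>"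
  shows "AE x in lborel. (\<Sum>b\<in>Basis. partial_deriv b (\<lambda>x. reg_kernel \<delta> (x - y) \<bullet> b) x)
    = real DIM('a) * inverse (\<delta> ^ DIM('a)) * indicator (ball y \<delta>) x"
proof -
  have "sphere y \<delta> \<in> null_sets lborel"
    using negligible_sphere[of y \<delta>] by (auto simp: null_sets_completion_iff negligible_iff_null_sets)
  from AE_not_in[OF this] show ?thesis
  proof eventually_elim
    case (elim x)
    show ?case
    proof (cases "norm (x - y) < \<delta>")
      case True
      then show ?thesis by (simp add: partial_deriv_reg_kernel_inside dist_norm norm_minus_commute)
    next
      case False
      then have gt: "\<delta> < norm (x - y)" using elim by (auto simp: dist_norm norm_minus_commute)
      have "(\<Sum>b\<in>Basis. ((x - y) \<bullet> b)\<^sup>2) = (norm (x - y))\<^sup>2"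
        unfolding power2_norm_eq_inner by (subst euclidean_inner) (simp add: power2_eq_square)
      then have "(\<Sum>b\<in>Basis. partial_deriv b (\<lambda>x. reg_kernel \<delta> (x - y) \<bullet> b) x)
        = real DIM('a) * inverse (norm (x - y) ^ DIM('a)) - real DIM('a) * (norm (x - y))\<^sup>2 / norm (x - y) ^ (DIM('a) + 2)"
        using gt \<delta> by (simp add: partial_deriv_reg_kernel_outside sum_subtractf sum_divide_distrib[symmetric] sum_distrib_left[symmetric])
      also have "\<dots> = 0" using gt \<delta> by (simp add: power_add power2_eq_square field_simps)
      finally show ?thesis using False by (simp add: dist_norm norm_minus_commute)
    qed
  qed
qed


section \<open>Distributional divergence of the kernels and of Newtonian fields\<close>

lemma borel_measurable_lipschitz:
  fixes \<phi> :: "'a::euclidean_space \<Rightarrow> 'b::euclidean_space"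
  shows "L-lipschitz_on UNIV \<phi> \<Longrightarrow> \<phi> \<in> borel_measurable borel"
  by (intro borel_measurable_continuous_onI lipschitz_on_continuous_on)

lemma integral_reg_kernel_grad:
  fixes \<phi> :: "'a::euclidean_space \<Rightarrow> real"
  assumes \<phi>: "\<phi> \<in> Lip_c" and \<delta>: "0 < \<delta>"
  shows "(\<integral>x. reg_kernel \<delta> (x - y) \<bullet> grad \<phi> x \<partial>lborel)
    = - (real DIM('a) * inverse (\<delta> ^ DIM('a)) * (\<integral>x. indicator (ball y \<delta>) x * \<phi> x \<partial>lborel))"
proof -
  obtain L R B where L: "L-lipschitz_on UNIV \<phi>" and R: "0 < R" "\<And>x. R \<le> norm x \<Longrightarrow> \<phi> x = 0"
    "\<And>x. R \<le> norm x \<Longrightarrow> grad \<phi> x = 0" and B: "\<And>x. \<bar>\<phi> x\<bar> \<le> B" using Lip_cE[OF \<phi>] by metis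
  define M where "M = (1 + real DIM('a)) * inverse (\<delta> ^ DIM('a))"
  have rk: "M-lipschitz_on UNIV (reg_kernel \<delta> :: 'a \<Rightarrow> 'a)" unfolding M_def by (rule lipschitz_reg_kernel[OF \<delta>])
  have M0: "0 \<le> M" using rk by (rule lipschitz_on_nonneg)
  define g where "g b x = reg_kernel \<delta> (x - y) \<bullet> b" for b x
  have g: "M-lipschitz_on UNIV (g b)" if b: "b \<in> Basis" for b
  proof (rule lipschitz_onI)
    fix x z
    have "dist (g b x) (g b z) \<le> norm (reg_kernel \<delta> (x - y) - reg_kernel \<delta> (z - y))"
      using Basis_le_norm[OF b] by (simp add: g_def dist_real_def inner_diff_left[symmetric])
    also have "\<dots> \<le> M * dist x z"
      using lipschitz_onD[OF rk, of "x - y" "z - y"] by (simp add: dist_norm)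
    finally show "dist (g b x) (g b z) \<le> M * dist x z" .
  qed (rule M0)
  note [measurable] = borel_measurable_lipschitz[OF L]
  \<comment> \<open>The numerator offsets one power of the denominator, so the kernel is globally
    bounded and its products with the compactly supported partial derivatives of \<phi> are
    integrable.\<close>
  have bk: "norm (reg_kernel \<delta> z) \<le> inverse (\<delta> ^ (DIM('a) - 1))" for z :: 'a
  proof (cases "z = 0")
    case False
    obtain m where m: "DIM('a) = Suc m" using DIM_positive[where 'a='a] by (cases "DIM('a)") auto
    have mx: "norm z \<le> max (norm z) \<delta>" "\<delta> \<le> max (norm z) \<delta>" "0 < max (norm z) \<delta>" using \<delta> by auto
    have "norm (reg_kernel \<delta> z) = norm z / max (norm z) \<delta> * inverse (max (norm z) \<delta> ^ m)"
      using mx by (simp add: reg_kernel_def m divide_inverse)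
    also have "\<dots> \<le> 1 * inverse (\<delta> ^ m)"
      using mx \<delta> by (intro mult_mono le_imp_inverse_le power_mono) auto
    finally show ?thesis by (simp add: m)
  qed (use \<delta> in \<open>auto simp: reg_kernel_def\<close>)
  have meas: "(\<lambda>x. g b x * partial_deriv b \<phi> x) \<in> borel_measurable borel"
    "(\<lambda>x. \<phi> x * partial_deriv b (g b) x) \<in> borel_measurable borel" if "b \<in> Basis" for b
    using borel_measurable_lipschitz[OF g[OF that]] borel_measurable_partial_deriv[OF L, of b]
      borel_measurable_partial_deriv[OF g[OF that], of b] by measurable
  have int1: "integrable lborel (\<lambda>x. g b x * partial_deriv b \<phi> x)" if b: "b \<in> Basis" for b
  proof (rule integrable_bounded_support[where R=R and B="inverse (\<delta> ^ (DIM('a) - 1)) * L"])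
    show "AE x in lborel. norm (g b x * partial_deriv b \<phi> x) \<le> inverse (\<delta> ^ (DIM('a) - 1)) * L"
      using AE_partial_deriv_le[OF L, of b]
    proof eventually_elim
      case (elim x)
      have "\<bar>g b x\<bar> \<le> inverse (\<delta> ^ (DIM('a) - 1))"
        unfolding g_def by (rule order_trans[OF Basis_le_norm[OF b] bk])
      then show ?case unfolding real_norm_def abs_mult using elim b \<delta> by (intro mult_mono) auto
    qed
    show "g b x * partial_deriv b \<phi> x = 0" if "R \<le> norm x" for x
      using arg_cong[OF R(3)[OF that], of "\<lambda>v. v \<bullet> b"] b by (simp add: grad_def inner_sum_left_Basis)
  qed (rule meas[OF b])
  have int2: "integrable lborel (\<lambda>x. \<phi> x * partial_deriv b (g b) x)" if b: "b \<in> Basis" for b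
  proof (rule integrable_bounded_support[where R=R and B="B * M"])
    show "AE x in lborel. norm (\<phi> x * partial_deriv b (g b) x) \<le> B * M"
      using AE_partial_deriv_le[OF g[OF b], of b]
    proof eventually_elim
      case (elim x)
      have "0 \<le> B" using B[of x] by linarith
      then show ?case unfolding real_norm_def abs_mult using elim b B[of x] by (intro mult_mono) auto
    qed
  qed (use R(2) meas[OF b] in auto)
  have "(\<integral>x. reg_kernel \<delta> (x - y) \<bullet> grad \<phi> x \<partial>lborel) = (\<integral>x. (\<Sum>b\<in>Basis. g b x * partial_deriv b \<phi> x) \<partial>lborel)"
    by (simp add: inner_grad g_def)
  also have "\<dots> = (\<Sum>b\<in>Basis. \<integral>x. g b x * partial_deriv b \<phi> x \<partial>lborel)"
    by (intro Bochner_Integration.integral_sum int1)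
  also have "\<dots> = (\<Sum>b\<in>Basis. - (\<integral>x. \<phi> x * partial_deriv b (g b) x \<partial>lborel))"
    by (intro sum.cong refl lipschitz_integration_by_parts[OF L g R(2)])
  also have "\<dots> = - (\<integral>x. (\<Sum>b\<in>Basis. \<phi> x * partial_deriv b (g b) x) \<partial>lborel)"
    by (subst Bochner_Integration.integral_sum) (auto simp: int2 sum_negf)
  also have "(\<integral>x. (\<Sum>b\<in>Basis. \<phi> x * partial_deriv b (g b) x) \<partial>lborel)
      = (\<integral>x. real DIM('a) * inverse (\<delta> ^ DIM('a)) * (indicator (ball y \<delta>) x * \<phi> x) \<partial>lborel)"
  proof (rule integral_cong_AE)
    have "AE x in lborel. (\<Sum>b\<in>Basis. partial_deriv b (g b) x)
        = real DIM('a) * inverse (\<delta> ^ DIM('a)) * indicator (ball y \<delta>) x"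
      unfolding g_def[abs_def] by (rule AE_divergence_reg_kernel[OF \<delta>])
    then show "AE x in lborel. (\<Sum>b\<in>Basis. \<phi> x * partial_deriv b (g b) x)
       = real DIM('a) * inverse (\<delta> ^ DIM('a)) * (indicator (ball y \<delta>) x * \<phi> x)"
      by eventually_elim (simp add: sum_distrib_left[symmetric])
  qed (use meas(2) in \<open>auto intro!: borel_measurable_sum\<close>)
  finally show ?thesis by simp
qed

text \<open>As \<delta> tends to 0, the regularised identity has on its right the constant
  \<open>DIM('a) * unit_ball_vol DIM('a)\<close> times the mean of \<phi> over a shrinking ball
  about \<open>y\<close>, and this mean differs from \<open>\<phi> y\<close> by at most
  \<open>L * \<delta>\<close>. On the left, the Newtonian kernel on a large ball, times a bound for
  the gradient, is an integrable majorant.\<close>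

lemma integral_newton_kernel_grad:
  fixes \<phi> :: "'a::euclidean_space \<Rightarrow> real"
  assumes \<phi>: "\<phi> \<in> Lip_c"
  shows "(\<integral>x. newton_kernel (x - y) \<bullet> grad \<phi> x \<partial>lborel) = - (real DIM('a) * unit_ball_vol DIM('a) * \<phi> y)"
proof -
  obtain L R B where L: "L-lipschitz_on UNIV \<phi>" and R: "\<And>x. R \<le> norm x \<Longrightarrow> grad \<phi> x = 0" and B: "\<And>x. \<bar>\<phi> x\<bar> \<le> B" using Lip_cE[OF \<phi>] by metis
  obtain C where C: "0 \<le> C" "\<And>x. norm (grad \<phi> x) \<le> C" using bounded_grad[OF L] by metis
  note [measurable] = borel_measurable_lipschitz[OF L] borel_measurable_grad[OF L]
  define d where "d j = inverse (real (Suc j))" for j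
  have d: "0 < d j" for j by (simp add: d_def)
  have d0: "d \<longlonglongrightarrow> 0" unfolding d_def by (rule LIMSEQ_inverse_real_of_nat)
  have intk: "integrable lborel (\<lambda>x. C * (norm (newton_kernel (x - y)) * indicator (cball 0 R) x))"
  proof (intro integrable_mult_right integrableI_nonneg)
    have "(\<integral>\<^sup>+x. ennreal (norm (newton_kernel (x - y)) * indicator (cball 0 R) x) \<partial>lborel)
        = (\<integral>\<^sup>+x. ennreal (norm (newton_kernel (x - y))) * indicator (cball 0 R) x \<partial>lborel)"
      by (intro nn_integral_cong) (auto simp: indicator_def)
    also have "\<dots> < \<infinity>" using nn_integral_kernel_le kernel_bound_finite by (rule le_less_trans)
    finally show "(\<integral>\<^sup>+x. ennreal (norm (newton_kernel (x - y)) * indicator (cball 0 R) x) \<partial>lborel) < \<infinity>" .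
  qed auto
  have lim1: "(\<lambda>j. \<integral>x. reg_kernel (d j) (x - y) \<bullet> grad \<phi> x \<partial>lborel) \<longlonglongrightarrow> (\<integral>x. newton_kernel (x - y) \<bullet> grad \<phi> x \<partial>lborel)"
  proof (rule integral_dominated_convergence[OF _ _ intk])
    show "AE x in lborel. (\<lambda>j. reg_kernel (d j) (x - y) \<bullet> grad \<phi> x) \<longlonglongrightarrow> newton_kernel (x - y) \<bullet> grad \<phi> x"
    proof (rule AE_I2)
      fix x
      have "(\<lambda>j. reg_kernel (d j) (x - y)) \<longlonglongrightarrow> newton_kernel (x - y)"
      proof (cases "x = y")
        case False
        then have "eventually (\<lambda>j. d j < norm (x - y)) sequentially" using d0 by (intro order_tendstoD) auto
        then have "eventually (\<lambda>j. reg_kernel (d j) (x - y) = newton_kernel (x - y)) sequentially"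
          by eventually_elim (simp add: reg_kernel_def newton_kernel_def)
        then show ?thesis by (rule tendsto_eventually)
      qed (simp add: reg_kernel_def newton_kernel_def)
      then show "(\<lambda>j. reg_kernel (d j) (x - y) \<bullet> grad \<phi> x) \<longlonglongrightarrow> newton_kernel (x - y) \<bullet> grad \<phi> x"
        by (intro tendsto_inner tendsto_const)
    qed
    show "AE x in lborel. norm (reg_kernel (d j) (x - y) \<bullet> grad \<phi> x)
        \<le> C * (norm (newton_kernel (x - y)) * indicator (cball 0 R) x)" for j
    proof (rule AE_I2)
      fix x
      have "norm (reg_kernel (d j) z) \<le> norm (newton_kernel z)" for z :: 'a
      proof (cases "z = 0")
        case False
        have "inverse (max (norm z) (d j) ^ DIM('a)) \<le> inverse (norm z ^ DIM('a))"
          using False by (intro le_imp_inverse_le power_mono) auto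
        then show ?thesis using d[of j] False
          by (simp add: reg_kernel_def newton_kernel_def mult_right_mono)
      qed (simp add: reg_kernel_def)
      then have k: "norm (reg_kernel (d j) (x - y)) \<le> norm (newton_kernel (x - y))" .
      show "norm (reg_kernel (d j) (x - y) \<bullet> grad \<phi> x)
        \<le> C * (norm (newton_kernel (x - y)) * indicator (cball 0 R) x)"
      proof (cases "norm x \<le> R")
        case True
        have "norm (reg_kernel (d j) (x - y) \<bullet> grad \<phi> x) \<le> norm (reg_kernel (d j) (x - y)) * norm (grad \<phi> x)"
          by (simp add: Cauchy_Schwarz_ineq2)
        also have "\<dots> \<le> norm (newton_kernel (x - y)) * C" using C k by (intro mult_mono) auto
        finally show ?thesis using True by (simp add: mult.commute)
      qed (use R[of x] in auto)
    qed
  qed auto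
  have lim2: "(\<lambda>j. real DIM('a) * inverse (d j ^ DIM('a)) * (\<integral>x. indicator (ball y (d j)) x * \<phi> x \<partial>lborel))
      \<longlonglongrightarrow> real DIM('a) * unit_ball_vol DIM('a) * \<phi> y"
  proof -
    define J where "J j = (\<integral>x. indicator (ball y (d j)) x * \<phi> x \<partial>lborel)" for j
    define w where "w = unit_ball_vol DIM('a)"
    have "\<bar>inverse (d j ^ DIM('a)) * J j - w * \<phi> y\<bar> \<le> L * w * d j" for j
    proof -
      have fin: "emeasure lborel (ball y (d j)) < \<infinity>"
        using d[of j] by (simp add: emeasure_ball)
      have i1: "integrable lborel (\<lambda>x. indicator (ball y (d j)) x * \<phi> x)"
      proof (rule Bochner_Integration.integrable_bound)
        show "integrable lborel (\<lambda>x. B * indicator (ball y (d j)) x)"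
          by (intro integrable_mult_right integrable_real_indicator) (simp, rule fin)
        show "AE x in lborel. norm (indicator (ball y (d j)) x * \<phi> x) \<le> norm (B * indicator (ball y (d j)) x)"
        proof (rule AE_I2)
          fix x
          have "\<bar>\<phi> x\<bar> \<le> \<bar>B\<bar>" using B[of x] by linarith
          then show "norm (indicator (ball y (d j)) x * \<phi> x) \<le> norm (B * indicator (ball y (d j)) x)"
            by (simp add: indicator_def)
        qed
      qed measurable
      have i2: "integrable lborel (\<lambda>x. indicator (ball y (d j)) x * c)" for c :: real
        by (intro integrable_mult_left integrable_real_indicator) (simp, rule fin)
      have vol: "(\<integral>x. indicator (ball y (d j)) x * c \<partial>lborel) = w * d j ^ DIM('a) * c" for c :: real
        using d[of j] by (simp add: w_def content_ball)
      have "\<bar>(\<integral>x. indicator (ball y (d j)) x * \<phi> x \<partial>lborel) - (\<integral>x. indicator (ball y (d j)) x * \<phi> y \<partial>lborel)\<bar>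
         = \<bar>\<integral>x. indicator (ball y (d j)) x * \<phi> x - indicator (ball y (d j)) x * \<phi> y \<partial>lborel\<bar>"
        using i1 i2 by (subst Bochner_Integration.integral_diff) auto
      also have "\<dots> \<le> (\<integral>x. indicator (ball y (d j)) x * (L * d j) \<partial>lborel)"
      proof (rule order_trans[OF integral_abs_bound], rule integral_mono)
        show "integrable lborel (\<lambda>x. \<bar>indicator (ball y (d j)) x * \<phi> x - indicator (ball y (d j)) x * \<phi> y\<bar>)"
          using i1 i2 by auto
        fix x
        have "\<bar>\<phi> x - \<phi> y\<bar> \<le> L * d j" if "dist y x < d j"
          using lipschitz_onD[OF L, of x y] mult_left_mono[of "dist x y" "d j" L] that lipschitz_on_nonneg[OF L]
          by (auto simp: dist_real_def dist_commute)
        then show "\<bar>indicator (ball y (d j)) x * \<phi> x - indicator (ball y (d j)) x * \<phi> y\<bar> \<le> indicator (ball y (d j)) x * (L * d j)"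
          by (auto simp: indicator_def)
      qed (rule i2)
      finally have *: "\<bar>J j - w * d j ^ DIM('a) * \<phi> y\<bar> \<le> w * d j ^ DIM('a) * (L * d j)"
        unfolding vol J_def .
      have "inverse (d j ^ DIM('a)) * J j - w * \<phi> y
        = inverse (d j ^ DIM('a)) * (J j - w * d j ^ DIM('a) * \<phi> y)"
        using d[of j] by (simp add: field_simps)
      then have "\<bar>inverse (d j ^ DIM('a)) * J j - w * \<phi> y\<bar>
        = inverse (d j ^ DIM('a)) * \<bar>J j - w * d j ^ DIM('a) * \<phi> y\<bar>"
        using d[of j] by (simp add: abs_mult)
      also have "\<dots> \<le> inverse (d j ^ DIM('a)) * (w * d j ^ DIM('a) * (L * d j))"
        using * d[of j] by (intro mult_left_mono) auto
      also have "\<dots> = L * w * d j" using d[of j] by (simp add: field_simps)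
      finally show ?thesis .
    qed
    then have "eventually (\<lambda>j. norm (inverse (d j ^ DIM('a)) * J j - w * \<phi> y) \<le> L * w * d j) sequentially"
      by auto
    from Lim_null_comparison[OF this]
    have "(\<lambda>j. inverse (d j ^ DIM('a)) * J j - w * \<phi> y) \<longlonglongrightarrow> 0"
      using tendsto_mult_right_zero[OF d0, of "L * w"] by simp
    then have "(\<lambda>j. inverse (d j ^ DIM('a)) * J j) \<longlonglongrightarrow> w * \<phi> y"
      by (simp add: LIM_zero_iff)
    from tendsto_mult[OF tendsto_const this, of "real DIM('a)"]
    show ?thesis by (simp add: mult.assoc w_def J_def)
  qed
  show ?thesis
    by (rule LIMSEQ_unique[OF lim1]) (unfold integral_reg_kernel_grad[OF \<phi> d], rule tendsto_minus[OF lim2])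
qed

text \<open>The normalising factor is left out. Where the kernel is not integrable, the Bochner
  integral has the value 0; for a finite Borel measure this happens only on a Lebesgue null set, by
  Fubini's theorem.\<close>

definition newton_field :: "'a::euclidean_space measure \<Rightarrow> 'a \<Rightarrow> 'a" where
  "newton_field P x = (\<integral>y. newton_kernel (x - y) \<partial>P)"

text \<open>Integrating in \<open>x\<close> first gives a bound uniform in \<open>y\<close>, so the
  kernel is integrable for the product of Lebesgue measure on a ball with \<open>P\<close>. Fubini's
  theorem then carries the identity for the kernel with a single pole over to
  \<open>P\<close>.\<close>

lemma
  fixes P :: "'a::euclidean_space measure"
  assumes P: "finite_measure P" and sP [measurable_cong, simp]: "sets P = sets borel"
  shows borel_measurable_newton_field: "newton_field P \<in> borel_measurable borel" (is ?M)
    and integrable_newton_field: "integrable lborel (\<lambda>x. indicator (cball 0 R) x *\<^sub>R newton_field P x)" (is ?I)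
    and integral_newton_field_grad: "\<phi> \<in> Lip_c \<Longrightarrow>
       (\<integral>x. newton_field P x \<bullet> grad \<phi> x \<partial>lborel) = - (real DIM('a) * unit_ball_vol DIM('a) * (\<integral>y. \<phi> y \<partial>P))"
proof -
  interpret P: finite_measure P by fact
  interpret pair_sigma_finite lborel P by standard
  show ?M unfolding newton_field_def[abs_def] by measurable
  have int: "integrable (lborel \<Otimes>\<^sub>M P) (\<lambda>(x, y). indicator (cball 0 R) x *\<^sub>R newton_kernel (x - y))" for R
  proof (rule integrableI_bounded)
    have "(\<integral>\<^sup>+p. ennreal (norm (case p of (x, y) \<Rightarrow> indicator (cball 0 R) x *\<^sub>R newton_kernel (x - y))) \<partial>(lborel \<Otimes>\<^sub>M P))
      = (\<integral>\<^sup>+y. \<integral>\<^sup>+x. ennreal (norm (indicator (cball 0 R) x *\<^sub>R newton_kernel (x - y))) \<partial>lborel \<partial>P)"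
      by (subst nn_integral_snd[symmetric]) auto
    also have "\<dots> = (\<integral>\<^sup>+y. \<integral>\<^sup>+x. ennreal (norm (newton_kernel (x - y))) * indicator (cball 0 R) x \<partial>lborel \<partial>P)"
      by (intro nn_integral_cong) (simp add: indicator_def)
    also have "\<dots> \<le> (\<integral>\<^sup>+y. kernel_bound TYPE('a) R \<partial>P)"
      by (intro nn_integral_mono nn_integral_kernel_le)
    also have "\<dots> < \<infinity>"
      using kernel_bound_finite[where 'a='a, of R] P.emeasure_finite[of "space P"]
      by (auto simp: ennreal_mult_eq_top_iff less_top[symmetric])
    finally show "(\<integral>\<^sup>+p. ennreal (norm (case p of (x, y) \<Rightarrow> indicator (cball 0 R) x *\<^sub>R newton_kernel (x - y))) \<partial>(lborel \<Otimes>\<^sub>M P)) < \<infinity>" .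
  qed measurable
  show ?I
    using integrable_fst[OF int] by (simp add: newton_field_def)
  assume \<phi>: "\<phi> \<in> Lip_c"
  obtain L R where L: "L-lipschitz_on UNIV \<phi>" and R: "\<And>x. R \<le> norm x \<Longrightarrow> grad \<phi> x = 0"
    using Lip_cE[OF \<phi>] by metis
  obtain C where C: "0 \<le> C" "\<And>x. norm (grad \<phi> x) \<le> C" using bounded_grad[OF L] by metis
  note [measurable] = borel_measurable_lipschitz[OF L] borel_measurable_grad[OF L]
  have int': "integrable (lborel \<Otimes>\<^sub>M P) (\<lambda>(x, y). newton_kernel (x - y) \<bullet> grad \<phi> x)"
  proof (rule Bochner_Integration.integrable_bound[OF integrable_mult_right[OF integrable_norm[OF int[of R]], of C]])
    show "AE p in lborel \<Otimes>\<^sub>M P. norm (case p of (x, y) \<Rightarrow> newton_kernel (x - y) \<bullet> grad \<phi> x)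
        \<le> norm (C * norm (case p of (x, y) \<Rightarrow> indicator (cball 0 R) x *\<^sub>R newton_kernel (x - y)))"
    proof (rule AE_I2, clarify)
      fix x y
      show "norm (newton_kernel (x - y) \<bullet> grad \<phi> x) \<le> norm (C * norm (indicator (cball 0 R) x *\<^sub>R newton_kernel (x - y)))"
      proof (cases "norm x \<le> R")
        case True
        have "norm (newton_kernel (x - y) \<bullet> grad \<phi> x) \<le> norm (newton_kernel (x - y)) * norm (grad \<phi> x)"
          by (simp add: Cauchy_Schwarz_ineq2)
        also have "\<dots> \<le> norm (newton_kernel (x - y)) * C" using C by (intro mult_left_mono) auto
        finally show ?thesis using True C by (simp add: mult.commute abs_mult)
      qed (use R[of x] in auto)
    qed
  qed measurable
  have "(\<integral>x. newton_field P x \<bullet> grad \<phi> x \<partial>lborel) = (\<integral>x. (\<integral>y. newton_kernel (x - y) \<bullet> grad \<phi> x \<partial>P) \<partial>lborel)"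
  proof (rule integral_cong_AE)
    \<comment> \<open>The inner product may enter the integral wherever the kernel is integrable in
      \<open>y\<close>, which holds for almost every \<open>x\<close> in the ball of radius
      \<open>R\<close>; outside it the gradient is 0.\<close>
    show "AE x in lborel. newton_field P x \<bullet> grad \<phi> x = (\<integral>y. newton_kernel (x - y) \<bullet> grad \<phi> x \<partial>P)"
      using AE_integrable_fst[OF int[of R]]
    proof eventually_elim
      case (elim x)
      show ?case
      proof (cases "norm x \<le> R")
        case True
        then have "integrable P (\<lambda>y. newton_kernel (x - y))" using elim by simp
        then show ?thesis unfolding newton_field_def by (intro integral_inner_left[symmetric])
      qed (use R[of x] in auto)
    qed
    show "(\<lambda>x. newton_field P x \<bullet> grad \<phi> x) \<in> borel_measurable lborel" using \<open>?M\<close> by measurable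
  qed measurable
  also have "\<dots> = (\<integral>y. (\<integral>x. newton_kernel (x - y) \<bullet> grad \<phi> x \<partial>lborel) \<partial>P)"
    by (rule Fubini_integral[OF int', symmetric])
  also have "\<dots> = (\<integral>y. - (real DIM('a) * unit_ball_vol DIM('a) * \<phi> y) \<partial>P)"
    by (simp only: integral_newton_kernel_grad[OF \<phi>])
  finally show "(\<integral>x. newton_field P x \<bullet> grad \<phi> x \<partial>lborel) = - (real DIM('a) * unit_ball_vol DIM('a) * (\<integral>y. \<phi> y \<partial>P))"
    by simp
qed

section \<open>Weak compactness of measures\<close>

definition clamp01 :: "real \<Rightarrow> real" where
  "clamp01 u = max 0 (min 1 u)"

text \<open>On the Cantor set, the left shift of ternary digits: \<open>3 * t - 1\<close> is at most
  0 if the leading digit is 0 and at least 1 if it is 2, so the clamp detects that digit and twice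
  the clamp removes it. Linear interpolation across the middle third makes the shift continuous on
  the whole line.\<close>

definition cantor_shift :: "real \<Rightarrow> real" where
  "cantor_shift t = 3 * t - 2 * clamp01 (3 * t - 1)"

definition cantor_digit :: "nat \<Rightarrow> real \<Rightarrow> real" where
  "cantor_digit i t = clamp01 (3 * (cantor_shift ^^ i) t - 1)"

text \<open>Doubling the digits 0 and 1 leaves only the ternary digits 0 and 2, which the gaps of
  the Cantor set keep apart.\<close>

definition cantor_point :: "(nat \<Rightarrow> real) \<Rightarrow> real" where
  "cantor_point D = (\<Sum>i. 2 * D i / 3 ^ Suc i)"

definition binary_digit :: "nat \<Rightarrow> real \<Rightarrow> real" where
  "binary_digit i r = real_of_int \<lfloor>2 ^ Suc i * r\<rfloor> - 2 * real_of_int \<lfloor>2 ^ i * r\<rfloor>"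

section \<open>Ternary and binary digits\<close>

lemma continuous_cantor_digit: "continuous_on UNIV (cantor_digit i)"
proof -
  have sh: "continuous_on UNIV cantor_shift"
    unfolding cantor_shift_def[abs_def] clamp01_def by (intro continuous_intros)
  have "continuous_on UNIV (cantor_shift ^^ i)"
  proof (induction i)
    case (Suc i)
    have "continuous_on UNIV (\<lambda>x. cantor_shift ((cantor_shift ^^ i) x))"
      by (rule continuous_on_compose2[OF sh Suc]) auto
    then show ?case by (simp add: o_def)
  qed (simp add: id_def)
  then show ?thesis
    unfolding cantor_digit_def[abs_def] clamp01_def by (intro continuous_intros)
qed

lemma summable_cantor_point:
  fixes D :: "nat \<Rightarrow> real"
  assumes "\<And>i. D i \<in> {0, 1}"
  shows "summable (\<lambda>i. 2 * D i / 3 ^ Suc i)"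
proof (rule summable_comparison_test')
  show "summable (\<lambda>i. 2 * (1/3) ^ Suc i :: real)" by (intro summable_mult) simp
  show "norm (2 * D i / 3 ^ Suc i) \<le> 2 * (1/3) ^ Suc i" for i
    using assms[of i] by (auto simp: power_divide)
qed

lemma cantor_point_bounds:
  fixes D :: "nat \<Rightarrow> real"
  assumes D: "\<And>i. D i \<in> {0, 1}"
  shows "0 \<le> cantor_point D" "cantor_point D \<le> 1"
proof -
  have D01: "0 \<le> D i" "D i \<le> 1" for i using D[of i] by auto
  show "0 \<le> cantor_point D" unfolding cantor_point_def
    by (intro suminf_nonneg summable_cantor_point D) (use D01 in auto)
  have "(\<Sum>i. 2 * D i / 3 ^ Suc i) \<le> (\<Sum>i. 2 / 3 * (1/3) ^ i)"
  proof (rule suminf_le)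
    show "2 * D i / 3 ^ Suc i \<le> 2 / 3 * (1/3) ^ i" for i
      using D[of i] by (auto simp: power_divide)
    show "summable (\<lambda>i. 2 * D i / 3 ^ Suc i)" by (rule summable_cantor_point[OF D])
    show "summable (\<lambda>i. 2 / 3 * (1/3) ^ i :: real)" by (intro summable_mult) simp
  qed
  also have "\<dots> = 2 / 3 * (\<Sum>i. (1/3) ^ i)" by (intro suminf_mult) simp
  also have "\<dots> = 1" by (subst suminf_geometric) auto
  finally show "cantor_point D \<le> 1" by (simp add: cantor_point_def)
qed

text \<open>Three times the point is \<open>2 * D 0\<close> plus a tail in [0, 1]. After subtracting
  1 the value lies in [-1, 0] or in [1, 2] according to the first digit, so the clamp returns that
  digit exactly, even for the extreme tails 0 and 1.\<close>

lemma cantor_point_step: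
  fixes D :: "nat \<Rightarrow> real"
  assumes D: "\<And>i. D i \<in> {0, 1}"
  shows "clamp01 (3 * cantor_point D - 1) = D 0" "cantor_shift (cantor_point D) = cantor_point (\<lambda>i. D (Suc i))"
proof -
  have "cantor_point D = 2 * D 0 / 3 + (\<Sum>i. 2 * D (Suc i) / 3 ^ Suc (Suc i))"
    unfolding cantor_point_def by (subst suminf_split_head[OF summable_cantor_point[OF D]]) simp
  also have "(\<Sum>i. 2 * D (Suc i) / 3 ^ Suc (Suc i)) = (\<Sum>i. (1 / 3) * (2 * D (Suc i) / 3 ^ Suc i))"
    by simp
  also have "\<dots> = (1 / 3) * cantor_point (\<lambda>i. D (Suc i))"
    unfolding cantor_point_def by (intro suminf_mult summable_cantor_point D)
  finally have eq: "3 * cantor_point D = 2 * D 0 + cantor_point (\<lambda>i. D (Suc i))" by simp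
  have b: "0 \<le> cantor_point (\<lambda>i. D (Suc i))" "cantor_point (\<lambda>i. D (Suc i)) \<le> 1"
    by (rule cantor_point_bounds, rule D)+
  show 1: "clamp01 (3 * cantor_point D - 1) = D 0"
  proof -
    consider "D 0 = 0" | "D 0 = 1" using D[of 0] by auto
    then show ?thesis using b unfolding eq by cases (auto simp: clamp01_def)
  qed
  show "cantor_shift (cantor_point D) = cantor_point (\<lambda>i. D (Suc i))"
  proof -
    have "cantor_shift (cantor_point D) = 3 * cantor_point D - 2 * D 0" by (simp only: cantor_shift_def 1)
    then show ?thesis using eq by simp
  qed
qed

lemma cantor_digit_point:
  fixes D :: "nat \<Rightarrow> real"
  assumes D: "\<And>i. D i \<in> {0, 1}"
  shows "cantor_digit i (cantor_point D) = D i"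
proof -
  have "(cantor_shift ^^ i) (cantor_point D) = cantor_point (\<lambda>k. D (k + i))"
  proof (induction i)
    case (Suc i)
    have "cantor_shift (cantor_point (\<lambda>k. D (k + i))) = cantor_point (\<lambda>k. D (Suc k + i))"
      by (rule cantor_point_step(2)) (rule D)
    then show ?case using Suc by simp
  qed simp
  then show ?thesis using cantor_point_step(1)[of "\<lambda>k. D (k + i)", OF D] by (simp add: cantor_digit_def)
qed

lemma binary_digit_01: "binary_digit i r \<in> {0, 1}"
proof -
  define k where "k = \<lfloor>2 ^ i * r\<rfloor>"
  define l where "l = \<lfloor>2 ^ Suc i * r\<rfloor>"
  have k: "of_int k \<le> 2 ^ i * r" "2 ^ i * r < of_int k + 1" by (auto simp: k_def)
  have l: "of_int l \<le> 2 * (2 ^ i * r)" "2 * (2 ^ i * r) < of_int l + 1"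
  proof -
    have "2 ^ Suc i * r = 2 * (2 ^ i * r)" by simp
    then show "of_int l \<le> 2 * (2 ^ i * r)" "2 * (2 ^ i * r) < of_int l + 1" unfolding l_def by linarith+
  qed
  have "of_int (2 * k) < (of_int (l + 1) :: real)" "of_int l < (of_int (2 * k + 2) :: real)"
    using k l by auto
  then have "2 * k < l + 1" "l < 2 * k + 2" by linarith+
  then have "l = 2 * k \<or> l = 2 * k + 1" by linarith
  then show ?thesis unfolding binary_digit_def k_def[symmetric] l_def[symmetric] by auto
qed

text \<open>The partial sums telescope to the floor of \<open>2 ^ k * r\<close> divided by
  \<open>2 ^ k\<close>, which is within \<open>(1/2) ^ k\<close> of \<open>r\<close>. The telescope
  starts at 0 because \<open>r < 1\<close> makes the floor of \<open>r\<close> vanish.\<close>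

lemma binary_digits_sums:
  assumes "0 \<le> r" "r < 1"
  shows "(\<lambda>i. (1/2) ^ Suc i * binary_digit i r) sums r"
proof -
  have part: "(\<Sum>i<k. (1/2) ^ Suc i * binary_digit i r) = real_of_int \<lfloor>2 ^ k * r\<rfloor> / 2 ^ k" for k
  proof (induction k)
    case 0
    have "\<lfloor>r\<rfloor> = 0" using assms by (simp add: floor_eq_iff)
    then show ?case by simp
  next
    case (Suc k)
    then show ?case by (simp add: binary_digit_def power_divide field_simps)
  qed
  have "(\<lambda>k. real_of_int \<lfloor>2 ^ k * r\<rfloor> / 2 ^ k) \<longlonglongrightarrow> r"
  proof (rule tendsto_sandwich[of "\<lambda>k. r - (1/2) ^ k" _ _ "\<lambda>k. r"])
    have "r - (1/2) ^ k \<le> real_of_int \<lfloor>2 ^ k * r\<rfloor> / 2 ^ k" for k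
    proof -
      have "2 ^ k * r - 1 \<le> real_of_int \<lfloor>2 ^ k * r\<rfloor>" by linarith
      then have "(2 ^ k * r - 1) / 2 ^ k \<le> real_of_int \<lfloor>2 ^ k * r\<rfloor> / 2 ^ k" by (intro divide_right_mono) auto
      moreover have "(2 ^ k * r - 1) / 2 ^ k = r - (1/2) ^ k" by (simp add: diff_divide_distrib power_divide)
      ultimately show ?thesis by simp
    qed
    then show "eventually (\<lambda>k. r - (1/2) ^ k \<le> real_of_int \<lfloor>2 ^ k * r\<rfloor> / 2 ^ k) sequentially" by simp
    have "real_of_int \<lfloor>2 ^ k * r\<rfloor> / 2 ^ k \<le> r" for k
      using of_int_floor_le[of "2 ^ k * r"] by (simp add: field_simps)
    then show "eventually (\<lambda>k. real_of_int \<lfloor>2 ^ k * r\<rfloor> / 2 ^ k \<le> r) sequentially" by simp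
    have "(\<lambda>k. r - (1/2) ^ k) \<longlonglongrightarrow> r - 0" by (intro tendsto_intros LIMSEQ_power_zero) auto
    then show "(\<lambda>k. r - (1/2) ^ k) \<longlonglongrightarrow> r" by simp
  qed simp
  then show ?thesis unfolding sums_def part .
qed

lemma borel_measurable_binary_digit [measurable]: "binary_digit i \<in> borel_measurable borel"
  unfolding binary_digit_def[abs_def] by measurable

text \<open>The digits of the coordinates are interleaved into the ternary digits of a point of the
  Cantor set, from which they are read off continuously.\<close>

lemma cube_section:
  obtains h :: "real \<Rightarrow> 'a::euclidean_space" and s :: "'a \<Rightarrow> real"
  where "continuous_on UNIV h" "s \<in> borel_measurable borel" "\<And>x. 0 \<le> s x" "\<And>x. s x \<le> 1"
    "\<And>x. (\<And>b. b \<in> Basis \<Longrightarrow> 0 \<le> x \<bullet> b \<and> x \<bullet> b < 1) \<Longrightarrow> h (s x) = x"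
proof -
  define A where "A = (UNIV :: nat set) \<times> (Basis :: 'a set)"
  have cA: "countable A" unfolding A_def by (intro countable_SIGMA) (auto simp: countable_finite)
  define D where "D x m = (case from_nat_into A m of (i, b) \<Rightarrow> binary_digit i (x \<bullet> b))" for x m
  define s where "s x = cantor_point (D x)" for x
  define c where "c b t = (\<Sum>i. (1/2) ^ Suc i * cantor_digit (to_nat_on A (i, b)) t)" for b t
  define h where "h t = (\<Sum>b\<in>Basis. c b t *\<^sub>R b)" for t
  have D01: "D x m \<in> {0, 1}" for x m
    unfolding D_def using binary_digit_01 by (auto split: prod.split)
  \<comment> \<open>Each digit is a continuous function of the code, and the geometric weights make
    the series converge uniformly on the whole line.\<close>
  have cont: "continuous_on UNIV (c b)" for b
  proof -
    have "uniform_limit UNIV (\<lambda>n t. \<Sum>i<n. (1/2) ^ Suc i * cantor_digit (to_nat_on A (i, b)) t) (c b) sequentially"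
      unfolding c_def[abs_def]
    proof (rule Weierstrass_m_test)
      show "norm ((1/2) ^ Suc i * cantor_digit (to_nat_on A (i, b)) t) \<le> (1/2) ^ Suc i" for i t
      proof -
        have "\<bar>cantor_digit (to_nat_on A (i, b)) t\<bar> \<le> 1" by (auto simp: cantor_digit_def clamp01_def)
        then show ?thesis by (simp add: abs_mult)
      qed
      show "summable (\<lambda>i. (1/2) ^ Suc i :: real)" by simp
    qed
    then show ?thesis
      by (rule uniform_limit_theorem[rotated])
         (auto intro!: always_eventually continuous_intros continuous_cantor_digit)
  qed
  show thesis
  proof (rule that[of h s])
    show "continuous_on UNIV h" unfolding h_def by (intro continuous_intros cont)
    have "(\<lambda>x. D x m) \<in> borel_measurable borel" for m
      unfolding D_def by (cases "from_nat_into A m") simp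
    then show "s \<in> borel_measurable borel" unfolding s_def[abs_def] cantor_point_def by measurable
    show "0 \<le> s x" "s x \<le> 1" for x unfolding s_def by (rule cantor_point_bounds, rule D01)+
    fix x :: 'a assume x: "\<And>b. b \<in> Basis \<Longrightarrow> 0 \<le> x \<bullet> b \<and> x \<bullet> b < 1"
    have "c b (s x) = x \<bullet> b" if b: "b \<in> Basis" for b
    proof -
      have "cantor_digit (to_nat_on A (i, b)) (s x) = binary_digit i (x \<bullet> b)" for i
      proof -
        have "(i, b) \<in> A" using b by (simp add: A_def)
        then show ?thesis unfolding s_def cantor_digit_point[OF D01] D_def
          using cA by simp
      qed
      then show ?thesis unfolding c_def using binary_digits_sums[of "x \<bullet> b"] x[OF b] by (simp add: sums_iff)
    qed
    then show "h (s x) = x" by (simp add: h_def euclidean_representation)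
  qed
qed

section \<open>Coding a ball by points of the unit interval\<close>

lemma ball_section:
  assumes R: "0 < R"
  obtains h :: "real \<Rightarrow> 'a::euclidean_space" and s :: "'a \<Rightarrow> real"
  where "continuous_on UNIV h" "s \<in> borel_measurable borel" "\<And>x. 0 \<le> s x" "\<And>x. s x \<le> 1"
    "\<And>x. norm x < R \<Longrightarrow> h (s x) = x"
proof -
  obtain h :: "real \<Rightarrow> 'a" and s where h: "continuous_on UNIV h" and [measurable]: "s \<in> borel_measurable borel"
    and s: "\<And>x. 0 \<le> s x" "\<And>x. s x \<le> 1"
    and hs: "\<And>x. (\<And>b. b \<in> Basis \<Longrightarrow> 0 \<le> x \<bullet> b \<and> x \<bullet> b < 1) \<Longrightarrow> h (s x) = x"
    using cube_section by metis
  \<comment> \<open>The centre of the unit cube: \<open>x / (2 * R) + z\<close> maps the open ball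
    of radius \<open>R\<close> into the half-open cube, where decoding is exact.\<close>
  define z where "z = (1/2) *\<^sub>R (\<Sum>b\<in>Basis. b :: 'a)"
  have z: "z \<bullet> b = 1/2" if "b \<in> Basis" for b using that by (simp add: z_def inner_sum_left_Basis inner_sum_left inner_Basis)
  show thesis
  proof (rule that[of "\<lambda>t. (2 * R) *\<^sub>R (h t - z)" "\<lambda>x. s ((1 / (2 * R)) *\<^sub>R x + z)"])
    show "continuous_on UNIV (\<lambda>t. (2 * R) *\<^sub>R (h t - z))" by (intro continuous_intros h)
    fix x :: 'a assume x: "norm x < R"
    have "h (s ((1 / (2 * R)) *\<^sub>R x + z)) = (1 / (2 * R)) *\<^sub>R x + z"
    proof (rule hs)
      fix b :: 'a assume b: "b \<in> Basis"
      have "\<bar>x \<bullet> b\<bar> < R" using Basis_le_norm[OF b, of x] x by linarith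
      then show "0 \<le> ((1 / (2 * R)) *\<^sub>R x + z) \<bullet> b \<and> ((1 / (2 * R)) *\<^sub>R x + z) \<bullet> b < 1"
        using R z[OF b] by (simp add: inner_add_left field_simps abs_less_iff)
    qed
    then show "(2 * R) *\<^sub>R (h (s ((1 / (2 * R)) *\<^sub>R x + z)) - z) = x" using R by simp
  qed (use s in auto)
qed

text \<open>The masses are completed to 1 by densities on a ball away from the supports, which is sent
  to the isolated point 3, so that Helly's theorem for probability measures on the line applies.\<close>

lemma weakly_convergent_subsequence:
  fixes g :: "nat \<Rightarrow> 'a::euclidean_space \<Rightarrow> real"
  assumes R: "0 < R" and [measurable]: "\<And>j. g j \<in> borel_measurable borel"
    and g0: "\<And>j x. 0 \<le> g j x" and supp: "\<And>j x. R \<le> norm x \<Longrightarrow> g j x = 0"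
    and int: "\<And>j. integrable lborel (g j)" and M: "\<And>j. (\<integral>x. g j x \<partial>lborel) \<le> M"
  obtains r :: "nat \<Rightarrow> nat" and \<sigma> :: "'a measure"
  where "strict_mono r" "finite_measure \<sigma>" "sets \<sigma> = sets borel"
    "\<And>\<phi> B. continuous_on UNIV \<phi> \<Longrightarrow> (\<And>x. \<bar>\<phi> x :: real\<bar> \<le> B) \<Longrightarrow>
      (\<lambda>j. \<integral>x. \<phi> x * g (r j) x \<partial>lborel) \<longlonglongrightarrow> (\<integral>x. \<phi> x \<partial>\<sigma>)"
proof -
  obtain h :: "real \<Rightarrow> 'a" and s where h: "continuous_on UNIV h" and sm [measurable]: "s \<in> borel_measurable borel"
    and s: "\<And>x. 0 \<le> s x" "\<And>x. s x \<le> 1" and hs: "\<And>x. norm x < R \<Longrightarrow> h (s x) = x"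
    using ball_section[OF R] by metis
  have hm [measurable]: "h \<in> borel_measurable borel" using h by (rule borel_measurable_continuous_onI)
  \<comment> \<open>A strictly positive bound for all masses: division by \<open>K\<close> leaves
    each of them at most 1, so the missing mass is nonnegative.\<close>
  define K where "K = \<bar>M\<bar> + 1"
  have K: "0 < K" by (simp add: K_def)
  define m where "m j = (\<integral>x. g j x \<partial>lborel)" for j
  have m: "0 \<le> m j" "m j \<le> K" for j
    using M[of j] g0 by (auto simp: m_def K_def intro: integral_nonneg)
  \<comment> \<open>The unit ball about a point of norm \<open>R + 2\<close> stays clear of the ball
    of radius \<open>R\<close> that carries the densities.\<close>
  obtain c :: 'a where c: "norm c = R + 2" using vector_choose_size[of "R + 2"] R by auto
  define W where "W = ball c 1"
  have [measurable]: "W \<in> sets borel" by (simp add: W_def)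
  define w where "w = measure lborel W"
  have w: "0 < w" by (simp add: w_def W_def)
  have intW: "integrable lborel (indicator W :: 'a \<Rightarrow> real)"
    by (rule integrable_real_indicator) (simp_all add: W_def emeasure_ball)
  have WR: "R \<le> norm x" if "x \<in> W" for x
  proof -
    have "norm (c - x) < 1" using that by (simp add: W_def dist_norm)
    then show ?thesis using c norm_triangle_ineq2[of c x] by linarith
  qed
  define G where "G j x = g j x / K + (1 - m j / K) / w * indicator W x" for j x
  define S where "S x = (if x \<in> W then 3 else s x)" for x
  have [measurable]: "G j \<in> borel_measurable borel" for j unfolding G_def by measurable
  have [measurable]: "S \<in> borel_measurable borel" unfolding S_def by measurable
  have G0: "0 \<le> G j x" for j x
    using g0[of j x] m[of j] w K by (auto simp: G_def divide_le_eq intro!: add_nonneg_nonneg mult_nonneg_nonneg divide_nonneg_nonneg)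
  have Gint: "integrable lborel (G j)" for j
    unfolding G_def by (intro Bochner_Integration.integrable_add integrable_mult_right intW integrable_divide int)
  have G1: "(\<integral>x. G j x \<partial>lborel) = 1" for j
  proof -
    have "(\<integral>x. G j x \<partial>lborel) = m j / K + (1 - m j / K) / w * w"
      unfolding G_def
      by (subst Bochner_Integration.integral_add) (auto simp: int intW m_def w_def intro!: integrable_mult_right)
    then show ?thesis using w by simp
  qed
  define \<pi> where "\<pi> j = distr (density lborel (\<lambda>x. ennreal (G j x))) borel S" for j
  have rd: "real_distribution (\<pi> j)" for j
  proof -
    have "prob_space (density lborel (\<lambda>x. ennreal (G j x)))"
    proof (rule prob_spaceI)
      show "emeasure (density lborel (\<lambda>x. ennreal (G j x))) (space (density lborel (\<lambda>x. ennreal (G j x)))) = 1"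
        using nn_integral_eq_integral[OF Gint[of j]] G0 G1 by (simp add: emeasure_density)
    qed
    then show ?thesis unfolding \<pi>_def
      by (intro prob_space.real_distribution_distr) auto
  qed
  \<comment> \<open>All codes lie in [0, 1] or equal 3, so one bounded interval carries the full
    mass of every measure.\<close>
  have tight: "tight \<pi>"
    unfolding tight_def
  proof (intro conjI allI impI)
    show "real_distribution (\<pi> n)" for n by (rule rd)
    fix e :: real assume e: "0 < e"
    have "measure (\<pi> n) {-1<..4} = 1" for n
    proof -
      interpret real_distribution "\<pi> n" by (rule rd)
      have "S -` {-1<..4} = UNIV"
        using s by (auto simp: S_def) (smt (verit))+
      then have "measure (\<pi> n) {-1<..4} = measure (\<pi> n) UNIV"
        unfolding \<pi>_def by (subst (1 2) measure_distr) auto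
      then show ?thesis using prob_space by simp
    qed
    then show "\<exists>a b. a < b \<and> (\<forall>n. 1 - e < measure (\<pi> n) {a<..b})"
      using e by (intro exI[of _ "-1"] exI[of _ 4]) auto
  qed
  obtain r \<pi>' where r: "strict_mono r" and rd': "real_distribution \<pi>'" and wc: "weak_conv_m (\<pi> \<circ> (\<lambda>x. x) \<circ> r) \<pi>'"
    using tight_imp_convergent_subsubsequence[OF tight, of "\<lambda>x. x"] by (auto simp: strict_mono_def)
  interpret \<pi>': real_distribution \<pi>' by (rule rd')
  \<comment> \<open>This factor is 1 up to 1 and 0 from 2 on. It discards the auxiliary mass at 3
    while keeping the test function continuous, so it survives the weak limit; the factor
    \<open>K\<close> later undoes the normalisation.\<close>
  define v where "v t = clamp01 (2 - t)" for t
  have vc: "continuous_on UNIV v" unfolding v_def[abs_def] clamp01_def by (intro continuous_intros)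
  have [measurable]: "v \<in> borel_measurable borel" using vc by (rule borel_measurable_continuous_onI)
  have v01: "0 \<le> v t" "v t \<le> 1" for t by (auto simp: v_def clamp01_def)
  define \<sigma> where "\<sigma> = distr (density \<pi>' (\<lambda>t. ennreal (K * v t))) borel h"
  show thesis
  proof (rule that[of r \<sigma>])
    show "finite_measure \<sigma>"
    proof (rule finite_measureI)
      have "emeasure \<sigma> (space \<sigma>) = (\<integral>\<^sup>+t. ennreal (K * v t) \<partial>\<pi>')"
        by (simp add: \<sigma>_def emeasure_distr emeasure_density)
      also have "\<dots> \<le> (\<integral>\<^sup>+t. ennreal K \<partial>\<pi>')"
        using v01 K by (intro nn_integral_mono ennreal_leI) (auto intro: mult_left_le)
      also have "\<dots> < \<infinity>" by (simp add: \<pi>'.emeasure_eq_measure ennreal_mult_less_top)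
      finally show "emeasure \<sigma> (space \<sigma>) \<noteq> \<infinity>" by auto
    qed
    fix \<phi> :: "'a \<Rightarrow> real" and B
    assume \<phi>: "continuous_on UNIV \<phi>" and B: "\<And>x. \<bar>\<phi> x\<bar> \<le> B"
    have [measurable]: "\<phi> \<in> borel_measurable borel" using \<phi> by (rule borel_measurable_continuous_onI)
    have c': "continuous_on UNIV (\<lambda>t. \<phi> (h t) * v t)"
      by (intro continuous_intros continuous_on_compose2[OF \<phi> h] vc) auto
    have "(\<lambda>j. integral\<^sup>L ((\<pi> \<circ> (\<lambda>x. x) \<circ> r) j) (\<lambda>t. \<phi> (h t) * v t)) \<longlonglongrightarrow> integral\<^sup>L \<pi>' (\<lambda>t. \<phi> (h t) * v t)"
    proof (rule weak_conv_imp_integral_bdd_continuous_conv[OF _ rd' wc])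
      show "isCont (\<lambda>t. \<phi> (h t) * v t) x" for x using c' by (simp add: continuous_on_eq_continuous_at)
      show "norm (\<phi> (h t) * v t) \<le> B * 1" for t
        unfolding norm_mult using B[of "h t"] v01[of t] by (intro mult_mono) auto
    qed (use rd in auto)
    then have lim: "(\<lambda>j. K * integral\<^sup>L (\<pi> (r j)) (\<lambda>t. \<phi> (h t) * v t)) \<longlonglongrightarrow> K * integral\<^sup>L \<pi>' (\<lambda>t. \<phi> (h t) * v t)"
      by (intro tendsto_mult tendsto_const) simp
    have "K * integral\<^sup>L (\<pi> j) (\<lambda>t. \<phi> (h t) * v t) = (\<integral>x. \<phi> x * g j x \<partial>lborel)" for j
    proof -
      have "integral\<^sup>L (\<pi> j) (\<lambda>t. \<phi> (h t) * v t) = (\<integral>x. G j x *\<^sub>R (\<phi> (h (S x)) * v (S x)) \<partial>lborel)"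
        unfolding \<pi>_def using G0 by (subst integral_distr, simp, simp, subst integral_density) auto
      also have "\<dots> = (\<integral>x. \<phi> x * g j x / K \<partial>lborel)"
      proof (intro Bochner_Integration.integral_cong refl)
        fix x
        show "G j x *\<^sub>R (\<phi> (h (S x)) * v (S x)) = \<phi> x * g j x / K"
        proof (cases "x \<in> W")
          case True
          then show ?thesis using supp[OF WR[OF True]] by (simp add: S_def v_def clamp01_def)
        next
          case False
          have "v (s x) = 1" using s(2)[of x] by (simp add: v_def clamp01_def)
          then show ?thesis using False supp[of x j] hs[of x]
            by (cases "norm x < R") (auto simp: S_def G_def)
        qed
      qed
      finally show ?thesis using K by simp
    qed
    moreover have "K * integral\<^sup>L \<pi>' (\<lambda>t. \<phi> (h t) * v t) = (\<integral>x. \<phi> x \<partial>\<sigma>)"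
    proof -
      have "(\<integral>x. \<phi> x \<partial>\<sigma>) = (\<integral>t. (K * v t) *\<^sub>R \<phi> (h t) \<partial>\<pi>')"
        unfolding \<sigma>_def using v01 K by (subst integral_distr, simp, simp, subst integral_density) auto
      also have "\<dots> = (\<integral>t. K * (\<phi> (h t) * v t) \<partial>\<pi>')"
        by (intro Bochner_Integration.integral_cong) (auto simp: ac_simps)
      finally show ?thesis by simp
    qed
    ultimately show "(\<lambda>j. \<integral>x. \<phi> x * g (r j) x \<partial>lborel) \<longlonglongrightarrow> (\<integral>x. \<phi> x \<partial>\<sigma>)"
      using lim by simp
  qed (use r in \<open>auto simp: \<sigma>_def\<close>)
qed

section \<open>Jordan decomposition\<close>

lemma sets_pos_part_measure [simp, measurable_cong]: "sets (pos_part_measure S \<mu>) = sets borel"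
  using sets.sigma_sets_eq[of borel] by (simp add: pos_part_measure_def)

lemma space_pos_part_measure [simp]: "space (pos_part_measure S \<mu>) = UNIV"
  by (simp add: pos_part_measure_def space_measure_of_conv)

text \<open>If the upper variation fails to be a measure, \<open>measure_of\<close> assigns 0 to
  every set, so the bound holds in either case.\<close>

lemma emeasure_pos_part_measure_le:
  assumes "\<And>B. B \<in> sets borel \<Longrightarrow> B \<subseteq> A \<inter> S \<Longrightarrow> \<mu> B \<le> c"
  shows "emeasure (pos_part_measure S \<mu>) A \<le> ennreal c"
  unfolding pos_part_measure_def emeasure_measure_of_conv
  using assms by (auto intro!: SUP_least ennreal_leI)

section \<open>Additivity and boundedness of signed measures\<close>

lemma signed_radon_measure_uminus:
  "signed_radon_measure S \<mu> \<Longrightarrow> signed_radon_measure S (\<lambda>A. - \<mu> A)"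
  unfolding signed_radon_measure_def using sums_minus by blast

lemma signed_radon_measure_empty:
  assumes \<mu>: "signed_radon_measure S \<mu>"
  shows "\<mu> {} = 0"
proof -
  have "(\<lambda>i::nat. \<mu> {}) sums \<mu> (\<Union>i::nat. {})"
    using \<mu>[unfolded signed_radon_measure_def, rule_format, of "\<lambda>_. {}"] by (auto simp: disjoint_family_on_def)
  then show ?thesis by (simp add: sums_iff summable_const_iff)
qed

lemma signed_radon_measure_Un:
  assumes \<mu>: "signed_radon_measure S \<mu>" and A: "A \<in> sets borel" "A \<subseteq> S" and B: "B \<in> sets borel" "B \<subseteq> S"
    and dj: "A \<inter> B = {}"
  shows "\<mu> (A \<union> B) = \<mu> A + \<mu> B"
proof -
  have "disjoint_family (binaryset A B)"
    using dj by (auto simp: binaryset_def disjoint_family_on_def)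
  moreover have "\<forall>i. binaryset A B i \<in> sets borel \<and> binaryset A B i \<subseteq> S"
    using A B by (auto simp: binaryset_def)
  ultimately have "(\<lambda>i. \<mu> (binaryset A B i)) sums \<mu> (\<Union>i. binaryset A B i)"
    using \<mu> unfolding signed_radon_measure_def by blast
  moreover have "(\<lambda>i. \<mu> (binaryset A B i)) sums (\<mu> A + \<mu> B)"
    using signed_radon_measure_empty[OF \<mu>] by (rule binaryset_sums)
  ultimately show ?thesis by (simp add: UN_binaryset_eq sums_iff)
qed

text \<open>If the values on subsets of \<open>S\<close> were unbounded, one could split off disjoint sets of measure
  at least 1 in absolute value indefinitely, always keeping a remainder with unbounded values.\<close>

lemma signed_radon_measure_bounded:
  assumes \<mu>: "signed_radon_measure S \<mu>" and S: "S \<in> sets borel"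
  obtains C where "\<And>B. B \<in> sets borel \<Longrightarrow> B \<subseteq> S \<Longrightarrow> \<bar>\<mu> B\<bar> \<le> C"
proof (rule ccontr)
  define bad where "bad A \<longleftrightarrow> A \<in> sets borel \<and> A \<subseteq> S \<and> (\<forall>C. \<exists>B. B \<in> sets borel \<and> B \<subseteq> A \<and> C < \<bar>\<mu> B\<bar>)" for A
  assume "\<not> thesis"
  then have badS: "bad S" using that S by (auto simp: bad_def) (meson not_le)
  have add: "\<mu> B = \<mu> (B \<inter> A) + \<mu> (B - A)" if "A \<in> sets borel" "B \<in> sets borel" "B \<subseteq> S" for A B
    using signed_radon_measure_Un[OF \<mu>, of "B \<inter> A" "B - A"] that
    by (simp add: Int_Diff_Un) (metis Diff_subset Int_Diff_disjoint Int_Diff_Un Int_commute inf.coboundedI1 order_trans sets.Diff sets.Int)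
  have step: "\<exists>A'. bad A' \<and> A' \<subseteq> A \<and> 1 \<le> \<bar>\<mu> (A - A')\<bar>" if A: "bad A" for A
  proof -
    have Ab: "A \<in> sets borel" "A \<subseteq> S" using A by (auto simp: bad_def)
    obtain B where B: "B \<in> sets borel" "B \<subseteq> A" "\<bar>\<mu> A\<bar> + 1 < \<bar>\<mu> B\<bar>"
      using A unfolding bad_def by blast
    have sum: "\<mu> A = \<mu> B + \<mu> (A - B)" using add[OF B(1) Ab] B(2) by (simp add: Int_absorb1)
    show ?thesis
    proof (cases "bad B")
      case True
      then show ?thesis using B sum by (intro exI[of _ B]) auto
    next
      case False
      then obtain C where C: "\<And>D. D \<in> sets borel \<Longrightarrow> D \<subseteq> B \<Longrightarrow> \<bar>\<mu> D\<bar> \<le> C"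
        using B Ab unfolding bad_def by (meson not_le order_trans)
      have "bad (A - B)"
        unfolding bad_def
      proof (intro conjI allI)
        fix C'
        obtain D where D: "D \<in> sets borel" "D \<subseteq> A" "C + C' < \<bar>\<mu> D\<bar>" using A unfolding bad_def by blast
        have "\<mu> D = \<mu> (D \<inter> B) + \<mu> (D - B)" using add[OF B(1) D(1)] D(2) Ab by auto
        moreover have "\<bar>\<mu> (D \<inter> B)\<bar> \<le> C" using D B by (intro C) auto
        ultimately have "C' < \<bar>\<mu> (D - B)\<bar>" using D(3) by linarith
        then show "\<exists>E. E \<in> sets borel \<and> E \<subseteq> A - B \<and> C' < \<bar>\<mu> E\<bar>" using D B by (intro exI[of _ "D - B"]) auto
      qed (use Ab B in auto)
      moreover have "A - (A - B) = B" using B(2) by auto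
      ultimately show ?thesis using B by (intro exI[of _ "A - B"]) auto
    qed
  qed
  then obtain f where f: "\<And>A. bad A \<Longrightarrow> bad (f A) \<and> f A \<subseteq> A \<and> 1 \<le> \<bar>\<mu> (A - f A)\<bar>" by metis
  define A where "A n = (f ^^ n) S" for n
  have badA: "bad (A n)" for n unfolding A_def using badS f by (induction n) auto
  have dec: "A m \<subseteq> A n" if "n \<le> m" for n m
    using that
  proof (induction rule: dec_induct)
    case (step k)
    then show ?case using f[OF badA[of k]] by (auto simp: A_def)
  qed simp
  have dj: "disjoint_family (\<lambda>n. A n - A (Suc n))"
    unfolding disjoint_family_on_def
  proof (intro ballI impI)
    fix m n :: nat assume "m \<noteq> n"
    then have "Suc m \<le> n \<or> Suc n \<le> m" by auto
    then show "(A m - A (Suc m)) \<inter> (A n - A (Suc n)) = {}" using dec by blast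
  qed
  have "(\<lambda>n. \<mu> (A n - A (Suc n))) sums \<mu> (\<Union>n. A n - A (Suc n))"
    using \<mu>[unfolded signed_radon_measure_def, rule_format, OF _ dj] badA by (auto simp: bad_def)
  then have "(\<lambda>n. \<mu> (A n - A (Suc n))) \<longlonglongrightarrow> 0" by (intro summable_LIMSEQ_zero) (rule sums_summable)
  then have "eventually (\<lambda>n. \<bar>\<mu> (A n - A (Suc n))\<bar> < 1) sequentially"
    by (auto simp: tendsto_iff dist_real_def)
  then obtain n where "\<bar>\<mu> (A n - A (Suc n))\<bar> < 1" by (auto simp: eventually_sequentially)
  moreover have "1 \<le> \<bar>\<mu> (A n - A (Suc n))\<bar>" using f[OF badA[of n]] by (simp add: A_def)
  ultimately show False by simp
qed

lemma finite_pos_part_measure: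
  assumes \<mu>: "signed_radon_measure S \<mu>" and S: "S \<in> sets borel"
  shows "finite_measure (pos_part_measure S \<mu>)"
proof (rule finite_measureI)
  obtain C where C: "\<And>B. B \<in> sets borel \<Longrightarrow> B \<subseteq> S \<Longrightarrow> \<bar>\<mu> B\<bar> \<le> C"
    using signed_radon_measure_bounded[OF \<mu> S] by blast
  have "emeasure (pos_part_measure S \<mu>) UNIV \<le> ennreal C"
    using C by (intro emeasure_pos_part_measure_le) force
  then show "emeasure (pos_part_measure S \<mu>) (space (pos_part_measure S \<mu>)) \<noteq> \<infinity>"
    by (auto simp: top_unique)
qed

section \<open>Null sets off the support\<close>

lemma signed_support_uminus: "signed_support S (\<lambda>A. - \<mu> A) = signed_support S \<mu>"
  by (simp add: signed_support_def)

text \<open>The support is defined by neighbourhoods of single points, so its complement in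
  \<open>S\<close> is covered by possibly uncountably many open sets whose Borel subsets in
  \<open>S\<close> all have measure 0. Lindelof's theorem leaves countably many of them, and making
  these disjoint brings countable additivity to bear.\<close>

lemma signed_radon_measure_off_support:
  assumes \<mu>: "signed_radon_measure S \<mu>" and B: "B \<in> sets borel" "B \<subseteq> S" "B \<inter> signed_support S \<mu> = {}"
  shows "\<mu> B = 0"
proof -
  define F where "F = {V. open V \<and> (\<forall>B\<in>sets borel. B \<subseteq> V \<inter> S \<longrightarrow> \<mu> B = 0)}"
  obtain F' where F': "F' \<subseteq> F" "countable F'" "\<Union>F' = \<Union>F"
    using Lindelof[of F] by (auto simp: F_def)
  have "B \<subseteq> \<Union>F"
  proof
    fix x assume x: "x \<in> B"
    then have "x \<in> S" "x \<notin> signed_support S \<mu>" using B by auto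
    then obtain V where "open V" "x \<in> V" "\<forall>B\<in>sets borel. B \<subseteq> V \<inter> S \<longrightarrow> \<mu> B = 0"
      by (auto simp: signed_support_def)
    then show "x \<in> \<Union>F" by (auto simp: F_def)
  qed
  show ?thesis
  proof (cases "F' = {}")
    case True
    then have "B = {}" using \<open>B \<subseteq> \<Union>F\<close> F'(3) by auto
    then show ?thesis using signed_radon_measure_empty[OF \<mu>] by simp
  next
    case False
    define V where "V = from_nat_into F'"
    have V: "range V = F'" unfolding V_def using False F' by (simp add: range_from_nat_into)
    have Vo: "open (V i)" for i using V F' by (auto simp: F_def)
    define D where "D i = B \<inter> disjointed V i" for i
    have Db: "D i \<in> sets borel" for i
    proof -
      have "disjointed V i \<in> sets borel"
        using Vo by (auto simp: disjointed_def intro!: sets.Diff sets.finite_UN)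
      then show ?thesis using B by (auto simp: D_def)
    qed
    have "disjoint_family D"
      using disjoint_family_disjointed[of V] by (auto simp: D_def disjoint_family_on_def)
    moreover have "D i \<subseteq> S" for i using B by (auto simp: D_def)
    ultimately have "(\<lambda>i. \<mu> (D i)) sums \<mu> (\<Union>i. D i)"
      using \<mu> Db unfolding signed_radon_measure_def by blast
    moreover have "\<mu> (D i) = 0" for i
    proof -
      have "V i \<in> F" using V F' by auto
      moreover have "D i \<subseteq> V i \<inter> S" using B disjointed_subset[of V i] by (auto simp: D_def)
      ultimately show ?thesis using Db by (auto simp: F_def)
    qed
    moreover have "(\<Union>i. D i) = B"
    proof -
      have "(\<Union>i. disjointed V i) = \<Union>F" using UN_disjointed_eq[of V] V F' by simp
      then show ?thesis using \<open>B \<subseteq> \<Union>F\<close> by (auto simp: D_def)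
    qed
    ultimately show ?thesis by (simp add: sums_iff)
  qed
qed

lemma AE_pos_part_measure_support:
  assumes \<mu>: "signed_radon_measure S \<mu>" and c: "closed (signed_support S \<mu>)"
  shows "AE x in pos_part_measure S \<mu>. x \<in> signed_support S \<mu>"
proof -
  have "emeasure (pos_part_measure S \<mu>) (- signed_support S \<mu>) \<le> ennreal 0"
  proof (rule emeasure_pos_part_measure_le)
    fix B assume "B \<in> sets borel" "B \<subseteq> - signed_support S \<mu> \<inter> S"
    moreover from this have "B \<inter> signed_support S \<mu> = {}" by auto
    ultimately show "\<mu> B \<le> 0" using signed_radon_measure_off_support[OF \<mu>, of B] by auto
  qed
  moreover have "- signed_support S \<mu> \<in> sets borel" using c by auto
  ultimately have "AE x in pos_part_measure S \<mu>. x \<notin> - signed_support S \<mu>"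
    by (intro AE_not_in) (auto simp: null_sets_def)
  then show ?thesis by simp
qed

section \<open>Integrals against differences of finite measures\<close>

lemma integrable_finite_borel_bounded:
  assumes "finite_measure P" and sP: "sets P = sets borel" and [measurable]: "f \<in> borel_measurable borel"
    and B: "\<And>x. \<bar>f x :: real\<bar> \<le> B"
  shows "integrable P f"
proof -
  interpret finite_measure P by fact
  show ?thesis
  proof (rule integrable_const_bound[of _ B])
    show "f \<in> borel_measurable P" using assms(3) measurable_cong_sets[OF sP refl] by blast
  qed (use B in auto)
qed

text \<open>Induction over nonnegative measurable functions extends the identity from sets to
  integrals. A bounded real function becomes nonnegative after adding the constant \<open>B\<close>,
  for which the identity is known as well and can be subtracted.\<close>

lemma integral_of_emeasure_add:
  fixes P Q R :: "'a::euclidean_space measure" and f :: "'a \<Rightarrow> real"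
  assumes fin: "finite_measure P" "finite_measure Q" "finite_measure R"
    and sets: "sets P = sets borel" "sets Q = sets borel" "sets R = sets borel"
    and add: "\<And>A. A \<in> sets borel \<Longrightarrow> emeasure P A + emeasure Q A = emeasure R A"
    and [measurable]: "f \<in> borel_measurable borel" and B: "\<And>x. \<bar>f x\<bar> \<le> B"
  shows "integral\<^sup>L P f + integral\<^sup>L Q f = integral\<^sup>L R f"
proof -
  have nn: "integral\<^sup>N P u + integral\<^sup>N Q u = integral\<^sup>N R u" if "u \<in> borel_measurable borel" for u :: "'a \<Rightarrow> ennreal"
    using that
  proof (induction rule: borel_measurable_induct)
    case (cong f g)
    then show ?case by (simp add: fun_eq_iff[symmetric] ext[of f g])
  next
    case (set A)
    then show ?case using add sets by simp
  next
    case (mult u c)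
    have "u \<in> borel_measurable P" "u \<in> borel_measurable Q" "u \<in> borel_measurable R"
      using mult(2) sets measurable_cong_sets by blast+
    then show ?case using mult by (simp add: nn_integral_cmult distrib_left[symmetric])
  next
    case (add u v)
    have "u \<in> borel_measurable P" "u \<in> borel_measurable Q" "u \<in> borel_measurable R"
      "v \<in> borel_measurable P" "v \<in> borel_measurable Q" "v \<in> borel_measurable R"
      using add(1,3) sets measurable_cong_sets by blast+
    then show ?case using add by (simp add: nn_integral_add) (metis (no_types, lifting) add.assoc add.commute)
  next
    case (seq U)
    have m: "U i \<in> borel_measurable P" "U i \<in> borel_measurable Q" "U i \<in> borel_measurable R" for i
      using seq(1) sets measurable_cong_sets by blast+
    have inc: "incseq (\<lambda>i. integral\<^sup>N L (U i))" for L
      using seq by (intro incseq_SucI nn_integral_mono) (auto simp: incseq_def le_fun_def)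
    have "integral\<^sup>N L (\<lambda>x. SUP i. U i x) = (SUP i. integral\<^sup>N L (U i))" if "\<And>i. U i \<in> borel_measurable L" for L
      using seq that by (intro nn_integral_monotone_convergence_SUP) auto
    then show ?case unfolding image_comp o_def SUP_apply
      using m seq inc by (simp add: ennreal_SUP_add[symmetric] image_comp o_def SUP_apply[abs_def])
  qed
  have int: "integrable L u" if "L \<in> {P, Q, R}" "u \<in> borel_measurable borel" "\<And>x. \<bar>u x\<bar> \<le> b"
    for L and u :: "'a \<Rightarrow> real" and b
    using that fin sets by (intro integrable_finite_borel_bounded[of L u b]) auto
  have pos: "integral\<^sup>L P u + integral\<^sup>L Q u = integral\<^sup>L R u"
    if u: "u \<in> borel_measurable borel" "\<And>x. 0 \<le> u x" "\<And>x. u x \<le> b" for u :: "'a \<Rightarrow> real" and b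
  proof -
    have i: "integrable L u" if "L \<in> {P, Q, R}" for L using that u by (intro int[of L u b]) auto
    have n: "ennreal (integral\<^sup>L L u) = (\<integral>\<^sup>+x. ennreal (u x) \<partial>L)" if "L \<in> {P, Q, R}" for L
      using nn_integral_eq_integral[OF i[OF that]] u by simp
    have "ennreal (integral\<^sup>L P u + integral\<^sup>L Q u) = ennreal (integral\<^sup>L R u)"
      using nn[of "\<lambda>x. ennreal (u x)"] u by (simp add: n)
    then show ?thesis using u by (subst (asm) ennreal_inj) (auto intro!: add_nonneg_nonneg integral_nonneg)
  qed
  have B0: "0 \<le> B" using B[of 0] by linarith
  have 1: "integral\<^sup>L P (\<lambda>x. f x + B) + integral\<^sup>L Q (\<lambda>x. f x + B) = integral\<^sup>L R (\<lambda>x. f x + B)"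
  proof (rule pos[of _ "2 * B"])
    fix x show "0 \<le> f x + B" "f x + B \<le> 2 * B" using B[of x] by linarith+
  qed measurable
  have 2: "integral\<^sup>L P (\<lambda>x. B) + integral\<^sup>L Q (\<lambda>x. B) = integral\<^sup>L R (\<lambda>x. B)"
    using B0 by (intro pos[of _ B]) auto
  have 3: "integral\<^sup>L L (\<lambda>x. f x + B) = integral\<^sup>L L f + integral\<^sup>L L (\<lambda>x. B)" if "L \<in> {P, Q, R}" for L
    using that B B0 by (intro Bochner_Integration.integral_add int) auto
  show ?thesis using 1 2 by (simp add: 3)
qed

text \<open>\<open>Z\<close> is a Hahn set for \<sigma>1 - \<sigma>2 inside \<open>S\<close>. The
  upper variation of \<open>A\<close> is attained at \<open>A \<inter> Z\<close>, since discarding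
  the part outside \<open>Z\<close> can only raise the value. The positive part is therefore the
  difference of the two measures restricted to \<open>Z\<close>, where it is nonnegative.\<close>

lemma integral_pos_part_measure:
  fixes \<sigma>1 \<sigma>2 :: "'a::euclidean_space measure" and f :: "'a \<Rightarrow> real"
  assumes fin: "finite_measure \<sigma>1" "finite_measure \<sigma>2"
    and sets: "sets \<sigma>1 = sets borel" "sets \<sigma>2 = sets borel"
    and S: "S \<in> sets borel" and Z: "Z \<in> sets borel" "Z \<subseteq> S"
    and le1: "\<And>X. X \<in> sets borel \<Longrightarrow> X \<subseteq> Z \<Longrightarrow> emeasure \<sigma>2 X \<le> emeasure \<sigma>1 X"
    and le2: "\<And>X. X \<in> sets borel \<Longrightarrow> X \<subseteq> S - Z \<Longrightarrow> emeasure \<sigma>1 X \<le> emeasure \<sigma>2 X"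
    and \<nu>: "\<And>B. B \<in> sets borel \<Longrightarrow> \<nu> B = measure \<sigma>1 B - measure \<sigma>2 B"
    and [measurable]: "f \<in> borel_measurable borel" and B: "\<And>x. \<bar>f x\<bar> \<le> B"
  shows "integral\<^sup>L (pos_part_measure S \<nu>) f = (\<integral>x. indicator Z x * f x \<partial>\<sigma>1) - (\<integral>x. indicator Z x * f x \<partial>\<sigma>2)"
proof -
  interpret s1: finite_measure \<sigma>1 by fact
  interpret s2: finite_measure \<sigma>2 by fact
  note [simp, measurable_cong] = sets
  have [measurable]: "Z \<in> sets borel" by fact
  define D1 where "D1 = density \<sigma>1 (indicator Z)"
  define D2 where "D2 = density \<sigma>2 (indicator Z)"
  have sD [simp]: "sets D1 = sets borel" "sets D2 = sets borel" by (auto simp: D1_def D2_def)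
  have eD: "emeasure D1 A = emeasure \<sigma>1 (A \<inter> Z)" "emeasure D2 A = emeasure \<sigma>2 (A \<inter> Z)" if "A \<in> sets borel" for A
    using that by (auto simp: D1_def D2_def emeasure_density indicator_inter_arith[symmetric] Int_commute)
  have fD: "finite_measure D1" "finite_measure D2"
    using sets_eq_imp_space_eq[OF sD(1)] sets_eq_imp_space_eq[OF sD(2)]
    by (intro finite_measureI; simp add: eD)+
  define D where "D = diff_measure D1 D2"
  have eDD: "emeasure D A = emeasure \<sigma>1 (A \<inter> Z) - emeasure \<sigma>2 (A \<inter> Z)" if A: "A \<in> sets borel" for A
    unfolding D_def using A fD le1 by (subst emeasure_diff_measure) (auto simp: eD)
  have sDD [simp]: "sets D = sets borel" by (simp add: D_def)
  have eDD': "emeasure D A = ennreal (\<nu> (A \<inter> Z))" if A: "A \<in> sets borel" for A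
    using A by (simp add: eDD \<nu> s1.emeasure_eq_measure s2.emeasure_eq_measure ennreal_minus)
  have spD: "space D = UNIV" using sets_eq_imp_space_eq[OF sDD] by simp
  have eq: "pos_part_measure S \<nu> = D"
  proof -
    have sup: "(SUP B\<in>{B \<in> sets borel. B \<subseteq> A \<inter> S}. ennreal (\<nu> B)) = emeasure D A" if A: "A \<in> sets borel" for A
    proof (rule antisym)
      show "(SUP B\<in>{B \<in> sets borel. B \<subseteq> A \<inter> S}. ennreal (\<nu> B)) \<le> emeasure D A"
      proof (rule SUP_least)
        fix B assume "B \<in> {B \<in> sets borel. B \<subseteq> A \<inter> S}"
        then have B: "B \<in> sets borel" "B \<subseteq> A" "B \<subseteq> S" by auto
        have m: "measure \<sigma> B = measure \<sigma> (B \<inter> Z) + measure \<sigma> (B - Z)"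
          if "finite_measure \<sigma>" "sets \<sigma> = sets borel" for \<sigma>
          using that B finite_measure.finite_measure_Union[OF that(1), of "B \<inter> Z" "B - Z"]
          by (auto simp: Int_Diff_Un Int_Diff)
        have "measure \<sigma>1 (B - Z) \<le> measure \<sigma>2 (B - Z)"
          using le2[of "B - Z"] B by (simp add: s1.emeasure_eq_measure s2.emeasure_eq_measure subset_iff)
        then have "\<nu> B \<le> \<nu> (B \<inter> Z)" using B m[OF fin(1)] m[OF fin(2)] by (simp add: \<nu>)
        then have "ennreal (\<nu> B) \<le> emeasure D B" using B by (simp add: eDD' ennreal_leI)
        also have "\<dots> \<le> emeasure D A" using B A by (intro emeasure_mono) auto
        finally show "ennreal (\<nu> B) \<le> emeasure D A" .
      qed
      show "emeasure D A \<le> (SUP B\<in>{B \<in> sets borel. B \<subseteq> A \<inter> S}. ennreal (\<nu> B))"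
        unfolding eDD'[OF A] using A Z by (intro SUP_upper) auto
    qed
    have "pos_part_measure S \<nu> = measure_of UNIV (sets borel) (emeasure D)"
      unfolding pos_part_measure_def
    proof (rule measure_of_eq)
      fix A assume "A \<in> sigma_sets UNIV (sets (borel :: 'a measure))"
      then have "A \<in> sets borel" using sets.sigma_sets_eq[of "borel :: 'a measure"] by simp
      then show "(SUP B\<in>{B \<in> sets borel. B \<subseteq> A \<inter> S}. ennreal (\<nu> B)) = emeasure D A" by (rule sup)
    qed simp
    also have "\<dots> = D" using measure_of_of_measure[of D] by (simp add: spD)
    finally show ?thesis .
  qed
  have "finite_measure D"
  proof (rule finite_measureI)
    have "emeasure D (space D) = ennreal (\<nu> Z)" using eDD'[of UNIV] by (simp add: spD)
    then show "emeasure D (space D) \<noteq> \<infinity>" by simp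
  qed
  \<comment> \<open>The integral against the difference measure is computed by moving the subtrahend
    to the other side.\<close>
  have "integral\<^sup>L D f + integral\<^sup>L D2 f = integral\<^sup>L D1 f"
  proof (rule integral_of_emeasure_add[OF \<open>finite_measure D\<close> fD(2,1)])
    fix A :: "'a set" assume A: "A \<in> sets borel"
    then show "emeasure D A + emeasure D2 A = emeasure D1 A"
      using le1[of "A \<inter> Z"] by (simp add: eDD eD diff_add_cancel_ennreal)
  qed (use B in auto)
  moreover have "integral\<^sup>L (density \<sigma> (indicator Z)) f = (\<integral>x. indicator Z x * f x \<partial>\<sigma>)" if [measurable_cong]: "sets \<sigma> = sets borel" for \<sigma>
  proof -
    have "density \<sigma> (indicator Z) = density \<sigma> (\<lambda>x. ennreal (indicator Z x))" by (simp add: ennreal_indicator)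
    then show ?thesis by (simp add: integral_density)
  qed
  ultimately show ?thesis unfolding eq D1_def D2_def by (simp add: sets)
qed

text \<open>For the negative part the same computation applies with the two measures exchanged and
  \<open>S - Y\<close> in place of \<open>S \<inter> Y\<close>. The almost everywhere conditions
  ensure that no mass is lost outside \<open>S\<close>.\<close>

lemma
  fixes \<sigma>1 \<sigma>2 :: "'a::euclidean_space measure" and f :: "'a \<Rightarrow> real"
  assumes fin: "finite_measure \<sigma>1" "finite_measure \<sigma>2"
    and sets: "sets \<sigma>1 = sets borel" "sets \<sigma>2 = sets borel"
  shows signed_radon_measure_diff: "signed_radon_measure S (\<lambda>B. measure \<sigma>1 B - measure \<sigma>2 B)"
    and signed_integral_diff: "\<lbrakk>S \<in> sets borel; AE x in \<sigma>1. x \<in> S; AE x in \<sigma>2. x \<in> S;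
      f \<in> borel_measurable borel; \<And>x. \<bar>f x\<bar> \<le> B\<rbrakk> \<Longrightarrow>
      signed_integral S (\<lambda>B. measure \<sigma>1 B - measure \<sigma>2 B) f = integral\<^sup>L \<sigma>1 f - integral\<^sup>L \<sigma>2 f"
proof -
  interpret s1: finite_measure \<sigma>1 by fact
  interpret s2: finite_measure \<sigma>2 by fact
  note [simp, measurable_cong] = sets
  show "signed_radon_measure S (\<lambda>B. measure \<sigma>1 B - measure \<sigma>2 B)"
    unfolding signed_radon_measure_def
  proof (intro allI impI)
    fix A :: "nat \<Rightarrow> 'a set"
    assume A: "\<forall>i. A i \<in> sets borel \<and> A i \<subseteq> S" "disjoint_family A"
    show "(\<lambda>i. measure \<sigma>1 (A i) - measure \<sigma>2 (A i)) sums (measure \<sigma>1 (\<Union>i. A i) - measure \<sigma>2 (\<Union>i. A i))"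
      using A by (intro sums_diff s1.finite_measure_UNION s2.finite_measure_UNION) auto
  qed
  assume S: "S \<in> sets borel" and AE: "AE x in \<sigma>1. x \<in> S" "AE x in \<sigma>2. x \<in> S"
    and [measurable]: "f \<in> borel_measurable borel" and B: "\<And>x. \<bar>f x\<bar> \<le> B"
  obtain Y where Y: "Y \<in> sets borel" "\<And>X. X \<in> sets borel \<Longrightarrow> X \<subseteq> Y \<Longrightarrow> emeasure \<sigma>2 X \<le> emeasure \<sigma>1 X"
    "\<And>X. X \<in> sets borel \<Longrightarrow> X \<inter> Y = {} \<Longrightarrow> emeasure \<sigma>1 X \<le> emeasure \<sigma>2 X"
    using finite_unsigned_Hahn_decomposition[OF fin] by auto
  have [measurable]: "S \<in> sets borel" "Y \<in> sets borel" by fact+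
  have P: "integral\<^sup>L (pos_part_measure S (\<lambda>B. measure \<sigma>1 B - measure \<sigma>2 B)) f
     = (\<integral>x. indicator (S \<inter> Y) x * f x \<partial>\<sigma>1) - (\<integral>x. indicator (S \<inter> Y) x * f x \<partial>\<sigma>2)"
    by (rule integral_pos_part_measure[OF fin sets S _ _ _ _ _ _ B]) (use Y S in auto)
  have N: "integral\<^sup>L (pos_part_measure S (\<lambda>B. - (measure \<sigma>1 B - measure \<sigma>2 B))) f
     = (\<integral>x. indicator (S - Y) x * f x \<partial>\<sigma>2) - (\<integral>x. indicator (S - Y) x * f x \<partial>\<sigma>1)"
    by (rule integral_pos_part_measure[OF fin(2,1) sets(2,1) S _ _ _ _ _ _ B]) (use Y S in auto)
  have split: "integral\<^sup>L \<sigma> f = (\<integral>x. indicator (S \<inter> Y) x * f x \<partial>\<sigma>) + (\<integral>x. indicator (S - Y) x * f x \<partial>\<sigma>)"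
    if "finite_measure \<sigma>" "sets \<sigma> = sets borel" "AE x in \<sigma>. x \<in> S" for \<sigma>
  proof -
    note [simp, measurable_cong] = that(2)
    have "integral\<^sup>L \<sigma> f = (\<integral>x. indicator (S \<inter> Y) x * f x + indicator (S - Y) x * f x \<partial>\<sigma>)"
    proof (rule integral_cong_AE)
      show "AE x in \<sigma>. f x = indicator (S \<inter> Y) x * f x + indicator (S - Y) x * f x"
        using that(3) by eventually_elim (auto simp: indicator_def)
    qed measurable
    moreover have "integrable \<sigma> (\<lambda>x. indicator A x * f x)" if [measurable]: "A \<in> sets borel" for A
    proof (rule integrable_finite_borel_bounded[where B=B])
      show "\<bar>indicator A x * f x\<bar> \<le> B" for x
        using B[of x] abs_ge_zero[of "f x"] by (auto simp: indicator_def)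
    qed (use \<open>finite_measure \<sigma>\<close> in auto)
    ultimately show ?thesis by simp
  qed
  show "signed_integral S (\<lambda>B. measure \<sigma>1 B - measure \<sigma>2 B) f = integral\<^sup>L \<sigma>1 f - integral\<^sup>L \<sigma>2 f"
    unfolding signed_integral_def P N split[OF fin(1) sets(1) AE(1)] split[OF fin(2) sets(2) AE(2)] by simp
qed

section \<open>Cutoff functions and Minkowski content\<close>

lemma integrable_newton_field_inner:
  fixes P :: "'a::euclidean_space measure"
  assumes P: "finite_measure P" "sets P = sets borel"
    and [measurable]: "G \<in> borel_measurable borel" and C: "\<And>x. norm (G x) \<le> C"
    and supp: "\<And>x. R \<le> norm x \<Longrightarrow> G x = 0"
  shows "integrable lborel (\<lambda>x. newton_field P x \<bullet> G x)"
proof (rule Bochner_Integration.integrable_bound)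
  note [measurable] = borel_measurable_newton_field[OF P]
  show "integrable lborel (\<lambda>x. C * norm (indicator (cball 0 R) x *\<^sub>R newton_field P x))"
    by (intro integrable_mult_right integrable_norm integrable_newton_field[OF P])
  show "(\<lambda>x. newton_field P x \<bullet> G x) \<in> borel_measurable lborel" by measurable
  show "AE x in lborel. norm (newton_field P x \<bullet> G x) \<le> norm (C * norm (indicator (cball 0 R) x *\<^sub>R newton_field P x))"
  proof (rule AE_I2)
    fix x
    show "norm (newton_field P x \<bullet> G x) \<le> norm (C * norm (indicator (cball 0 R) x *\<^sub>R newton_field P x))"
    proof (cases "norm x \<le> R")
      case True
      have "norm (newton_field P x \<bullet> G x) \<le> norm (newton_field P x) * norm (G x)"
        by (simp add: Cauchy_Schwarz_ineq2)
      also have "\<dots> \<le> norm (newton_field P x) * C" by (intro mult_left_mono C) auto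
      also have "\<dots> \<le> norm (C * norm (indicator (cball 0 R) x *\<^sub>R newton_field P x))"
        using True by (simp add: abs_mult mult.commute) (metis abs_ge_self mult_right_mono mult.commute norm_ge_zero)
      finally show ?thesis .
    qed (use supp[of x] in auto)
  qed
qed

text \<open>At distance \<open>r\<close> from a set that carries \<open>P\<close> the singularity is
  not met; this yields the bound of the field near the frontier.\<close>

lemma norm_newton_field_le:
  fixes P :: "'a::euclidean_space measure"
  assumes P: "finite_measure P" and sP [measurable_cong, simp]: "sets P = sets borel"
    and S: "AE y in P. y \<in> S" and r: "0 < r" "\<And>y. y \<in> S \<Longrightarrow> r \<le> norm (x - y)"
  shows "norm (newton_field P x) \<le> measure P UNIV * inverse (r ^ (DIM('a) - 1))"
proof -
  interpret finite_measure P by fact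
  have sp: "space P = UNIV" using sets_eq_imp_space_eq[OF sP] by simp
  have ae: "AE y in P. norm (newton_kernel (x - y)) \<le> inverse (r ^ (DIM('a) - 1))"
    using S by eventually_elim (intro norm_newton_kernel_le r)
  have "norm (newton_field P x) \<le> (\<integral>y. norm (newton_kernel (x - y)) \<partial>P)"
    unfolding newton_field_def by (rule integral_norm_bound)
  also have "\<dots> \<le> (\<integral>y. inverse (r ^ (DIM('a) - 1)) \<partial>P)"
    using ae by (intro integral_mono_AE integrable_const_bound) auto
  finally show ?thesis by (simp add: sp)
qed

section \<open>Distance cutoffs\<close>

lemma set_plus_ball: "C + ball (0::'a::real_normed_vector) e = (\<Union>c\<in>C. ball c e)"
proof (intro set_eqI iffI)
  fix x assume "x \<in> C + ball 0 e"
  then show "x \<in> (\<Union>c\<in>C. ball c e)" by (auto simp: set_plus_def dist_norm intro!: bexI)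
next
  fix x assume "x \<in> (\<Union>c\<in>C. ball c e)"
  then obtain c where "c \<in> C" "norm (x - c) < e" by (auto simp: dist_norm norm_minus_commute)
  then show "x \<in> C + ball 0 e" using set_plus_intro[of c C "x - c" "ball 0 e"] by simp
qed

text \<open>The value 1 is reached at distance \<open>e / 2\<close> already. The spare half lets the
  ball of radius \<open>e / 2\<close> around any point off the \<open>e\<close>-neighbourhood of the
  frontier lie in a plateau, so the gradient vanishes there exactly.\<close>

definition cutoff :: "'a::euclidean_space set \<Rightarrow> real \<Rightarrow> 'a \<Rightarrow> real" where
  "cutoff C e x = min 1 (2 / e * infdist x C)"

lemma cutoff_bounds: "0 < e \<Longrightarrow> 0 \<le> cutoff C e x" "cutoff C e x \<le> 1"
  by (auto simp: cutoff_def infdist_nonneg)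

lemma lipschitz_cutoff:
  assumes e: "0 < e"
  shows "(2 / e)-lipschitz_on UNIV (cutoff C e)"
proof (rule lipschitz_onI)
  fix x y
  have "\<bar>infdist x C - infdist y C\<bar> \<le> dist x y" by (rule infdist_triangle_abs)
  then have "2 / e * \<bar>infdist x C - infdist y C\<bar> \<le> 2 / e * dist x y" using e by (intro mult_left_mono) auto
  moreover have "2 / e * \<bar>infdist x C - infdist y C\<bar> = \<bar>2 / e * infdist x C - 2 / e * infdist y C\<bar>"
    using e by (metis abs_mult abs_of_pos divide_pos_pos right_diff_distrib zero_less_numeral)
  ultimately show "dist (cutoff C e x) (cutoff C e y) \<le> 2 / e * dist x y"
    unfolding cutoff_def dist_real_def by linarith
qed (use e in auto)

text \<open>A ball is connected, so one that misses the frontier of \<open>C\<close> lies inside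
  \<open>C\<close> or in its complement. In the latter case all points of the concentric half ball
  have distance at least \<open>e / 2\<close> from \<open>C\<close>, where the cutoff is
  saturated.\<close>

lemma cutoff_locally_const:
  assumes e: "0 < e" and C: "closed C" "C \<noteq> {}" and x: "x \<notin> frontier C + ball 0 e"
  obtains c where "\<And>z. z \<in> ball x (e / 2) \<Longrightarrow> cutoff C e z = c"
proof -
  have dj: "ball x e \<inter> frontier C = {}" using x by (auto simp: set_plus_ball dist_commute)
  show thesis
  proof (cases "ball x e \<inter> C = {}")
    case True
    show ?thesis
    proof (rule that[of 1])
      fix z assume z: "z \<in> ball x (e / 2)"
      obtain c where c: "c \<in> C" "infdist z C = dist z c" using infdist_attains_inf[OF C] by blast
      have "e \<le> dist x c" using True c by (auto simp: not_less disjoint_iff)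
      then have "e / 2 \<le> infdist z C" using c z dist_triangle[of x c z] by (simp add: dist_commute)
      then have "1 \<le> 2 / e * infdist z C" using e by (simp add: field_simps)
      then show "cutoff C e z = 1" by (simp add: cutoff_def)
    qed
  next
    case False
    then have sub: "ball x e \<subseteq> C" using connected_Int_frontier[of "ball x e" C] dj by auto
    show ?thesis
    proof (rule that[of 0])
      fix z assume "z \<in> ball x (e / 2)"
      then have "z \<in> C" using sub e by auto
      then show "cutoff C e z = 0" by (simp add: cutoff_def)
    qed
  qed
qed

lemma tendsto_cutoff:
  assumes C: "closed C" "C \<noteq> {}"
  shows "((\<lambda>e. cutoff C e x) \<longlongrightarrow> indicator (- C) x) (at_right 0)"
proof (cases "x \<in> C")
  case True
  then show ?thesis by (simp add: cutoff_def)
next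
  case False
  define d where "d = infdist x C"
  have d: "0 < d" using False C infdist_pos_not_in_closed[of C x] by (simp add: d_def)
  have "eventually (\<lambda>e. e \<in> {0<..<2 * d}) (at_right 0)"
    using d by (intro eventually_at_right_real) auto
  then have "eventually (\<lambda>e. cutoff C e x = 1) (at_right 0)"
  proof eventually_elim
    case (elim e)
    then have "1 \<le> 2 / e * d" by (simp add: field_simps)
    then show ?case by (simp add: cutoff_def d_def)
  qed
  then show ?thesis using False by (simp add: tendsto_eventually)
qed

text \<open>A finite lower limit provides good radii along a sequence only, not for all small radii;
  the trace is computed along this sequence.\<close>

lemma lower_minkowski_content_sequence:
  assumes fin: "lower_minkowski_content C < \<infinity>" and \<delta>: "0 < \<delta>"
  obtains M and \<epsilon> :: "nat \<Rightarrow> real" where "0 \<le> M" "\<And>j. 0 < \<epsilon> j" "\<And>j. \<epsilon> j < \<delta>" "\<epsilon> \<longlonglongrightarrow> 0"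
    "\<And>j. emeasure lebesgue (C + ball 0 (\<epsilon> j)) \<le> ennreal (M * \<epsilon> j)"
proof -
  define f where "f e = emeasure lebesgue (C + ball 0 e) / ennreal (2 * e)" for e
  have "Liminf (at_right 0) f < \<infinity>" using fin by (simp add: lower_minkowski_content_def f_def[abs_def])
  then obtain M' where M': "Liminf (at_right 0) f = ennreal M'" "0 \<le> M'"
    by (cases "Liminf (at_right 0) f") auto
  \<comment> \<open>The summand 1 makes the inequality strict, so quotients below \<open>M\<close>
    occur at arbitrarily small radii.\<close>
  define M where "M = M' + 1"
  have M: "Liminf (at_right 0) f < ennreal M" "0 \<le> M"
    unfolding M' using M'(2) by (auto simp: M_def intro!: ennreal_lessI)
  have "\<exists>e. 0 < e \<and> e < \<delta> \<and> e < inverse (real (Suc j)) \<and> f e < ennreal M" for j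
  proof (rule ccontr)
    assume *: "\<not> ?thesis"
    define m where "m = min \<delta> (inverse (real (Suc j)))"
    have "eventually (\<lambda>e. e \<in> {0<..<m}) (at_right 0)"
      using \<delta> by (intro eventually_at_right_real) (auto simp: m_def)
    then have "eventually (\<lambda>e. ennreal M \<le> f e) (at_right 0)"
    proof eventually_elim
      case (elim e)
      then show ?case using * by (auto simp: m_def)
    qed
    from Liminf_bounded[OF this] M show False by auto
  qed
  then obtain \<epsilon> where \<epsilon>: "\<And>j. 0 < \<epsilon> j" "\<And>j. \<epsilon> j < \<delta>" "\<And>j. \<epsilon> j < inverse (real (Suc j))"
    and f: "\<And>j. f (\<epsilon> j) < ennreal M" by metis
  show thesis
  \<comment> \<open>The factor 2 stems from the denominator \<open>2 * \<epsilon>\<close> in the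
    Minkowski content.\<close>
  proof (rule that[of "2 * M" \<epsilon>])
    show "\<epsilon> \<longlonglongrightarrow> 0"
      by (rule tendsto_sandwich[OF _ _ tendsto_const LIMSEQ_inverse_real_of_nat])
         (use \<epsilon> in \<open>auto intro!: always_eventually less_imp_le\<close>)
    fix j
    have "emeasure lebesgue (C + ball 0 (\<epsilon> j)) = f (\<epsilon> j) * ennreal (2 * \<epsilon> j)"
    proof -
      have ne: "ennreal (2 * \<epsilon> j) \<noteq> 0" "ennreal (2 * \<epsilon> j) < top" using \<epsilon>(1)[of j] by auto
      then show ?thesis unfolding f_def ennreal_divide_times by (simp only: ennreal_divide_self[OF ne] mult_1_right)
    qed
    also have "\<dots> \<le> ennreal M * ennreal (2 * \<epsilon> j)" using f[of j] by (intro mult_right_mono) auto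
    also have "\<dots> = ennreal (2 * M * \<epsilon> j)" using M \<epsilon>(1)[of j] by (simp add: ennreal_mult[symmetric] ac_simps)
    finally show "emeasure lebesgue (C + ball 0 (\<epsilon> j)) \<le> ennreal (2 * M * \<epsilon> j)" .
  qed (use M \<epsilon> in auto)
qed

section \<open>The normal trace\<close>

text \<open>Field, measures and cutoffs are abstract so that open and compact sets share one
  argument. \<open>P\<close> and \<open>N\<close> stand for the positive and negative parts of the
  divergence, which explains their order in the hypothesis on gradients.\<close>

lemma field_trace_representation:
  fixes F :: "'a::euclidean_space \<Rightarrow> 'a" and P N :: "'a measure"
  assumes P: "finite_measure P" and sP [measurable_cong, simp]: "sets P = sets borel"
    and N: "finite_measure N" and sN [measurable_cong, simp]: "sets N = sets borel"
    and Fm [measurable]: "F \<in> borel_measurable borel"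
    and int: "\<And>G c R. G \<in> borel_measurable borel \<Longrightarrow> (\<And>x. norm (G x) \<le> c) \<Longrightarrow> (\<And>x. R \<le> norm x \<Longrightarrow> G x = 0)
      \<Longrightarrow> integrable lborel (\<lambda>x. F x \<bullet> G x)"
    and div: "\<And>\<zeta>. \<zeta> \<in> Lip_c \<Longrightarrow> (\<integral>x. F x \<bullet> grad \<zeta> x \<partial>lborel) = (\<integral>x. \<zeta> x \<partial>N) - (\<integral>x. \<zeta> x \<partial>P)"
    and C: "compact C" "C \<noteq> {}" and fin: "lower_minkowski_content C < \<infinity>"
    and \<delta>: "0 < \<delta>" and K: "\<And>x. x \<in> C + ball 0 \<delta> \<Longrightarrow> norm (F x) \<le> K"
    and E [measurable]: "E \<in> sets borel"
    and lip: "\<And>e. 0 < e \<Longrightarrow> (2 / e)-lipschitz_on UNIV (\<psi> e)"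
    and b01: "\<And>e x. 0 < e \<Longrightarrow> 0 \<le> \<psi> e x \<and> \<psi> e x \<le> 1"
    and off: "\<And>e x. 0 < e \<Longrightarrow> x \<notin> C + ball 0 e \<Longrightarrow> grad (\<psi> e) x = 0"
    and lim: "\<And>x. ((\<lambda>e. \<psi> e x) \<longlongrightarrow> indicator E x) (at_right 0)"
  obtains \<sigma>1 \<sigma>2 :: "'a measure" where "finite_measure \<sigma>1" "finite_measure \<sigma>2" "sets \<sigma>1 = sets borel" "sets \<sigma>2 = sets borel"
    "AE x in \<sigma>1. x \<in> C" "AE x in \<sigma>2. x \<in> C"
    "\<And>\<phi>. \<phi> \<in> Lip_c \<Longrightarrow> (\<integral>x. indicator E x * \<phi> x \<partial>P) - (\<integral>x. indicator E x * \<phi> x \<partial>N)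
      + (\<integral>x. indicator E x *\<^sub>R (F x \<bullet> grad \<phi> x) \<partial>lborel) = (\<integral>x. \<phi> x \<partial>\<sigma>1) - (\<integral>x. \<phi> x \<partial>\<sigma>2)"
proof -
  interpret P: finite_measure P by fact
  interpret N: finite_measure N by fact
  obtain M \<epsilon> where M: "0 \<le> M" and \<epsilon>: "\<And>j. 0 < \<epsilon> j" "\<And>j. \<epsilon> j < \<delta>" "\<epsilon> \<longlonglongrightarrow> 0"
    and vol: "\<And>j. emeasure lebesgue (C + ball 0 (\<epsilon> j)) \<le> ennreal (M * \<epsilon> j)"
    using lower_minkowski_content_sequence[OF fin \<delta>] by metis
  define A where "A j = C + ball 0 (\<epsilon> j)" for j
  have Ao: "open (A j)" for j unfolding A_def set_plus_ball by auto
  have Am [measurable]: "A j \<in> sets borel" for j using Ao by auto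
  have Avol: "emeasure lborel (A j) \<le> ennreal (M * \<epsilon> j)" for j
    using vol[of j] Am[of j] by (simp add: A_def)
  obtain R0 where R0: "0 < R0" "\<And>x. x \<in> C \<Longrightarrow> norm x \<le> R0"
    using compact_imp_bounded[OF C(1)] by (auto simp: bounded_pos)
  define R where "R = R0 + \<delta>"
  have R: "0 < R" using R0 \<delta> by (simp add: R_def)
  have AR: "norm x < R" if "x \<in> A j" for x j
  proof -
    obtain c where "c \<in> C" "norm (x - c) < \<epsilon> j" using \<open>x \<in> A j\<close> by (auto simp: A_def set_plus_ball dist_norm norm_minus_commute)
    then show ?thesis using R0(2)[of c] \<epsilon>(2)[of j] norm_triangle_ineq2[of x c] by (simp add: R_def)
  qed
  have AK: "norm (F x) \<le> K" if "x \<in> A j" for x j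
    using that K[of x] \<epsilon>(2)[of j] by (force simp: A_def set_plus_ball)
  have K0: "0 \<le> K"
  proof -
    obtain c where "c \<in> C" using C by auto
    then have "c \<in> A 0" using \<epsilon>(1)[of 0] by (auto simp: A_def set_plus_ball intro!: bexI[of _ c])
    from AK[OF this] show ?thesis by (meson norm_ge_zero order_trans)
  qed
  define \<psi>' where "\<psi>' j = \<psi> (\<epsilon> j)" for j
  have \<psi>l: "(2 / \<epsilon> j)-lipschitz_on UNIV (\<psi>' j)" for j unfolding \<psi>'_def by (intro lip \<epsilon>)
  have \<psi>01: "0 \<le> \<psi>' j x" "\<psi>' j x \<le> 1" for j x using b01[OF \<epsilon>(1)] by (auto simp: \<psi>'_def)
  have \<psi>off: "grad (\<psi>' j) x = 0" if "x \<notin> A j" for j x unfolding \<psi>'_def using that by (intro off \<epsilon>) (simp add: A_def)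
  have [measurable]: "\<psi>' j \<in> borel_measurable borel" "grad (\<psi>' j) \<in> borel_measurable borel" for j
    by (rule borel_measurable_lipschitz[OF \<psi>l] borel_measurable_grad[OF \<psi>l])+
  have \<psi>lim: "(\<lambda>j. \<psi>' j x) \<longlonglongrightarrow> indicator E x" for x
  proof -
    have "filterlim \<epsilon> (at_right 0) sequentially"
      using \<epsilon> by (auto simp: filterlim_at intro!: always_eventually less_imp_neq[symmetric])
    from filterlim_compose[OF lim this] show ?thesis by (simp add: \<psi>'_def)
  qed
  define g where "g j x = - (F x \<bullet> grad (\<psi>' j) x)" for j x
  have [measurable]: "g j \<in> borel_measurable borel" for j unfolding g_def by measurable
  have g_off: "g j x = 0" if "x \<notin> A j" for j x using \<psi>off[OF that] by (simp add: g_def)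
  \<comment> \<open>The product of the field bound \<open>K\<close>, the gradient bound
    \<open>DIM('a) * (2 / \<epsilon> j)\<close> and the volume bound
    \<open>M * \<epsilon> j\<close>; the radii cancel.\<close>
  define H where "H = K * (real DIM('a) * 2) * M"
  have AfinI: "integrable lborel (\<lambda>x. c * indicator (A j) x)" for c :: real and j
    using Avol[of j] by (intro integrable_mult_right integrable_real_indicator) (auto simp: le_less_trans)
  have g_le: "AE x in lborel. \<bar>g j x\<bar> \<le> K * (real DIM('a) * (2 / \<epsilon> j)) * indicator (A j) x" for j
    using AE_norm_grad_le[OF \<psi>l, of j]
  proof eventually_elim
    case (elim x)
    show ?case
    proof (cases "x \<in> A j")
      case True
      have "\<bar>g j x\<bar> \<le> norm (F x) * norm (grad (\<psi>' j) x)" by (simp add: g_def Cauchy_Schwarz_ineq2)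
      also have "\<dots> \<le> K * (real DIM('a) * (2 / \<epsilon> j))"
        using elim AK[OF True] K0 by (intro mult_mono) auto
      finally show ?thesis using True by simp
    qed (simp add: g_off)
  qed
  have g_int: "integrable lborel (g j)" for j
  proof (rule Bochner_Integration.integrable_bound[OF AfinI[of "K * (real DIM('a) * (2 / \<epsilon> j))" j]])
    show "AE x in lborel. norm (g j x) \<le> norm (K * (real DIM('a) * (2 / \<epsilon> j)) * indicator (A j) x)"
      using g_le[of j] by eventually_elim (metis abs_ge_self order_trans real_norm_def)
  qed measurable
  have g_mass: "(\<integral>x. \<bar>g j x\<bar> \<partial>lborel) \<le> H" for j
  proof -
    have "(\<integral>x. \<bar>g j x\<bar> \<partial>lborel) \<le> (\<integral>x. K * (real DIM('a) * (2 / \<epsilon> j)) * indicator (A j) x \<partial>lborel)"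
      using g_int[of j] AfinI g_le[of j] by (intro integral_mono_AE) auto
    also have "\<dots> = K * (real DIM('a) * (2 / \<epsilon> j)) * measure lborel (A j)" by simp
    also have "\<dots> \<le> K * (real DIM('a) * (2 / \<epsilon> j)) * (M * \<epsilon> j)"
    proof (rule mult_left_mono)
      have "ennreal (measure lborel (A j)) \<le> ennreal (M * \<epsilon> j)"
        using Avol[of j] by (subst emeasure_eq_ennreal_measure[symmetric]) (auto simp: top_unique)
      then show "measure lborel (A j) \<le> M * \<epsilon> j" using M \<epsilon>(1)[of j] by (subst (asm) ennreal_le_iff) auto
      show "0 \<le> K * (real DIM('a) * (2 / \<epsilon> j))" using K0 \<epsilon>(1)[of j] by auto
    qed
    also have "\<dots> = H" using \<epsilon>(1)[of j] by (simp add: H_def)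
    finally show ?thesis .
  qed
  \<comment> \<open>The selection argument needs nonnegative densities, so the two parts are treated
    one after the other, the second along the subsequence found for the first.\<close>
  have split_mass: "(\<integral>x. max 0 (g j x) \<partial>lborel) \<le> H" "(\<integral>x. max 0 (- g j x) \<partial>lborel) \<le> H" for j
    by (rule order_trans[OF integral_mono g_mass[of j]]; use g_int[of j] in auto)+
  have split_int: "integrable lborel (\<lambda>x. max 0 (g j x))" "integrable lborel (\<lambda>x. max 0 (- g j x))" for j
    using g_int[of j] by auto
  have gR: "g j x = 0" if "R \<le> norm x" for j x using AR[of x j] that by (intro g_off) auto
  obtain r1 \<sigma>1 where r1: "strict_mono r1" and \<sigma>1: "finite_measure \<sigma>1" "sets \<sigma>1 = sets borel"
    and lim1: "\<And>\<phi> B. continuous_on UNIV \<phi> \<Longrightarrow> (\<And>x. \<bar>\<phi> x :: real\<bar> \<le> B) \<Longrightarrow>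
      (\<lambda>j. \<integral>x. \<phi> x * max 0 (g (r1 j) x) \<partial>lborel) \<longlonglongrightarrow> (\<integral>x. \<phi> x \<partial>\<sigma>1)"
    using weakly_convergent_subsequence[OF R, of "\<lambda>j x. max 0 (g j x)" H] gR split_mass split_int by auto
  obtain r2 \<sigma>2 where r2: "strict_mono r2" and \<sigma>2: "finite_measure \<sigma>2" "sets \<sigma>2 = sets borel"
    and lim2: "\<And>\<phi> B. continuous_on UNIV \<phi> \<Longrightarrow> (\<And>x. \<bar>\<phi> x :: real\<bar> \<le> B) \<Longrightarrow>
      (\<lambda>j. \<integral>x. \<phi> x * max 0 (- g (r1 (r2 j)) x) \<partial>lborel) \<longlonglongrightarrow> (\<integral>x. \<phi> x \<partial>\<sigma>2)"
    using weakly_convergent_subsequence[OF R, of "\<lambda>j x. max 0 (- g (r1 j) x)" H] gR split_mass split_int by auto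
  have r1i: "filterlim r1 at_top sequentially" and r2i: "filterlim r2 at_top sequentially"
    using r1 r2 by (auto intro: filterlim_subseq)
  have clC: "closed C" using C by (simp add: compact_imp_closed)
  \<comment> \<open>The test function is the distance to \<open>C\<close>, truncated at 1 to stay
    bounded. It is at most \<open>\<epsilon> j\<close> where the densities live, so its integral
    against the limit is 0 and the limit is concentrated on the closed set \<open>C\<close>. Here
    \<open>u\<close> stands for either part of the densities.\<close>
  have conc: "AE x in \<sigma>. x \<in> C"
    if \<sigma>: "finite_measure \<sigma>" "sets \<sigma> = sets borel" and r: "filterlim r at_top sequentially"
      and lim: "\<And>\<phi> B. continuous_on UNIV \<phi> \<Longrightarrow> (\<And>x. \<bar>\<phi> x :: real\<bar> \<le> B) \<Longrightarrow>
        (\<lambda>j. \<integral>x. \<phi> x * u (r j) x \<partial>lborel) \<longlonglongrightarrow> (\<integral>x. \<phi> x \<partial>\<sigma>)"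
      and u: "\<And>j x. 0 \<le> u j x \<and> u j x \<le> \<bar>g j x\<bar>" and [measurable]: "\<And>j. u j \<in> borel_measurable borel"
    for \<sigma> r u
  proof -
    define d where "d x = min 1 (infdist x C)" for x
    have dc: "continuous_on UNIV d" unfolding d_def by (intro continuous_intros)
    have [measurable]: "d \<in> borel_measurable borel" using dc by (rule borel_measurable_continuous_onI)
    have d01: "0 \<le> d x" "d x \<le> 1" for x by (auto simp: d_def infdist_nonneg)
    have l1: "(\<lambda>j. \<integral>x. d x * u (r j) x \<partial>lborel) \<longlonglongrightarrow> (\<integral>x. d x \<partial>\<sigma>)"
      using d01 by (intro lim[OF dc, of 1]) (auto simp: abs_le_iff intro: order_trans[of _ 0])
    have le: "norm (\<integral>x. d x * u j x \<partial>lborel) \<le> \<epsilon> j * H" for j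
    proof -
      have i: "integrable lborel (\<lambda>x. d x * u j x)"
      proof (rule Bochner_Integration.integrable_bound[OF g_int[of j]])
        show "AE x in lborel. norm (d x * u j x) \<le> norm (g j x)"
        proof (rule AE_I2)
          fix x
          have "d x * u j x \<le> 1 * \<bar>g j x\<bar>" using d01[of x] u[of j x] by (intro mult_mono) auto
          then show "norm (d x * u j x) \<le> norm (g j x)" using d01[of x] u[of j x] by simp
        qed
      qed measurable
      have "norm (\<integral>x. d x * u j x \<partial>lborel) = (\<integral>x. d x * u j x \<partial>lborel)"
        using d01 u by (simp add: integral_nonneg)
      also have "\<dots> \<le> (\<integral>x. \<epsilon> j * \<bar>g j x\<bar> \<partial>lborel)"
      proof (rule integral_mono[OF i])
        fix x
        show "d x * u j x \<le> \<epsilon> j * \<bar>g j x\<bar>"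
        proof (cases "x \<in> A j")
          case True
          then obtain c where "c \<in> C" "dist x c < \<epsilon> j" by (auto simp: A_def set_plus_ball dist_commute)
          then have "d x \<le> \<epsilon> j" using infdist_le[of c C x] by (simp add: d_def)
          then show ?thesis using u[of j x] d01[of x] by (intro mult_mono) auto
        qed (use g_off[of x j] u[of j x] in auto)
      qed (use g_int[of j] in auto)
      also have "\<dots> \<le> \<epsilon> j * H" using g_mass[of j] \<epsilon>(1)[of j] by (simp add: mult_left_mono)
      finally show ?thesis .
    qed
    have "(\<lambda>j. \<epsilon> j * H) \<longlonglongrightarrow> 0" using tendsto_mult_left_zero[OF \<epsilon>(3)] .
    then have "(\<lambda>j. \<integral>x. d x * u j x \<partial>lborel) \<longlonglongrightarrow> 0"
      by (rule Lim_null_comparison[rotated]) (use le in auto)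
    from filterlim_compose[OF this r] have "(\<integral>x. d x \<partial>\<sigma>) = 0" by (rule LIMSEQ_unique[OF l1])
    moreover have "integrable \<sigma> d"
      using d01 by (intro integrable_finite_borel_bounded[OF \<sigma>, of _ 1]) (auto simp: abs_le_iff intro: order_trans[of _ 0])
    ultimately have "AE x in \<sigma>. d x = 0" using d01 by (subst (asm) integral_nonneg_eq_0_iff_AE) auto
    then show ?thesis
    proof eventually_elim
      case (elim x)
      then have "infdist x C = 0" by (simp add: d_def min_def split: if_splits)
      then show ?case using in_closed_iff_infdist_zero[OF clC C(2)] by simp
    qed
  qed
  show thesis
  proof (rule that[of \<sigma>1 \<sigma>2])
    show "AE x in \<sigma>1. x \<in> C"
      by (rule conc[OF \<sigma>1 r1i, where u="\<lambda>j x. max 0 (g j x)"]) (use lim1 in auto)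
    show "AE x in \<sigma>2. x \<in> C"
      by (rule conc[OF \<sigma>2 filterlim_compose[OF r1i r2i], where u="\<lambda>j x. max 0 (- g j x)"]) (use lim2 in auto)
    fix \<phi> :: "'a \<Rightarrow> real" assume \<phi>: "\<phi> \<in> Lip_c"
    obtain L R' B where L: "L-lipschitz_on UNIV \<phi>" and R': "\<And>x. R' \<le> norm x \<Longrightarrow> grad \<phi> x = 0"
      and B: "\<And>x. \<bar>\<phi> x\<bar> \<le> B" using Lip_cE[OF \<phi>] by metis
    obtain c where c: "0 \<le> c" "\<And>x. norm (grad \<phi> x) \<le> c" using bounded_grad[OF L] by metis
    note [measurable] = borel_measurable_lipschitz[OF L] borel_measurable_grad[OF L]
    have \<phi>c: "continuous_on UNIV \<phi>" using L by (rule lipschitz_on_continuous_on)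
    have int\<phi>: "integrable lborel (\<lambda>x. F x \<bullet> grad \<phi> x)"
      by (rule int[OF _ c(2) R']) measurable
    have i: "integrable lborel (\<lambda>x. \<phi> x * u x)" if "integrable lborel u" "u \<in> borel_measurable borel" for u
    proof (rule Bochner_Integration.integrable_bound[OF integrable_mult_right[OF integrable_norm[OF that(1)], of B]])
      note [measurable] = that(2)
      show "(\<lambda>x. \<phi> x * u x) \<in> borel_measurable lborel" by measurable
      show "AE x in lborel. norm (\<phi> x * u x) \<le> norm (B * norm (u x))"
        using B by (intro AE_I2) (auto simp: abs_mult intro!: mult_right_mono intro: order_trans[OF _ abs_ge_self])
    qed
    have key: "(\<integral>x. \<phi> x * g j x \<partial>lborel) = (\<integral>x. \<psi>' j x * (F x \<bullet> grad \<phi> x) \<partial>lborel)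
        + ((\<integral>x. \<psi>' j x * \<phi> x \<partial>P) - (\<integral>x. \<psi>' j x * \<phi> x \<partial>N))" for j
    proof -
      have p: "(\<lambda>x. \<psi>' j x * \<phi> x) \<in> Lip_c"
      proof -
        have "(1 * L + B * (2 / \<epsilon> j))-lipschitz_on UNIV (\<lambda>x. \<psi>' j x * \<phi> x)"
          by (rule lipschitz_on_UNIV_mult[OF \<psi>l L]) (use \<psi>01 B in \<open>auto simp: abs_le_iff intro: order_trans[of _ 0]\<close>)
        moreover have "compact (closure {x. \<psi>' j x * \<phi> x \<noteq> 0})"
        proof (rule compact_closure[THEN iffD2], rule bounded_subset)
          show "bounded {x. \<phi> x \<noteq> 0}" using \<phi> by (auto simp: Lip_c_def)
        qed auto
        ultimately show ?thesis by (auto simp: Lip_c_def)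
      qed
      have i1: "integrable lborel (\<lambda>x. \<psi>' j x * (F x \<bullet> grad \<phi> x))"
      proof (rule Bochner_Integration.integrable_bound[OF int\<phi>])
        show "AE x in lborel. norm (\<psi>' j x * (F x \<bullet> grad \<phi> x)) \<le> norm (F x \<bullet> grad \<phi> x)"
          using \<psi>01[of j] by (intro AE_I2) (simp add: abs_mult mult_left_le_one_le)
      qed measurable
      have "(\<integral>x. \<psi>' j x * \<phi> x \<partial>N) - (\<integral>x. \<psi>' j x * \<phi> x \<partial>P) = (\<integral>x. F x \<bullet> grad (\<lambda>x. \<psi>' j x * \<phi> x) x \<partial>lborel)"
        by (rule div[OF p, symmetric])
      also have "\<dots> = (\<integral>x. \<psi>' j x * (F x \<bullet> grad \<phi> x) - \<phi> x * g j x \<partial>lborel)"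
      proof (rule integral_cong_AE)
        show "AE x in lborel. F x \<bullet> grad (\<lambda>x. \<psi>' j x * \<phi> x) x = \<psi>' j x * (F x \<bullet> grad \<phi> x) - \<phi> x * g j x"
          using AE_grad_mult[OF \<psi>l L, of j] by eventually_elim (simp add: g_def inner_add_right)
        obtain L' where "L'-lipschitz_on UNIV (\<lambda>x. \<psi>' j x * \<phi> x)" using p by (auto simp: Lip_c_def)
        note [measurable] = borel_measurable_grad[OF this]
        show "(\<lambda>x. F x \<bullet> grad (\<lambda>x. \<psi>' j x * \<phi> x) x) \<in> borel_measurable lborel" by measurable
      qed measurable
      also have "\<dots> = (\<integral>x. \<psi>' j x * (F x \<bullet> grad \<phi> x) \<partial>lborel) - (\<integral>x. \<phi> x * g j x \<partial>lborel)"
        by (rule Bochner_Integration.integral_diff[OF i1 i[OF g_int]]) measurable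
      finally show ?thesis by simp
    qed
    \<comment> \<open>The cutoffs converge at every point, frontier included, so the limit is valid
      for any finite Borel measure whatever sets it charges.\<close>
    have mlim: "(\<lambda>j. \<integral>x. \<psi>' j x * \<phi> x \<partial>Q) \<longlonglongrightarrow> (\<integral>x. indicator E x * \<phi> x \<partial>Q)"
      if Q: "finite_measure Q" and [measurable_cong]: "sets Q = sets borel" for Q
    proof (rule integral_dominated_convergence[where w="\<lambda>x. B"])
      interpret finite_measure Q by (rule Q)
      show "integrable Q (\<lambda>x. B)" by simp
      show "AE x in Q. (\<lambda>j. \<psi>' j x * \<phi> x) \<longlonglongrightarrow> indicator E x * \<phi> x"
        by (intro AE_I2 tendsto_mult \<psi>lim tendsto_const)
      show "AE x in Q. norm (\<psi>' j x * \<phi> x) \<le> B" for j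
      proof (rule AE_I2)
        fix x
        have "norm (\<psi>' j x * \<phi> x) \<le> \<bar>\<phi> x\<bar>" using \<psi>01[of j x] by (simp add: abs_mult mult_left_le_one_le)
        then show "norm (\<psi>' j x * \<phi> x) \<le> B" using B[of x] by linarith
      qed
    qed measurable
    have flim: "(\<lambda>j. \<integral>x. \<psi>' j x * (F x \<bullet> grad \<phi> x) \<partial>lborel) \<longlonglongrightarrow> (\<integral>x. indicator E x *\<^sub>R (F x \<bullet> grad \<phi> x) \<partial>lborel)"
    proof (rule integral_dominated_convergence[OF _ _ integrable_norm[OF int\<phi>]])
      show "AE x in lborel. (\<lambda>j. \<psi>' j x * (F x \<bullet> grad \<phi> x)) \<longlonglongrightarrow> indicator E x *\<^sub>R (F x \<bullet> grad \<phi> x)"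
        unfolding real_scaleR_def by (intro AE_I2 tendsto_mult \<psi>lim tendsto_const)
      show "AE x in lborel. norm (\<psi>' j x * (F x \<bullet> grad \<phi> x)) \<le> norm (F x \<bullet> grad \<phi> x)" for j
        using \<psi>01[of j] by (intro AE_I2) (simp add: abs_mult mult_left_le_one_le)
    qed measurable
    let ?T = "(\<integral>x. indicator E x * \<phi> x \<partial>P) - (\<integral>x. indicator E x * \<phi> x \<partial>N)
      + (\<integral>x. indicator E x *\<^sub>R (F x \<bullet> grad \<phi> x) \<partial>lborel)"
    have "(\<lambda>j. \<integral>x. \<phi> x * g j x \<partial>lborel) \<longlonglongrightarrow> (\<integral>x. indicator E x *\<^sub>R (F x \<bullet> grad \<phi> x) \<partial>lborel)
       + ((\<integral>x. indicator E x * \<phi> x \<partial>P) - (\<integral>x. indicator E x * \<phi> x \<partial>N))"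
      unfolding key by (intro tendsto_add tendsto_diff flim mlim P N sP sN)
    then have "(\<lambda>j. \<integral>x. \<phi> x * g j x \<partial>lborel) \<longlonglongrightarrow> ?T" by (simp add: add.commute)
    from filterlim_compose[OF this filterlim_compose[OF r1i r2i]]
    have T1: "(\<lambda>j. \<integral>x. \<phi> x * g (r1 (r2 j)) x \<partial>lborel) \<longlonglongrightarrow> ?T" .
    have T2: "(\<lambda>j. (\<integral>x. \<phi> x * max 0 (g (r1 (r2 j)) x) \<partial>lborel) - (\<integral>x. \<phi> x * max 0 (- g (r1 (r2 j)) x) \<partial>lborel))
        \<longlonglongrightarrow> (\<integral>x. \<phi> x \<partial>\<sigma>1) - (\<integral>x. \<phi> x \<partial>\<sigma>2)"
      by (intro tendsto_diff lim2[OF \<phi>c B] filterlim_compose[OF lim1[OF \<phi>c B] r2i])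
    have "(\<integral>x. \<phi> x * max 0 (g j x) \<partial>lborel) - (\<integral>x. \<phi> x * max 0 (- g j x) \<partial>lborel) = (\<integral>x. \<phi> x * g j x \<partial>lborel)" for j
    proof -
      have "(\<integral>x. \<phi> x * max 0 (g j x) \<partial>lborel) - (\<integral>x. \<phi> x * max 0 (- g j x) \<partial>lborel)
        = (\<integral>x. \<phi> x * max 0 (g j x) - \<phi> x * max 0 (- g j x) \<partial>lborel)"
        by (intro Bochner_Integration.integral_diff[symmetric] i split_int) measurable
      also have "\<dots> = (\<integral>x. \<phi> x * g j x \<partial>lborel)"
        by (intro Bochner_Integration.integral_cong) (auto simp: max_def)
      finally show ?thesis .
    qed
    then show "?T = (\<integral>x. \<phi> x \<partial>\<sigma>1) - (\<integral>x. \<phi> x \<partial>\<sigma>2)"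
      using LIMSEQ_unique[OF T1] T2 by simp
  qed (use \<sigma>1 \<sigma>2 in auto)
qed

text \<open>The empty set is treated apart because it has no frontier points, while the main
  argument works near a nonempty frontier; the zero measure represents its trace.\<close>

lemma normal_trace_is_measure_empty: "normal_trace_is_measure \<Omega> F {}"
proof -
  define Z where "Z = null_measure (borel :: 'a measure)"
  have Z: "finite_measure Z" "sets Z = sets borel"
    unfolding Z_def by (auto intro: finite_measureI)
  have ae: "AE x in Z. x \<in> frontier {}" by (simp add: Z_def AE_iff_null null_sets_def)
  have "normal_trace \<Omega> F {} \<phi> = signed_integral (frontier {}) (\<lambda>B. measure Z B - measure Z B) \<phi>"
    if \<phi>: "\<phi> \<in> Lip_c" for \<phi>
  proof -
    obtain L R B where L: "L-lipschitz_on UNIV \<phi>" and B: "\<And>x. \<bar>\<phi> x\<bar> \<le> B" using Lip_cE[OF \<phi>] by metis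
    have "signed_integral (frontier {}) (\<lambda>B. measure Z B - measure Z B) \<phi> = integral\<^sup>L Z \<phi> - integral\<^sup>L Z \<phi>"
      by (rule signed_integral_diff[OF Z(1,1,2,2) _ ae ae borel_measurable_lipschitz[OF L] B]) simp
    then show ?thesis by (simp add: normal_trace_def signed_integral_def set_lebesgue_integral_def)
  qed
  then show ?thesis
    unfolding normal_trace_is_measure_def
    using signed_radon_measure_diff[OF Z(1,1,2,2)] by blast
qed

text \<open>This transfers the abstract representation to the given field and leaves open only the
  choice of cutoffs, which differs for open and compact sets.\<close>

lemma normal_trace_is_measure_if_newton_field:
  fixes \<Omega> :: "'a::euclidean_space set" and F :: "'a \<Rightarrow> 'a"
  defines "\<mu> \<equiv> div_measure \<Omega> F"
  assumes \<Omega>: "open \<Omega>" and \<mu>: "signed_radon_measure \<Omega> \<mu>" and S: "compact (signed_support \<Omega> \<mu>)"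
    and Fm: "F \<in> borel_measurable (lebesgue_on \<Omega>)"
    and rep: "AE x in lebesgue_on \<Omega>.
       F x = (1 / (real DIM('a) * measure lebesgue (ball (0::'a) 1))) *\<^sub>R
             signed_integral \<Omega> \<mu> (\<lambda>y. (x - y) /\<^sub>R norm (x - y) ^ DIM('a))"
    and E: "E \<in> sets borel" "E \<subseteq> \<Omega>" and C: "compact (frontier E)" "frontier E \<noteq> {}"
    and fin: "lower_minkowski_content (frontier E) < \<infinity>" and dj: "signed_support \<Omega> \<mu> \<inter> frontier E = {}"
    and lip: "\<And>e. 0 < e \<Longrightarrow> (2 / e)-lipschitz_on UNIV (\<psi> e)"
    and b01: "\<And>e x. 0 < e \<Longrightarrow> 0 \<le> \<psi> e x \<and> \<psi> e x \<le> 1"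
    and off: "\<And>e x. 0 < e \<Longrightarrow> x \<notin> frontier E + ball 0 e \<Longrightarrow> grad (\<psi> e) x = 0"
    and lim: "\<And>x. ((\<lambda>e. \<psi> e x) \<longlongrightarrow> indicator E x) (at_right 0)"
  shows "normal_trace_is_measure \<Omega> F E"
proof -
  define P where "P = pos_part_measure \<Omega> \<mu>"
  define N where "N = pos_part_measure \<Omega> (\<lambda>A. - \<mu> A)"
  note \<mu>' = signed_radon_measure_uminus[OF \<mu>]
  have \<Omega>b: "\<Omega> \<in> sets borel" using \<Omega> by simp
  have P: "finite_measure P" "sets P = sets borel"
    using finite_pos_part_measure[OF \<mu> \<Omega>b] by (auto simp: P_def)
  have N: "finite_measure N" "sets N = sets borel"
    using finite_pos_part_measure[OF \<mu>' \<Omega>b] by (auto simp: N_def)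
  have clS: "closed (signed_support \<Omega> \<mu>)" using S by (rule compact_imp_closed)
  have PS: "AE y in P. y \<in> signed_support \<Omega> \<mu>"
    unfolding P_def by (rule AE_pos_part_measure_support[OF \<mu> clS])
  have NS: "AE y in N. y \<in> signed_support \<Omega> \<mu>"
    unfolding N_def using AE_pos_part_measure_support[OF \<mu>'] clS by (simp add: signed_support_uminus)
  define k where "k = real DIM('a) * unit_ball_vol DIM('a)"
  have k: "0 < k" by (simp add: k_def)
  have k': "real DIM('a) * measure lebesgue (ball (0::'a) 1) = k" by (simp add: k_def content_ball)
  \<comment> \<open>A Borel field on the whole space. The Jordan parts of the divergence turn the
    representation formula into a difference of two Newtonian fields, equal to \<open>F\<close>
    almost everywhere in \<Omega>.\<close>
  define G where "G x = (1 / k) *\<^sub>R (newton_field P x - newton_field N x)" for x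
  note [measurable] = borel_measurable_newton_field[OF P] borel_measurable_newton_field[OF N]
  have Gm [measurable]: "G \<in> borel_measurable borel" unfolding G_def[abs_def] by measurable
  have Gin: "G x \<bullet> v = (newton_field P x \<bullet> v - newton_field N x \<bullet> v) / k" for x v
    by (simp add: G_def inner_diff_left)
  have rep': "AE x in lebesgue. x \<in> \<Omega> \<longrightarrow> F x = G x"
    using rep \<Omega>b unfolding k' by (subst (asm) AE_restrict_space_iff)
      (auto simp: signed_integral_def newton_field_def newton_kernel_def G_def P_def N_def)
  have Gint: "integrable lborel (\<lambda>x. G x \<bullet> H x)"
    if "H \<in> borel_measurable borel" "\<And>x. norm (H x) \<le> c" "\<And>x. R \<le> norm x \<Longrightarrow> H x = 0" for H c R
    unfolding Gin using integrable_newton_field_inner[OF P that] integrable_newton_field_inner[OF N that] by auto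
  have Gdiv: "(\<integral>x. G x \<bullet> grad \<zeta> x \<partial>lborel) = (\<integral>x. \<zeta> x \<partial>N) - (\<integral>x. \<zeta> x \<partial>P)" if \<zeta>: "\<zeta> \<in> Lip_c" for \<zeta>
  proof -
    obtain L R where L: "L-lipschitz_on UNIV \<zeta>" and R: "\<And>x. R \<le> norm x \<Longrightarrow> grad \<zeta> x = 0" using Lip_cE[OF \<zeta>] by metis
    obtain c where c: "\<And>x. norm (grad \<zeta> x) \<le> c" using bounded_grad[OF L] by metis
    note H = borel_measurable_grad[OF L] c R
    have "(\<integral>x. G x \<bullet> grad \<zeta> x \<partial>lborel)
       = ((\<integral>x. newton_field P x \<bullet> grad \<zeta> x \<partial>lborel) - (\<integral>x. newton_field N x \<bullet> grad \<zeta> x \<partial>lborel)) / k"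
      unfolding Gin integral_divide_zero
      by (subst Bochner_Integration.integral_diff) (auto intro: integrable_newton_field_inner[OF P H] integrable_newton_field_inner[OF N H])
    also have "\<dots> = (- (k * (\<integral>x. \<zeta> x \<partial>P)) - - (k * (\<integral>x. \<zeta> x \<partial>N))) / k"
      by (simp only: integral_newton_field_grad[OF P \<zeta>] integral_newton_field_grad[OF N \<zeta>] k_def)
    also have "\<dots> = k * ((\<integral>x. \<zeta> x \<partial>N) - (\<integral>x. \<zeta> x \<partial>P)) / k" by (simp add: right_diff_distrib)
    finally show ?thesis using k by simp
  qed
  \<comment> \<open>The compact support and the closed frontier are disjoint, hence at a positive
    distance \<open>d\<close>. The neighbourhood of the frontier of radius \<open>d / 2\<close> then
    stays \<open>d / 2\<close> away from the support.\<close>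
  obtain d where d: "0 < d" "\<And>y x. y \<in> signed_support \<Omega> \<mu> \<Longrightarrow> x \<in> frontier E \<Longrightarrow> d \<le> dist y x"
    using separate_compact_closed[OF S frontier_closed dj] by blast
  define K where "K = (measure P UNIV + measure N UNIV) * inverse ((d / 2) ^ (DIM('a) - 1)) / k"
  have GK: "norm (G x) \<le> K" if x: "x \<in> frontier E + ball 0 (d / 2)" for x
  proof -
    obtain c where c: "c \<in> frontier E" "dist c x < d / 2" using x by (auto simp: set_plus_ball)
    have r: "d / 2 \<le> norm (x - y)" if "y \<in> signed_support \<Omega> \<mu>" for y
      using d(2)[OF that c(1)] c(2) dist_triangle[of y c x] by (simp add: dist_norm norm_minus_commute)
    have "norm (newton_field P x - newton_field N x) \<le> norm (newton_field P x) + norm (newton_field N x)"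
      by (rule norm_triangle_ineq4)
    also have "\<dots> \<le> measure P UNIV * inverse ((d / 2) ^ (DIM('a) - 1)) + measure N UNIV * inverse ((d / 2) ^ (DIM('a) - 1))"
      by (intro add_mono norm_newton_field_le[OF P PS _ r] norm_newton_field_le[OF N NS _ r]) (use d in auto)
    finally have "norm (newton_field P x - newton_field N x) \<le> (measure P UNIV + measure N UNIV) * inverse ((d / 2) ^ (DIM('a) - 1))"
      by (simp only: distrib_right)
    then show ?thesis using k unfolding G_def K_def by (simp add: divide_right_mono)
  qed
  have d2: "0 < d / 2" using d by simp
  obtain \<sigma>1 \<sigma>2 :: "'a measure" where \<sigma>: "finite_measure \<sigma>1" "finite_measure \<sigma>2" "sets \<sigma>1 = sets borel" "sets \<sigma>2 = sets borel"
    and ae: "AE x in \<sigma>1. x \<in> frontier E" "AE x in \<sigma>2. x \<in> frontier E"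
    and trace: "\<And>\<phi>. \<phi> \<in> Lip_c \<Longrightarrow> (\<integral>x. indicator E x * \<phi> x \<partial>P) - (\<integral>x. indicator E x * \<phi> x \<partial>N)
      + (\<integral>x. indicator E x *\<^sub>R (G x \<bullet> grad \<phi> x) \<partial>lborel) = (\<integral>x. \<phi> x \<partial>\<sigma>1) - (\<integral>x. \<phi> x \<partial>\<sigma>2)"
    by (rule field_trace_representation[where F=G and \<psi>=\<psi> and K=K,
          OF P N Gm Gint Gdiv C fin d2 GK E(1) lip b01 off lim]; (assumption | rule that))
  show ?thesis
    unfolding normal_trace_is_measure_def
  proof (intro exI conjI ballI)
    show "signed_radon_measure (frontier E) (\<lambda>B. measure \<sigma>1 B - measure \<sigma>2 B)"
      by (rule signed_radon_measure_diff[OF \<sigma>])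
    fix \<phi> :: "'a \<Rightarrow> real" assume \<phi>: "\<phi> \<in> Lip_c"
    obtain L R B where L: "L-lipschitz_on UNIV \<phi>" and B: "\<And>x. \<bar>\<phi> x\<bar> \<le> B" using Lip_cE[OF \<phi>] by metis
    note [measurable] = borel_measurable_lipschitz[OF L] borel_measurable_grad[OF L] E(1)
    have si: "signed_integral (frontier E) (\<lambda>B. measure \<sigma>1 B - measure \<sigma>2 B) \<phi> = integral\<^sup>L \<sigma>1 \<phi> - integral\<^sup>L \<sigma>2 \<phi>"
      by (rule signed_integral_diff[OF \<sigma> _ ae borel_measurable_lipschitz[OF L] B]) (simp add: frontier_closed borel_closed)
    \<comment> \<open>Measurability of \<open>F\<close> and its formula are known on \<Omega> only.
      As \<open>E\<close> is contained in \<Omega>, inserting the indicator of \<Omega> leaves the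
      integrand unchanged and makes it measurable on the whole space.\<close>
    have "(LINT x:E|lebesgue. F x \<bullet> grad \<phi> x) = (\<integral>x. indicator E x *\<^sub>R (G x \<bullet> grad \<phi> x) \<partial>lebesgue)"
      unfolding set_lebesgue_integral_def
    proof (rule integral_cong_AE)
      show "AE x in lebesgue. indicator E x *\<^sub>R (F x \<bullet> grad \<phi> x) = indicator E x *\<^sub>R (G x \<bullet> grad \<phi> x)"
        using rep' by eventually_elim (use E(2) in \<open>auto simp: indicator_def\<close>)
      have F': "(\<lambda>x. indicator \<Omega> x *\<^sub>R F x) \<in> borel_measurable lebesgue"
        using Fm \<Omega>b by (subst (asm) borel_measurable_restrict_space_iff) auto
      have g': "grad \<phi> \<in> borel_measurable lebesgue" and i': "indicator E \<in> borel_measurable lebesgue"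
        by (intro measurable_completion; simp)+
      have "(\<lambda>x. indicator E x *\<^sub>R ((indicator \<Omega> x *\<^sub>R F x) \<bullet> grad \<phi> x)) \<in> borel_measurable lebesgue"
        by (intro borel_measurable_scaleR borel_measurable_inner i' F' g')
      moreover have "(\<lambda>x. indicator E x *\<^sub>R ((indicator \<Omega> x *\<^sub>R F x) \<bullet> grad \<phi> x)) = (\<lambda>x. indicator E x *\<^sub>R (F x \<bullet> grad \<phi> x))"
        using E(2) by (auto simp: indicator_def fun_eq_iff)
      ultimately show "(\<lambda>x. indicator E x *\<^sub>R (F x \<bullet> grad \<phi> x)) \<in> borel_measurable lebesgue" by simp
      show "(\<lambda>x. indicator E x *\<^sub>R (G x \<bullet> grad \<phi> x)) \<in> borel_measurable lebesgue"
        by (rule measurable_completion) measurable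
    qed
    also have "\<dots> = (\<integral>x. indicator E x *\<^sub>R (G x \<bullet> grad \<phi> x) \<partial>lborel)"
      by (rule integral_completion) measurable
    finally show "normal_trace \<Omega> F E \<phi> = signed_integral (frontier E) (\<lambda>B. measure \<sigma>1 B - measure \<sigma>2 B) \<phi>"
      using trace[OF \<phi>] unfolding si normal_trace_def
      by (simp add: signed_integral_def P_def N_def \<mu>_def)
  qed
qed

section \<open>Frontiers, and cutoffs for open and compact sets\<close>

lemma frontier_nonempty_if_bounded:
  fixes E :: "'a::euclidean_space set"
  assumes "bounded E" "E \<noteq> {}"
  shows "frontier E \<noteq> {}"
  using assms not_bounded_UNIV frontier_eq_empty by metis

lemma grad_cutoff_off_frontier:
  assumes "0 < e" "closed C" "C \<noteq> {}" "x \<notin> frontier C + ball 0 e"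
  shows "grad (cutoff C e) x = 0" "grad (\<lambda>x. 1 - cutoff C e x) x = 0"
proof -
  obtain c where c: "\<And>z. z \<in> ball x (e / 2) \<Longrightarrow> cutoff C e z = c"
    using cutoff_locally_const[OF assms] by metis
  show "grad (cutoff C e) x = 0"
    by (rule grad_locally_const[of "e / 2"]) (use assms(1) c in auto)
  show "grad (\<lambda>x. 1 - cutoff C e x) x = 0"
    by (rule grad_locally_const[of "e / 2" _ _ "1 - c"]) (use assms(1) c in auto)
qed

lemma lower_minkowski_content_mono:
  fixes A B :: "'a::euclidean_space set"
  assumes "A \<subseteq> B"
  shows "lower_minkowski_content A \<le> lower_minkowski_content B"
  unfolding lower_minkowski_content_def
proof (intro Liminf_mono always_eventually allI divide_right_mono_ennreal emeasure_mono)
  fix e :: real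
  show "A + ball 0 e \<subseteq> B + ball 0 e" using assms by (auto simp: set_plus_ball)
  have "open (B + ball 0 e)" by (auto simp: set_plus_ball)
  then show "B + ball 0 e \<in> sets lebesgue" by simp
qed

theorem proposition6p1:
  fixes \<Omega> :: "'a::euclidean_space set" and F :: "'a \<Rightarrow> 'a" and p :: ennreal
  assumes "open \<Omega>"
    and "1 \<le> p"
    and "F \<in> DM p \<Omega>"
    and "compact (signed_support \<Omega> (div_measure \<Omega> F))"
    and "AE x in lebesgue_on \<Omega>.
           F x = (1 / (real DIM('a) * measure lebesgue (ball (0::'a) 1))) *\<^sub>R
             signed_integral \<Omega> (div_measure \<Omega> F) (\<lambda>y. (x - y) /\<^sub>R norm (x - y) ^ DIM('a))"
  shows "(\<forall>U. open U \<and> bounded U \<and> U \<subseteq> \<Omega> \<and> lower_minkowski_content (frontier U) < \<infinity> \<and>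
              signed_support \<Omega> (div_measure \<Omega> F) \<subseteq> U \<longrightarrow>
            normal_trace_is_measure \<Omega> F U \<and>
            (compact (closure U) \<and> closure U \<subseteq> \<Omega> \<longrightarrow> normal_trace_is_measure \<Omega> F (closure U))) \<and>
         (\<forall>K. compact K \<and> K \<subseteq> \<Omega> \<and> lower_minkowski_content (frontier K) < \<infinity> \<and>
              signed_support \<Omega> (div_measure \<Omega> F) \<inter> frontier K = {} \<longrightarrow>
            normal_trace_is_measure \<Omega> F K)"
proof -
  have "\<exists>\<mu>. is_divergence \<Omega> F \<mu>" using assms(3) by (simp add: DM_def)
  then have "is_divergence \<Omega> F (div_measure \<Omega> F)" unfolding div_measure_def by (rule someI_ex)
  then have \<mu>: "signed_radon_measure \<Omega> (div_measure \<Omega> F)" by (simp add: is_divergence_def)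
  have Fm: "F \<in> borel_measurable (lebesgue_on \<Omega>)" using assms(3) by (simp add: DM_def Lp_field_def)
  note main = normal_trace_is_measure_if_newton_field[OF assms(1) \<mu> assms(4) Fm assms(5)]
  have openU: "normal_trace_is_measure \<Omega> F U"
    if U: "open U" "bounded U" "U \<subseteq> \<Omega>" "lower_minkowski_content (frontier U) < \<infinity>"
      "signed_support \<Omega> (div_measure \<Omega> F) \<subseteq> U" for U
  proof (cases "U = {}")
    case False
    \<comment> \<open>The complement must be nonempty: the distance to the empty set is 0 by
      convention, and the cutoff would vanish identically.\<close>
    have "U \<noteq> UNIV" using U(2) not_bounded_UNIV by auto
    then have C: "closed (- U)" "- U \<noteq> {}" using U(1) by (auto simp: closed_Compl)
    show ?thesis
    \<comment> \<open>Distance from the complement gives cutoffs that vanish off \<open>U\<close>,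
      frontier included, and tend to 1 at each point of \<open>U\<close>. A set and its complement
      have the same frontier.\<close>
    proof (rule main[where \<psi>="cutoff (- U)"])
      show "frontier U \<noteq> {}" using U(2) False by (rule frontier_nonempty_if_bounded)
      show "signed_support \<Omega> (div_measure \<Omega> F) \<inter> frontier U = {}"
        using U(1,5) frontier_disjoint_eq[of U] by blast
      show "grad (cutoff (- U) e) x = 0" if "0 < e" "x \<notin> frontier U + ball 0 e" for e x
        using that C by (intro grad_cutoff_off_frontier) auto
      show "((\<lambda>e. cutoff (- U) e x) \<longlongrightarrow> indicator U x) (at_right 0)" for x
        using tendsto_cutoff[OF C, of x] by simp
    qed (use U in \<open>auto intro: lipschitz_cutoff compact_frontier_bounded simp: cutoff_bounds\<close>)
  qed (simp add: normal_trace_is_measure_empty)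
  have cpt: "normal_trace_is_measure \<Omega> F K"
    if K: "compact K" "K \<subseteq> \<Omega>" "lower_minkowski_content (frontier K) < \<infinity>"
      "signed_support \<Omega> (div_measure \<Omega> F) \<inter> frontier K = {}" for K
  proof (cases "K = {}")
    case False
    have C: "closed K" using K by (simp add: compact_imp_closed)
    show ?thesis
    \<comment> \<open>For a compact set the cutoffs are 1 on all of \<open>K\<close>, frontier
      included, and fall to 0 outside, as convergence to its indicator requires.\<close>
    proof (rule main[where \<psi>="\<lambda>e x. 1 - cutoff K e x"])
      show "frontier K \<noteq> {}" using compact_imp_bounded[OF K(1)] False by (rule frontier_nonempty_if_bounded)
      show "compact (frontier K)" using K(1) by (rule compact_frontier)
      show "(2 / e)-lipschitz_on UNIV (\<lambda>x. 1 - cutoff K e x)" if "0 < e" for e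
        using lipschitz_cutoff[OF that, of K] by (simp add: lipschitz_on_def dist_real_def abs_minus_commute)
      show "grad (\<lambda>x. 1 - cutoff K e x) x = 0" if "0 < e" "x \<notin> frontier K + ball 0 e" for e x
        using that C False by (intro grad_cutoff_off_frontier)
      show "((\<lambda>e. 1 - cutoff K e x) \<longlongrightarrow> indicator K x) (at_right 0)" for x
      proof -
        have "((\<lambda>e. 1 - cutoff K e x) \<longlongrightarrow> 1 - indicator (- K) x) (at_right 0)"
          by (intro tendsto_diff tendsto_const tendsto_cutoff C False)
        moreover have "1 - indicator (- K) x = (indicator K x :: real)" by (simp add: indicator_def)
        ultimately show ?thesis by simp
      qed
    qed (use K C in \<open>auto simp: cutoff_bounds\<close>)
  qed (simp add: normal_trace_is_measure_empty)
  have clU: "normal_trace_is_measure \<Omega> F (closure U)"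
    if U: "open U" "lower_minkowski_content (frontier U) < \<infinity>"
      "signed_support \<Omega> (div_measure \<Omega> F) \<subseteq> U" "compact (closure U)" "closure U \<subseteq> \<Omega>" for U
  proof (rule cpt[OF U(4,5)])
    \<comment> \<open>Closing \<open>U\<close> can only enlarge the interior, so frontier points may
      be lost, for instance along a slit, but none are gained; the content hypothesis is
      inherited.\<close>
    have sub: "frontier (closure U) \<subseteq> frontier U" 
      using interior_mono[OF closure_subset[of U]] by (auto simp: frontier_def)
    show "lower_minkowski_content (frontier (closure U)) < \<infinity>"
      using lower_minkowski_content_mono[OF sub] U(2) by (rule le_less_trans)
    show "signed_support \<Omega> (div_measure \<Omega> F) \<inter> frontier (closure U) = {}"
      using sub U(1,3) frontier_disjoint_eq[of U] by blast
  qed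
  show ?thesis using openU cpt clU by blast
qed

end
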